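(* Let $a,b,c,n$ be positive integers with $a+b=n$ and $c\leq n$. Then $\operatorname{ind}\mathfrak{p}_n^{\mathrm C}((a,b)\mid(c))=0$ if and only if one of the following conditions holds: (i) $c=n-1$ and $\gcd(a+b,\,b+c)=1$; (ii) $c=n-2$ and $\gcd(a+b,\,b+c)=1$; (iii) $c=n-3$, the integers $a$, $b$, and $c$ are all odd, and $\gcd(a+b,\,b+c)=2$.
   Context: The ground field is algebraically closed of characteristic zero. Index. For a Lie algebra $\mathfrak{g}$, $\operatorname{ind}\mathfrak{g}=\min_{f\in\mathfrak{g}^*}\dim\ker(B_f)$, where $B_f(x,y)=f([x,y])$ for $x,y\in\mathfrak{g}$. Symplectic Lie algebra. $\mathfrak{sp}(2n)$ is the Lie algebra of $2n\times 2n$ block matrices $\begin{bmatrix}A&B\\C&-\widehat{A}\end{bmatrix}$ with $A,B,C$ of size $n\times n$, $B=\widehat{B}$, $C=\widehat{C}$, where $\widehat{X}$ is the transpose of $X$ with respect to the antidiagonal. Use the triangular decomposition $\mathfrak{sp}(2n)=\mathfrak{u}_+\oplus\mathfrak{h}\oplus\mathfrak{u}_-$ into strictly upper triangular, diagonal, and strictly lower triangular matrices. Let $\Pi=\{\alpha_1,\dots,\alpha_n\}$ be the simple roots in the standard order with $\alpha_n$ the exceptional (long) root: writing $\epsilon_i$ for the $i$-th diagonal entry functional on $\mathfrak h$, $\alpha_i=\epsilon_i-\epsilon_{i+1}$ for $i<n$ and $\alpha_n=2\epsilon_n$. Let $\mathfrak{g}_\alpha$ denote the root space of $\alpha$. Seaweeds.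 For $\Psi,\Psi'\subseteq\Pi$, $\mathfrak{p}_n^{\mathrm C}(\Psi\mid\Psi')$ is the (standard) seaweed subalgebra $\mathfrak{p}\cap\mathfrak{p}'$ of $\mathfrak{sp}(2n)$, where $\mathfrak{p}\supseteq\mathfrak{h}\oplus\mathfrak{u}_+$ and $\mathfrak{p}'\supseteq\mathfrak{h}\oplus\mathfrak{u}_-$ are the parabolic subalgebras determined by $\Psi=\{\alpha\in\Pi:\mathfrak{g}_{-\alpha}\not\subseteq\mathfrak{p}\}$ and $\Psi'=\{\alpha\in\Pi:\mathfrak{g}_{\alpha}\not\subseteq\mathfrak{p}'\}$. Let $C_{\leq n}$ be the set of finite strings of positive integers (possibly the empty string $\emptyset$) with sum at most $n$. For $\underline{a}=(a_1,\dots,a_m)\in C_{\leq n}$ put $\varphi_{\mathrm C}(\underline{a})=\{\alpha_{a_1},\alpha_{a_1+a_2},\dots,\alpha_{a_1+\dots+a_m}\}$ (with $\varphi_{\mathrm C}(\emptyset)=\emptyset$), and define $\mathfrak{p}_n^{\mathrm C}(\underline{a}\mid\underline{b})=\mathfrak{p}_n^{\mathrm C}(\varphi_{\mathrm C}(\underline{a})\mid\varphi_{\mathrm C}(\underline{b}))$. *)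

theory Defs
  imports
    "HOL-Computational_Algebra.Computational_Algebra"
    "HOL-Library.Function_Algebras"
begin

section \<open>Index of a Lie algebra\<close>

locale lie_algebra = vector_space scale
  for scale :: "'a::field \<Rightarrow> 'b::ab_group_add \<Rightarrow> 'b" +
  fixes br :: "'b \<Rightarrow> 'b \<Rightarrow> 'b"
  assumes br_add_left: "br (x + y) z = br x z + br y z"
    and br_add_right: "br x (y + z) = br x y + br x z"
    and br_scale_left: "br (scale c x) y = scale c (br x y)"
    and br_scale_right: "br x (scale c y) = scale c (br x y)"
    and br_self: "br x x = 0"
    and jacobi: "br x (br y z) + br y (br z x) + br z (br x y) = 0"
begin

definition lie_subalgebra :: "'b set \<Rightarrow> bool" where
  "lie_subalgebra L \<longleftrightarrow> subspace L \<and> (\<forall>x\<in>L. \<forall>y\<in>L. br x y \<in> L)"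

text \<open>
  Elements of the dual of a subalgebra \<open>L\<close> are functions required to be linear on \<open>L\<close> only;
  their values outside \<open>L\<close> are irrelevant.
\<close>

definition dual_of :: "'b set \<Rightarrow> ('b \<Rightarrow> 'a) set" where
  "dual_of L = {f. (\<forall>x\<in>L. \<forall>y\<in>L. f (x + y) = f x + f y) \<and> (\<forall>c. \<forall>x\<in>L. f (scale c x) = c * f x)}"

definition ker_B :: "'b set \<Rightarrow> ('b \<Rightarrow> 'a) \<Rightarrow> 'b set" where
  "ker_B L f = {x\<in>L. \<forall>y\<in>L. f (br x y) = 0}"

text \<open>The index of a finite-dimensional subalgebra; \<open>dim\<close> is 0 on infinite-dimensional spaces.\<close>

definition lie_index :: "'b set \<Rightarrow> nat" where
  "lie_index L = (LEAST d. \<exists>f\<in>dual_of L. d = dim (ker_B L f))"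

end

section \<open>Square matrices of varying size\<close>

text \<open>
  An \<open>N \<times> N\<close> matrix is a function of two indices, numbered from 1, that vanishes outside
  \<open>{1..N} \<times> {1..N}\<close>. All sizes thus live in one type, which is a vector space under the pointwise
  operations.
\<close>

type_synonym 'k matrix = "nat \<Rightarrow> nat \<Rightarrow> 'k"

definition mat_scale :: "'k::field \<Rightarrow> 'k matrix \<Rightarrow> 'k matrix" where
  "mat_scale c A = (\<lambda>i j. c * A i j)"

definition square_mats :: "nat \<Rightarrow> 'k::field matrix set" where
  "square_mats N = {A. \<forall>i j. A i j \<noteq> 0 \<longrightarrow> i \<in> {1..N} \<and> j \<in> {1..N}}"

definition mat_mult :: "nat \<Rightarrow> 'k::field matrix \<Rightarrow> 'k matrix \<Rightarrow> 'k matrix" where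
  "mat_mult N A B = (\<lambda>i j. \<Sum>k=1..N. A i k * B k j)"

definition commutator :: "nat \<Rightarrow> 'k::field matrix \<Rightarrow> 'k matrix \<Rightarrow> 'k matrix" where
  "commutator N A B = mat_mult N A B - mat_mult N B A"

lemma mat_mult_assoc: "mat_mult N (mat_mult N A B) C = mat_mult N A (mat_mult N B C)"
proof (intro ext)
  fix i j
  have "mat_mult N (mat_mult N A B) C i j = (\<Sum>k=1..N. \<Sum>l=1..N. A i l * B l k * C k j)"
    by (simp add: mat_mult_def sum_distrib_right)
  also have "\<dots> = (\<Sum>l=1..N. \<Sum>k=1..N. A i l * B l k * C k j)"
    by (rule sum.swap)
  also have "\<dots> = mat_mult N A (mat_mult N B C) i j"
    by (simp add: mat_mult_def sum_distrib_left mult.assoc)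
  finally show "mat_mult N (mat_mult N A B) C i j = mat_mult N A (mat_mult N B C) i j" .
qed

lemma mat_mult_linear:
  "mat_mult N (A + B) C = mat_mult N A C + mat_mult N B C"
  "mat_mult N C (A + B) = mat_mult N C A + mat_mult N C B"
  "mat_mult N (A - B) C = mat_mult N A C - mat_mult N B C"
  "mat_mult N C (A - B) = mat_mult N C A - mat_mult N C B"
  "mat_mult N (mat_scale c A) C = mat_scale c (mat_mult N A C)"
  "mat_mult N C (mat_scale c A) = mat_scale c (mat_mult N C A)"
  by (simp_all add: mat_mult_def mat_scale_def fun_eq_iff algebra_simps
      sum.distrib sum_subtractf sum_distrib_left)

interpretation gl: lie_algebra
  "mat_scale :: 'k::field \<Rightarrow> 'k matrix \<Rightarrow> 'k matrix" "commutator N" for N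
proof unfold_locales
  fix c :: 'k and x y z :: "'k matrix"
  show "commutator N (mat_scale c x) y = mat_scale c (commutator N x y)"
    and "commutator N x (mat_scale c y) = mat_scale c (commutator N x y)"
    by (simp_all add: commutator_def mat_mult_linear)
      (simp_all add: mat_scale_def fun_eq_iff algebra_simps)
qed (simp_all add: commutator_def mat_mult_linear mat_mult_assoc,
     simp_all add: mat_scale_def fun_eq_iff algebra_simps)

definition antitranspose :: "nat \<Rightarrow> 'k::field matrix \<Rightarrow> 'k matrix" where
  "antitranspose n A = (\<lambda>i j. A (n + 1 - j) (n + 1 - i))"

definition block_mat ::
    "nat \<Rightarrow> 'k::field matrix \<Rightarrow> 'k matrix \<Rightarrow> 'k matrix \<Rightarrow> 'k matrix \<Rightarrow> 'k matrix" where
  "block_mat n A B C D = (\<lambda>i j.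
     if i \<in> {1..n} \<and> j \<in> {1..n} then A i j
     else if i \<in> {1..n} \<and> j \<in> {n+1..2*n} then B i (j - n)
     else if i \<in> {n+1..2*n} \<and> j \<in> {1..n} then C (i - n) j
     else if i \<in> {n+1..2*n} \<and> j \<in> {n+1..2*n} then D (i - n) (j - n)
     else 0)"

section \<open>The symplectic Lie algebra\<close>

definition sp :: "nat \<Rightarrow> 'k::field matrix set" where
  "sp n = {block_mat n A B C (- antitranspose n A) | A B C.
     A \<in> square_mats n \<and> B \<in> square_mats n \<and> C \<in> square_mats n \<and>
     B = antitranspose n B \<and> C = antitranspose n C}"

definition cartan :: "nat \<Rightarrow> 'k::field matrix set" where
  "cartan n = {X \<in> sp n. \<forall>i j. i \<noteq> j \<longrightarrow> X i j = 0}"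

definition u_plus :: "nat \<Rightarrow> 'k::field matrix set" where
  "u_plus n = {X \<in> sp n. \<forall>i j. \<not> i < j \<longrightarrow> X i j = 0}"

definition u_minus :: "nat \<Rightarrow> 'k::field matrix set" where
  "u_minus n = {X \<in> sp n. \<forall>i j. \<not> j < i \<longrightarrow> X i j = 0}"

text \<open>
  Functionals on the Cartan subalgebra are written as functions on all matrices depending
  only on the diagonal entries.
\<close>

definition simple_root :: "nat \<Rightarrow> nat \<Rightarrow> 'k::field matrix \<Rightarrow> 'k" where
  "simple_root n i = (\<lambda>H. if i < n then H i i - H (i + 1) (i + 1) else 2 * H n n)"

definition simple_roots :: "nat \<Rightarrow> ('k::field matrix \<Rightarrow> 'k) set" where
  "simple_roots n = simple_root n ` {1..n}"

definition root_space :: "nat \<Rightarrow> ('k::field matrix \<Rightarrow> 'k) \<Rightarrow> 'k matrix set" where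
  "root_space n \<alpha> = {X \<in> sp n. \<forall>H\<in>cartan n. commutator (2 * n) H X = mat_scale (\<alpha> H) X}"

section \<open>Standard seaweed subalgebras\<close>

text \<open>
  A standard parabolic subalgebra is determined by the simple roots whose opposite root space
  (respectively, for the lower triangular Borel subalgebra, whose own root space) it misses, so
  for sets of simple roots the definite descriptions below are well defined.
\<close>

definition parabolic_plus :: "nat \<Rightarrow> ('k::field matrix \<Rightarrow> 'k) set \<Rightarrow> 'k matrix set" where
  "parabolic_plus n \<Psi> = (THE p.
     gl.lie_subalgebra (2 * n) p \<and> p \<subseteq> sp n \<and>
     {H + U | H U. H \<in> cartan n \<and> U \<in> u_plus n} \<subseteq> p \<and>
     {\<alpha> \<in> simple_roots n. \<not> root_space n (- \<alpha>) \<subseteq> p} = \<Psi>)"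

definition parabolic_minus :: "nat \<Rightarrow> ('k::field matrix \<Rightarrow> 'k) set \<Rightarrow> 'k matrix set" where
  "parabolic_minus n \<Psi>' = (THE p'.
     gl.lie_subalgebra (2 * n) p' \<and> p' \<subseteq> sp n \<and>
     {H + U | H U. H \<in> cartan n \<and> U \<in> u_minus n} \<subseteq> p' \<and>
     {\<alpha> \<in> simple_roots n. \<not> root_space n \<alpha> \<subseteq> p'} = \<Psi>')"

definition seaweed_roots ::
    "nat \<Rightarrow> ('k::field matrix \<Rightarrow> 'k) set \<Rightarrow> ('k matrix \<Rightarrow> 'k) set \<Rightarrow> 'k matrix set" where
  "seaweed_roots n \<Psi> \<Psi>' = parabolic_plus n \<Psi> \<inter> parabolic_minus n \<Psi>'"

text \<open>Meaningful for strings of positive integers with sum at most \<open>n\<close>.\<close>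

definition roots_of_string :: "nat \<Rightarrow> nat list \<Rightarrow> ('k::field matrix \<Rightarrow> 'k) set" where
  "roots_of_string n as = {simple_root n (sum_list (take k as)) | k. 1 \<le> k \<and> k \<le> length as}"

definition seaweed :: "nat \<Rightarrow> nat list \<Rightarrow> nat list \<Rightarrow> 'k::field matrix set" where
  "seaweed n as bs = seaweed_roots n (roots_of_string n as) (roots_of_string n bs)"

end

theory Submission
  imports Defs
begin

text \<open>
  Put \<open>t = n - c\<close>. The seaweed consists of the pairs \<open>(A, B)\<close> with \<open>A\<close> in \<open>gl(n)\<close> stabilizing the spans
  \<open>U\<close> of the first \<open>a\<close> and \<open>W\<close> of the last \<open>t\<close> basis vectors and \<open>B\<close> a symmetric matrix on \<open>W\<close>, so a
  functional is a pair \<open>(F, G)\<close> with \<open>G\<close> symmetric. Its kernel is trivial iff the analogous kernel is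
  trivial for \<open>(gl(U) \<times> gl(M) \<times> o(W)) \<ltimes> Hom(M, U \<oplus> W)\<close> with \<open>M\<close> of dimension \<open>n\<close>, for the functional given by
  the inclusions \<open>\<phi> : U \<rightarrow> M\<close> and \<open>\<psi> : W \<rightarrow> M\<close>, the form \<open>G\<close> on \<open>W\<close> and the endomorphism \<open>F\<close> of \<open>M\<close>.

  For arbitrary \<open>\<phi>\<close>, \<open>\<psi>\<close>, \<open>G\<close> and endomorphisms of \<open>U\<close>, \<open>M\<close>, \<open>W\<close>, the kernel is the solution space of a
  linear system. If it is trivial then the maps are in general position, and eliminating
  unknowns leaves a system of the same shape on smaller spaces. In terms of the dimensions
  \<open>(a, m, t)\<close> of \<open>U\<close>, \<open>M\<close>, \<open>W\<close>, existence of a functional with trivial kernel is equivalent to that for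
  \<open>(a, m - a - t, t)\<close> if \<open>m \<ge> a + t\<close>, to that for \<open>(a - m, m, t)\<close> if \<open>m \<le> a\<close>, and, if \<open>a \<le> m \<le> a + t\<close>, to that for
  \<open>(0, a, a + t - m)\<close> together with \<open>m - a \<le> 1\<close>, because an orthogonal Lie algebra \<open>o(m - a)\<close> splits off. The
  first two steps are the Euclidean algorithm for \<open>gcd(m, a + t)\<close>, and for \<open>m = n\<close> this is
  \<open>gcd(a + b, b + c)\<close>; the third lowers \<open>t\<close> by at most one and leads, after at most two uses, to
  \<open>(0, 0, t)\<close> with \<open>t \<le> 1\<close>, which is what limits the initial \<open>t\<close> to at most three.
\<close>

section \<open>Finitely supported matrices\<close>

text \<open>The reductions leave the class of seaweeds: after one elimination \<open>\<phi>\<close>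
  and \<open>\<psi>\<close> are no longer inclusions, and terms \<open>F1\<close>, \<open>F3\<close>
  appear on the outer spaces. The family with arbitrary maps is closed under elimination, which is
  why the linear system is stated for it.

  For data already split by one-sided inverses, each elimination is an equivalence of two linear
  systems and is proved as such. Necessity then needs only that a trivial kernel forces the
  splittings, and sufficiency only suitable data on coordinate spaces. A functional on the seaweed
  itself, however, gives inclusions with \<open>F1 = F3 = 0\<close>, so the data built for
  sufficiency must return to that shape.

  All maps live in a single ring of finitely supported matrices, a space being an idempotent.
  Changing dimensions then costs nothing, and eliminations become identities in a noncommutative
  ring without unit. Transposition in that ring supplies the bilinear forms; the trace supplies both
  the dimensions and the pairing with functionals.\<close>

typedef (overloaded) 'k fin_mat =
  "{A :: nat \<Rightarrow> nat \<Rightarrow> 'k::field. \<exists>N. \<forall>i j. A i j \<noteq> 0 \<longrightarrow> i < N \<and> j < N}"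
  morphisms entry mk_mat
  by (rule exI[of _ "\<lambda>_ _. 0"]) simp

setup_lifting type_definition_fin_mat

lemma entry_bound: "\<exists>N. \<forall>i j. entry A i j \<noteq> 0 \<longrightarrow> i < N \<and> j < N"
  using entry[of A] by simp

lemma finite_row: "finite {k. entry A i k \<noteq> 0}" and finite_col: "finite {k. entry A k i \<noteq> 0}"
  and finite_diag: "finite {k. entry A k k \<noteq> 0}"
  using entry_bound[of A] by (auto intro: finite_subset[OF _ finite_lessThan])

lemma fin_mat_eqI: "(\<And>i j. entry A i j = entry B i j) \<Longrightarrow> A = B"
  by (meson entry_inject ext)

lemma entry_mk:
  assumes "finite I" "\<And>i j. f i j \<noteq> 0 \<Longrightarrow> i \<in> I \<and> j \<in> I"
  shows "entry (mk_mat f) = f"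
proof -
  obtain N where "I \<subseteq> {..<N}" using assms(1) finite_nat_iff_bounded by auto
  with assms(2) show ?thesis by (intro mk_mat_inverse) blast
qed

instantiation fin_mat :: (field) ring
begin

lift_definition zero_fin_mat :: "'a fin_mat" is "\<lambda>_ _. 0" by simp

lift_definition plus_fin_mat :: "'a fin_mat \<Rightarrow> 'a fin_mat \<Rightarrow> 'a fin_mat"
  is "\<lambda>A B i j. A i j + B i j"
proof -
  fix A B :: "nat \<Rightarrow> nat \<Rightarrow> 'a"
  assume "\<exists>N. \<forall>i j. A i j \<noteq> 0 \<longrightarrow> i < N \<and> j < N" "\<exists>N. \<forall>i j. B i j \<noteq> 0 \<longrightarrow> i < N \<and> j < N"
  then obtain M N where "\<forall>i j. A i j \<noteq> 0 \<longrightarrow> i < M \<and> j < M" "\<forall>i j. B i j \<noteq> 0 \<longrightarrow> i < N \<and> j < N"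
    by blast
  then show "\<exists>N. \<forall>i j. A i j + B i j \<noteq> 0 \<longrightarrow> i < N \<and> j < N"
    by (intro exI[of _ "max M N"]) (metis add.right_neutral less_max_iff_disj)
qed

lift_definition uminus_fin_mat :: "'a fin_mat \<Rightarrow> 'a fin_mat" is "\<lambda>A i j. - A i j" by simp

definition minus_fin_mat :: "'a fin_mat \<Rightarrow> 'a fin_mat \<Rightarrow> 'a fin_mat" where
  "minus_fin_mat A B = A + - B"

lift_definition times_fin_mat :: "'a fin_mat \<Rightarrow> 'a fin_mat \<Rightarrow> 'a fin_mat"
  is "\<lambda>A B i j. \<Sum>k | A i k \<noteq> 0. A i k * B k j"
proof -
  fix A B :: "nat \<Rightarrow> nat \<Rightarrow> 'a"
  assume "\<exists>N. \<forall>i j. A i j \<noteq> 0 \<longrightarrow> i < N \<and> j < N" "\<exists>N. \<forall>i j. B i j \<noteq> 0 \<longrightarrow> i < N \<and> j < N"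
  then obtain M N where "\<forall>i j. A i j \<noteq> 0 \<longrightarrow> i < M \<and> j < M" "\<forall>i j. B i j \<noteq> 0 \<longrightarrow> i < N \<and> j < N"
    by blast
  then show "\<exists>N. \<forall>i j. (\<Sum>k | A i k \<noteq> 0. A i k * B k j) \<noteq> 0 \<longrightarrow> i < N \<and> j < N"
    by (intro exI[of _ "max M N"]) (smt (verit) less_max_iff_disj mem_Collect_eq mult_not_zero sum.neutral)
qed

lemma entry_times:
  assumes "finite K" "\<And>k. entry A i k * entry B k j \<noteq> 0 \<Longrightarrow> k \<in> K"
  shows "entry (A * B) i j = (\<Sum>k\<in>K. entry A i k * entry B k j)"
  unfolding times_fin_mat.rep_eq
  by (rule sum.mono_neutral_cong) (use assms finite_row in auto)

instance
proof
  fix A B C :: "'a fin_mat"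
  show "A + B + C = A + (B + C)" "A + B = B + A" "0 + A = A" "- A + A = 0"
    by (transfer; simp add: algebra_simps)+
  show "A - B = A + - B" by (simp add: minus_fin_mat_def)
  obtain N1 N2 N3 where N: "\<And>i j. entry A i j \<noteq> 0 \<Longrightarrow> i < N1 \<and> j < N1"
    "\<And>i j. entry B i j \<noteq> 0 \<Longrightarrow> i < N2 \<and> j < N2" "\<And>i j. entry C i j \<noteq> 0 \<Longrightarrow> i < N3 \<and> j < N3"
    using entry_bound by metis
  define N where "N = N1 + N2 + N3"
  have N: "i < N \<and> j < N" if "entry A i j \<noteq> 0 \<or> entry B i j \<noteq> 0 \<or> entry C i j \<noteq> 0" for i j
    using N that by (fastforce simp: N_def)
  have *: "entry (X * Y) i j = (\<Sum>k<N. entry X i k * entry Y k j)"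
    if "X \<in> {A, B, C} \<or> Y \<in> {A, B, C}" for X Y i j
    by (rule entry_times) (use that N in auto)
  show "A * B * C = A * (B * C)"
  proof (rule fin_mat_eqI)
    fix i j
    show "entry (A * B * C) i j = entry (A * (B * C)) i j"
      by (simp add: * sum_distrib_right sum_distrib_left mult.assoc) (rule sum.swap)
  qed
  show "(A + B) * C = A * C + B * C" "A * (B + C) = A * B + A * C"
    by (rule fin_mat_eqI; simp add: * plus_fin_mat.rep_eq sum.distrib algebra_simps)+
qed

end

lemmas entry_zero [simp] = zero_fin_mat.rep_eq[THEN fun_cong, THEN fun_cong]
lemmas entry_plus [simp] = plus_fin_mat.rep_eq[THEN fun_cong, THEN fun_cong]
lemmas entry_uminus [simp] = uminus_fin_mat.rep_eq[THEN fun_cong, THEN fun_cong]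

lemma entry_minus [simp]: "entry (A - B) i j = entry A i j - entry B i j"
  by (subst minus_fin_mat_def) (simp only: entry_plus entry_uminus, simp)

section \<open>Transpose and trace\<close>

lift_definition tp :: "'k::field fin_mat \<Rightarrow> 'k fin_mat" is "\<lambda>A i j. A j i"
  by blast

lemma entry_tp [simp]: "entry (tp A) i j = entry A j i"
  by transfer simp

lemma tp_simps [simp]:
  "tp (tp A) = A" "tp 0 = 0" "tp (A + B) = tp A + tp B" "tp (A - B) = tp A - tp B" "tp (- A) = - tp A"
  by (auto intro: fin_mat_eqI)

lemma tp_mult [simp]: "tp (A * B) = tp B * tp A"
proof (rule fin_mat_eqI)
  fix i j
  show "entry (tp (A * B)) i j = entry (tp B * tp A) i j"
    using entry_times[OF finite_row[of A j], where B = B and j = i]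
      entry_times[OF finite_row[of A j], where A = "tp B" and B = "tp A" and i = i and j = j]
    by (simp add: mult.commute)
qed

definition tr :: "'k::field fin_mat \<Rightarrow> 'k" where
  "tr A = (\<Sum>i | entry A i i \<noteq> 0. entry A i i)"

lemma tr_eq:
  assumes "finite I" "\<And>i. entry A i i \<noteq> 0 \<Longrightarrow> i \<in> I"
  shows "tr A = (\<Sum>i\<in>I. entry A i i)"
  unfolding tr_def by (rule sum.mono_neutral_left) (use assms in auto)

lemma tr_add [simp]: "tr (A + B) = tr A + tr B"
proof -
  let ?I = "{i. entry A i i \<noteq> 0} \<union> {i. entry B i i \<noteq> 0}"
  have "finite ?I" using finite_diag by blast
  then have "tr A = (\<Sum>i\<in>?I. entry A i i)" "tr B = (\<Sum>i\<in>?I. entry B i i)"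
    by (auto intro!: tr_eq)
  moreover have "tr (A + B) = (\<Sum>i\<in>?I. entry (A + B) i i)"
    by (rule tr_eq) (use \<open>finite ?I\<close> in auto)
  ultimately show ?thesis by (simp add: sum.distrib)
qed

lemma tr_0 [simp]: "tr 0 = 0"
  by (simp add: tr_def)

lemma tr_minus [simp]: "tr (A - B) = tr A - tr B"
  using tr_add[of "A - B" B] by simp

lemma tr_mult_commute: "tr (A * B) = tr (B * A)"
proof -
  obtain N1 N2 where N: "\<And>i j. entry A i j \<noteq> 0 \<Longrightarrow> i < N1 \<and> j < N1"
    "\<And>i j. entry B i j \<noteq> 0 \<Longrightarrow> i < N2 \<and> j < N2"
    using entry_bound by metis
  define N where "N = N1 + N2"
  have N: "i < N \<and> j < N" if "entry A i j \<noteq> 0 \<or> entry B i j \<noteq> 0" for i j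
    using N that by (fastforce simp: N_def)
  have *: "entry (X * Y) i j = (\<Sum>k<N. entry X i k * entry Y k j)"
    if "X \<in> {A, B}" for X Y i j
    by (rule entry_times) (use that N in auto)
  have "tr (X * Y) = (\<Sum>i<N. \<Sum>k<N. entry X i k * entry Y k i)" if X: "X \<in> {A, B}" for X Y
  proof -
    have "tr (X * Y) = (\<Sum>i<N. entry (X * Y) i i)"
    proof (rule tr_eq)
      fix i assume "entry (X * Y) i i \<noteq> 0"
      then have "(\<Sum>k<N. entry X i k * entry Y k i) \<noteq> 0" using *[OF X] by simp
      then obtain k where "entry X i k * entry Y k i \<noteq> 0" by (meson sum.not_neutral_contains_not_neutral)
      then have "entry X i k \<noteq> 0" by auto
      then show "i \<in> {..<N}" using N X by auto
    qed simp
    then show ?thesis using *[OF X] by simp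
  qed
  then have 1: "tr (A * B) = (\<Sum>i<N. \<Sum>k<N. entry A i k * entry B k i)"
    and 2: "tr (B * A) = (\<Sum>k<N. \<Sum>i<N. entry A i k * entry B k i)"
    by (simp_all add: mult.commute)
  show ?thesis unfolding 1 2 by (rule sum.swap)
qed

section \<open>Matrix units and coordinate projections\<close>

definition single :: "nat \<Rightarrow> nat \<Rightarrow> 'k::field \<Rightarrow> 'k fin_mat" where
  "single i j c = mk_mat (\<lambda>p q. if p = i \<and> q = j then c else 0)"

lemma entry_single [simp]: "entry (single i j c) p q = (if p = i \<and> q = j then c else 0)"
  unfolding single_def by (subst entry_mk[of "{i, j}"]) (auto split: if_splits)

lemma entry_single_times: "entry (single i j c * A) p q = (if p = i then c * entry A j q else 0)"
  by (subst entry_times[of "{j}"]) (auto split: if_splits)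

lemma entry_times_single: "entry (A * single i j c) p q = (if q = j then entry A p i * c else 0)"
  by (subst entry_times[of "{i}"]) (auto split: if_splits)

lemma tp_single [simp]: "tp (single i j c) = single j i c"
  by (rule fin_mat_eqI) auto

text \<open>The guard \<open>finite I\<close> keeps the function finitely supported; an infinite
  \<open>I\<close> yields 0.\<close>

definition dg :: "nat set \<Rightarrow> 'k::field fin_mat" where
  "dg I = mk_mat (\<lambda>i j. if i = j \<and> i \<in> I \<and> finite I then 1 else 0)"

lemma entry_dg [simp]: "finite I \<Longrightarrow> entry (dg I) i j = (if i = j \<and> i \<in> I then 1 else 0)"
  unfolding dg_def by (subst entry_mk[of I]) (auto split: if_splits)

lemma entry_dg_times: "finite I \<Longrightarrow> entry (dg I * A) i j = (if i \<in> I then entry A i j else 0)"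
  by (subst entry_times[of "{i}"]) (auto split: if_splits)

lemma entry_times_dg: "finite I \<Longrightarrow> entry (A * dg I) i j = (if j \<in> I then entry A i j else 0)"
  by (subst entry_times[of "{j}"]) (auto split: if_splits)

lemma dg_times_dg: "finite I \<Longrightarrow> finite J \<Longrightarrow> dg I * dg J = dg (I \<inter> J)"
  by (rule fin_mat_eqI) (auto simp: entry_dg_times)

lemma dg_idem [simp]: "finite I \<Longrightarrow> dg I * dg I = dg I"
  by (simp add: dg_times_dg)

lemma dg_empty [simp]: "dg {} = 0"
  by (rule fin_mat_eqI) simp

lemma tp_dg [simp]: "finite I \<Longrightarrow> tp (dg I) = dg I"
  by (rule fin_mat_eqI) auto

lemma tr_dg: "finite I \<Longrightarrow> tr (dg I :: 'k::field fin_mat) = of_nat (card I)"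
  by (subst tr_eq[of I]) (auto split: if_splits)

section \<open>Regularity and primeness of the matrix ring\<close>

lemma fin_mat_nonzero: "A \<noteq> 0 \<Longrightarrow> \<exists>i j. entry A i j \<noteq> 0"
  by (metis entry_zero fin_mat_eqI)

text \<open>McCoy's lemma on von Neumann regular elements: regularity may be tested after
  subtracting \<open>a * s * a\<close>.\<close>

lemma regular_lift:
  fixes a s b :: "'a::ring"
  assumes "(a - a * s * a) * b * (a - a * s * a) = a - a * s * a"
  shows "\<exists>b. a * b * a = a"
proof -
  \<comment> \<open>Read formally in a ring with unit, the hypothesis has
    \<open>(1 - s * a) * b * (1 - a * s)\<close> between two outer factors \<open>a\<close>;
    expanding this and adding \<open>s\<close> gives the witness.\<close>
  have "a * (b - b * a * s - s * a * b + s * a * b * a * s + s) * a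
      = (a - a * s * a) * b * (a - a * s * a) + a * s * a"
    by (simp add: left_diff_distrib right_diff_distrib distrib_left distrib_right mult.assoc)
  also have "\<dots> = a" unfolding assms by simp
  finally show ?thesis by blast
qed

text \<open>Gaussian elimination: subtracting the rank-one matrix through a nonzero entry in
  position \<open>(i, j)\<close> clears row \<open>i\<close> and fills no zero row, so the number of
  nonzero rows drops and \<open>regular_lift\<close> applies.\<close>

lemma fin_mat_regular: "\<exists>B. A * B * A = (A :: 'k::field fin_mat)"
proof (induction "card {i. \<exists>j. entry A i j \<noteq> 0}" arbitrary: A rule: less_induct)
  case less
  show ?case
  proof (cases "A = 0")
    case False
    then obtain i j where ij: "entry A i j \<noteq> 0" using fin_mat_nonzero by blast
    define S where "S = single j i (1 / entry A i j)"
    define A' where "A' = A - A * S * A"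
    have entA': "entry A' p q = entry A p q - entry A p j * (1 / entry A i j) * entry A i q" for p q
      unfolding A'_def S_def entry_minus mult.assoc
      by (subst entry_times[of "{j}"]) (auto simp: entry_single_times split: if_splits)
    have "{p. \<exists>q. entry A' p q \<noteq> 0} \<subset> {p. \<exists>q. entry A p q \<noteq> 0}"
    proof
      show "{p. \<exists>q. entry A' p q \<noteq> 0} \<subseteq> {p. \<exists>q. entry A p q \<noteq> 0}"
      proof clarify
        fix p q assume "entry A' p q \<noteq> 0"
        then have "entry A p q \<noteq> 0 \<or> entry A p j \<noteq> 0" by (auto simp: entA')
        then show "\<exists>q. entry A p q \<noteq> 0" by blast
      qed
      show "{p. \<exists>q. entry A' p q \<noteq> 0} \<noteq> {p. \<exists>q. entry A p q \<noteq> 0}"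
        using ij by (auto simp: entA' set_eq_iff intro!: exI[of _ i])
    qed
    moreover have "finite {p. \<exists>q. entry A p q \<noteq> 0}"
      using entry_bound[of A] by (auto intro: finite_subset[OF _ finite_lessThan])
    ultimately have "card {p. \<exists>q. entry A' p q \<noteq> 0} < card {p. \<exists>q. entry A p q \<noteq> 0}"
      by (rule psubset_card_mono[rotated])
    from less[OF this] obtain B where "A' * B * A' = A'" by blast
    then show ?thesis unfolding A'_def by (rule regular_lift)
  qed simp
qed

text \<open>A matrix unit links a nonzero column of \<open>A\<close> to a nonzero row of
  \<open>B\<close>. This primeness later turns a map with both a kernel and a cokernel into a
  nonzero solution.\<close>

lemma fin_mat_prime:
  fixes A B :: "'k::field fin_mat"
  assumes "A \<noteq> 0" "B \<noteq> 0"
  shows "\<exists>X. A * X * B \<noteq> 0"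
proof -
  obtain i j p q where e: "entry A i j \<noteq> 0" "entry B p q \<noteq> 0"
    using assms fin_mat_nonzero by metis
  have "entry (A * single j p 1 * B) i q = entry A i j * entry B p q"
    unfolding mult.assoc by (subst entry_times[of "{j}"]) (auto simp: entry_single_times split: if_splits)
  then show ?thesis using e by (metis entry_zero mult_eq_0_iff)
qed

section \<open>Idempotents as objects\<close>

text \<open>
  Vector spaces are encoded as images of idempotents: \<open>hom e f\<close> plays the role of the linear maps from
  the image of \<open>e\<close> to that of \<open>f\<close>, and in characteristic 0 the trace of \<open>e\<close> is the dimension.
\<close>

definition idem :: "'k::field fin_mat \<Rightarrow> bool" where
  "idem e \<longleftrightarrow> e * e = e"

definition hom :: "'k::field fin_mat \<Rightarrow> 'k fin_mat \<Rightarrow> 'k fin_mat set" where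
  "hom e f = {x. f * x = x \<and> x * e = x}"

definition iso_via :: "'k::field fin_mat \<Rightarrow> 'k fin_mat \<Rightarrow> 'k fin_mat \<Rightarrow> 'k fin_mat \<Rightarrow> bool" where
  "iso_via e f x y \<longleftrightarrow> x \<in> hom e f \<and> y \<in> hom f e \<and> x * y = f \<and> y * x = e"

lemma hom_mult: "x \<in> hom e f \<Longrightarrow> y \<in> hom f g \<Longrightarrow> y * x \<in> hom e g"
  by (auto simp: hom_def mult.assoc) (simp flip: mult.assoc)

lemma iso_via_trans: "iso_via e f x y \<Longrightarrow> iso_via f g x' y' \<Longrightarrow> iso_via e g (x' * x) (y * y')"
proof -
  assume a: "iso_via e f x y" "iso_via f g x' y'"
  then have "x' * x * (y * y') = x' * f * y'" "y * y' * (x' * x) = y * f * x"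
    unfolding iso_via_def by (metis mult.assoc)+
  with a show ?thesis unfolding iso_via_def by (auto intro: hom_mult) (auto simp: hom_def)
qed

lemma iso_via_sym: "iso_via e f x y \<Longrightarrow> iso_via f e y x"
  unfolding iso_via_def by auto

text \<open>Rank-one idempotents are split off one by one. With \<open>c\<close> the inverse of a
  nonzero entry, \<open>single j i c * e * single j i c = single j i c\<close>, so
  \<open>e * single j i c * e\<close> is an idempotent below \<open>e\<close>. The remainder has
  fewer nonzero rows, and its isomorphism with \<open>dg {..<r}\<close> is enlarged by the
  coordinate \<open>r\<close>.\<close>

lemma idem_iso_standard:
  "idem e \<Longrightarrow> \<exists>r x y. iso_via (dg {..<r}) (e :: 'k::field fin_mat) x y"
proof (induction "card {i. \<exists>j. entry e i j \<noteq> 0}" arbitrary: e rule: less_induct)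
  case less
  have ee: "e * e = e" using less.prems by (simp add: idem_def)
  then have ee': "e * (e * z) = e * z" for z by (simp add: mult.assoc[symmetric])
  show ?case
  proof (cases "e = 0")
    case True
    then have "iso_via (dg {..<0}) e 0 0" by (simp add: iso_via_def hom_def)
    then show ?thesis by blast
  next
    case False
    then obtain i j where ij: "entry e i j \<noteq> 0" using fin_mat_nonzero by blast
    define c where "c = 1 / entry e i j"
    define e' where "e' = e - e * (single j i c * e)"
    have S: "single p i a * (e * (single j q b)) = single p q (a * entry e i j * b)" for p q a b
      by (rule fin_mat_eqI) (auto simp: entry_single_times entry_times_single)
    have S': "single p i a * (e * (single j q b * z)) = single p q (a * entry e i j * b) * z" for p q a b z
      by (subst S[symmetric]) (simp only: mult.assoc)
    have id: "idem e'" unfolding idem_def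
      using ij by (simp add: e'_def algebra_simps ee ee' S S' c_def)
    have ent: "entry e' p q = entry e p q - entry e p j * c * entry e i q" for p q
      unfolding e'_def entry_minus
      by (subst entry_times[of "{j}"]) (auto simp: entry_single_times split: if_splits)
    have "{p. \<exists>q. entry e' p q \<noteq> 0} \<subset> {p. \<exists>q. entry e p q \<noteq> 0}"
    proof
      show "{p. \<exists>q. entry e' p q \<noteq> 0} \<subseteq> {p. \<exists>q. entry e p q \<noteq> 0}"
      proof clarify
        fix p q assume "entry e' p q \<noteq> 0"
        then have "entry e p q \<noteq> 0 \<or> entry e p j \<noteq> 0" by (auto simp: ent)
        then show "\<exists>q. entry e p q \<noteq> 0" by blast
      qed
      show "{p. \<exists>q. entry e' p q \<noteq> 0} \<noteq> {p. \<exists>q. entry e p q \<noteq> 0}"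
        using ij by (auto simp: ent c_def set_eq_iff intro!: exI[of _ i])
    qed
    moreover have "finite {p. \<exists>q. entry e p q \<noteq> 0}"
      using entry_bound[of e] by (auto intro: finite_subset[OF _ finite_lessThan])
    ultimately have "card {p. \<exists>q. entry e' p q \<noteq> 0} < card {p. \<exists>q. entry e p q \<noteq> 0}"
      by (rule psubset_card_mono[rotated])
    from less.hyps[OF this id] obtain r x' y' where "iso_via (dg {..<r}) e' x' y'" by blast
    then have xy: "e' * x' = x'" "x' * dg {..<r} = x'" "dg {..<r} * y' = y'" "y' * e' = y'"
      "x' * y' = e'" "y' * x' = dg {..<r}"
      by (auto simp: iso_via_def hom_def)
    have e'e: "e * e' = e'" "e' * e = e'"
      by (simp_all add: e'_def algebra_simps ee ee')
    have exy: "e * x' = x'" "y' * e = y'"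
      using xy e'e by (metis mult.assoc)+
    \<comment> \<open>Column \<open>r\<close> of \<open>x\<close> is \<open>c\<close> times column
      \<open>j\<close> of \<open>e\<close>, and row \<open>r\<close> of \<open>y\<close> is row
      \<open>i\<close> of \<open>e\<close>; their product is
      \<open>c * entry e i j = 1\<close>.\<close>
    define x where "x = x' + e * single j r c"
    define y where "y = y' + single r i 1 * e"
    have z1: "x' * single r p b = 0" for p b
    proof -
      have "dg {..<r} * single r p b = 0" by (rule fin_mat_eqI) (simp add: entry_dg_times)
      then show ?thesis using xy(2) by (metis mult.assoc mult_zero_right)
    qed
    have z2: "single p r b * y' = 0" for p b
    proof -
      have "single p r b * dg {..<r} = 0" by (rule fin_mat_eqI) (simp add: entry_times_dg)
      then show ?thesis using xy(3) by (metis mult.assoc mult_zero_left)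
    qed
    have d0: "single p r b * dg {..<r} = 0" and d0': "dg {..<r} * (single r p b * z) = 0" for p b z
      by (rule fin_mat_eqI, simp add: entry_times_dg entry_dg_times entry_single_times)+
    have z3: "single r i 1 * x' = 0"
    proof -
      have "single r i 1 * e' = 0" by (rule fin_mat_eqI) (use ij in \<open>simp add: entry_single_times ent c_def\<close>)
      then show ?thesis using xy(1) by (metis mult.assoc mult_zero_left)
    qed
    have z4: "y' * single j r c = 0"
    proof -
      have "e' * single j r c = 0" by (rule fin_mat_eqI) (use ij in \<open>simp add: entry_times_single ent c_def\<close>)
      then show ?thesis using xy(4) by (metis mult.assoc mult_zero_right)
    qed
    have z1': "x' * (single r p b * z) = 0" for p b z
      using z1 by (metis mult.assoc mult_zero_left)
    have ss: "single p q a * single q p' b = single p p' (a * b)" for p q p' a and b :: 'k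
      by (rule fin_mat_eqI) (simp add: entry_single_times)
    have ss': "single p q a * (single q p' b * z) = single p p' (a * b) * z" for p q p' a and b :: 'k and z
      by (metis ss mult.assoc)
    have xy1: "x * y = e"
      by (simp add: x_def y_def algebra_simps xy z1' z2 ss') (simp add: e'_def)
    have suc: "dg {..<r} + single r r 1 = (dg {..<Suc r} :: 'k fin_mat)"
      by (rule fin_mat_eqI) auto
    have "y' * (e * single j r c) = 0" using exy z4 by (metis mult.assoc)
    moreover have "single r i 1 * (e * x') = 0" using exy z3 by (metis)
    ultimately have yx: "y * x = dg {..<Suc r}"
      using ij by (simp add: x_def y_def algebra_simps xy ee' S suc[symmetric] c_def)
    have "e * x = x" by (simp add: x_def algebra_simps exy ee')
    moreover have "y * e = y" by (simp add: y_def algebra_simps exy ee mult.assoc)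
    moreover have "x * dg {..<Suc r} = x"
      by (simp add: suc[symmetric] x_def algebra_simps xy z1 ss d0)
    moreover have "dg {..<Suc r} * y = y"
      by (simp add: suc[symmetric] y_def algebra_simps xy z2 ss') (rule fin_mat_eqI, auto simp: entry_dg_times entry_single_times)
    ultimately have "iso_via (dg {..<Suc r}) e x y"
      using xy1 yx by (simp add: iso_via_def hom_def)
    then show ?thesis by blast
  qed
qed

lemma iso_via_tr: "iso_via e f x y \<Longrightarrow> tr e = tr f"
  unfolding iso_via_def using tr_mult_commute by metis

lemma idem_rank:
  assumes "idem (e :: 'k::field_char_0 fin_mat)"
  obtains r where "tr e = of_nat r" "r = 0 \<longleftrightarrow> e = 0"
proof -
  obtain r x y where i: "iso_via (dg {..<r}) e x y" using idem_iso_standard[OF assms] by blast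
  then have "tr e = of_nat r" using iso_via_tr[OF i] by (simp add: tr_dg)
  moreover have "r = 0 \<longleftrightarrow> e = 0"
  proof
    assume "r = 0" then show "e = 0" using i by (auto simp: iso_via_def hom_def)
  next
    assume "e = 0" then show "r = 0" using \<open>tr e = of_nat r\<close> by simp
  qed
  ultimately show ?thesis by (rule that)
qed

lemma idem_iso:
  fixes e f :: "'k::field_char_0 fin_mat"
  assumes "idem e" "idem f" "tr e = tr f"
  obtains x y where "iso_via e f x y"
proof -
  obtain r x y s x' y' where i: "iso_via (dg {..<r}) e x y" "iso_via (dg {..<s}) f x' y'"
    using idem_iso_standard assms by metis
  have "(of_nat r :: 'k) = of_nat s"
    using iso_via_tr[OF i(1)] iso_via_tr[OF i(2)] assms(3) by (simp add: tr_dg)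
  then have "r = s" by simp
  then show ?thesis using that iso_via_trans[OF iso_via_sym[OF i(1)]] i(2) by blast
qed

section \<open>The kernel of a coadjoint form as a linear system\<close>

text \<open>Products are kept nested to the right, so an identity for \<open>a * b\<close> also
  needs a form with a continuation \<open>z\<close> in order to apply inside a longer word.\<close>

lemma mult_eq_ext: "a * b = c \<Longrightarrow> a * (b * z) = c * (z :: 'a::semigroup_mult)"
  by (simp flip: mult.assoc)

lemma hom_simps:
  assumes "x \<in> hom e f"
  shows "f * x = x" "x * e = x" "f * (x * z) = x * z" "x * (e * z) = x * z"
  using assms by (auto simp: hom_def) (metis mult.assoc)+

lemma homI: "f * x = x \<Longrightarrow> x * e = x \<Longrightarrow> x \<in> hom e f"
  by (simp add: hom_def)

lemma hom_uminus: "x \<in> hom e f \<Longrightarrow> - x \<in> hom e f"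
  and hom_zero: "0 \<in> hom e f"
  and hom_tp: "x \<in> hom e f \<Longrightarrow> tp x \<in> hom (tp f) (tp e)"
  and hom_mult': "x \<in> hom f g \<Longrightarrow> y \<in> hom e f \<Longrightarrow> x * y \<in> hom e g"
  by (auto simp: hom_def hom_mult simp flip: tp_mult) (metis mult.assoc)+

lemma idem_hom: "idem e \<Longrightarrow> e \<in> hom e e"
  by (simp add: idem_def hom_def)

text \<open>The image of \<open>tp w\<close> serves as the dual of the image of \<open>w\<close>, so
  a nondegenerate symmetric form is a self-adjoint isomorphism \<open>G\<close> from
  \<open>w\<close> to \<open>tp w\<close> with inverse \<open>H\<close>. The idempotent
  \<open>w\<close> itself need not be symmetric.\<close>

definition form_on :: "'k::field fin_mat \<Rightarrow> 'k fin_mat \<Rightarrow> 'k fin_mat \<Rightarrow> bool" where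
  "form_on w G H \<longleftrightarrow> G \<in> hom w (tp w) \<and> H \<in> hom (tp w) w \<and> tp G = G \<and> H * G = w \<and> G * H = tp w"

lemma form_on_tp: "form_on w G H \<Longrightarrow> tp H = H"
proof -
  assume f: "form_on w G H"
  then have G: "G \<in> hom w (tp w)" and H: "H \<in> hom (tp w) w" and *: "tp G = G" "H * G = w" "G * H = tp w"
    by (auto simp: form_on_def)
  have "tp (G * H) = w" by (simp only: *(3) tp_simps)
  then have "tp H * G = w" by (simp only: tp_mult *(1))
  then have "tp H * (G * H) = w * H" by (simp flip: mult.assoc)
  moreover have "tp H * tp w = tp H" using H by (metis hom_simps(1) tp_mult)
  ultimately show ?thesis using hom_simps(1)[OF H] * by metis
qed

text \<open>
  The equations for \<open>((A1, A2, A3), (p, q))\<close> in \<open>(gl(u) \<times> gl(m) \<times> o(w)) \<ltimes> Hom(m, u \<oplus> w)\<close> to lie in the kernel of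
  the form defined by the functional \<open>((F1, F2, F3), (\<phi>, \<psi>))\<close>. The last one says that the bracketed
  endomorphism of \<open>w\<close> is orthogonal to \<open>o(w)\<close> for the trace form.
\<close>

definition sol :: "'k::field fin_mat \<Rightarrow> 'k fin_mat \<Rightarrow> 'k fin_mat \<Rightarrow> 'k fin_mat \<Rightarrow> 'k fin_mat \<Rightarrow> 'k fin_mat
  \<Rightarrow> 'k fin_mat \<Rightarrow> 'k fin_mat \<Rightarrow> 'k fin_mat \<Rightarrow> 'k fin_mat \<Rightarrow> 'k fin_mat \<Rightarrow> 'k fin_mat \<Rightarrow> 'k fin_mat \<Rightarrow> 'k fin_mat \<Rightarrow> bool"
  where
  "sol u m w \<phi> \<psi> G F1 F2 F3 A1 A2 A3 p q \<longleftrightarrow>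
     A1 \<in> hom u u \<and> A2 \<in> hom m m \<and> A3 \<in> hom w w \<and> p \<in> hom m u \<and> q \<in> hom m w \<and>
     A2 * \<phi> = \<phi> * A1 \<and> A2 * \<psi> = \<psi> * A3 \<and> tp (G * A3) = - (G * A3) \<and>
     F1 * A1 - A1 * F1 = p * \<phi> \<and> F2 * A2 - A2 * F2 + \<phi> * p + \<psi> * q = 0 \<and>
     tp (G * (F3 * A3 - A3 * F3 - q * \<psi>)) = G * (F3 * A3 - A3 * F3 - q * \<psi>)"

definition reg :: "'k::field fin_mat \<Rightarrow> 'k fin_mat \<Rightarrow> 'k fin_mat \<Rightarrow> 'k fin_mat \<Rightarrow> 'k fin_mat \<Rightarrow> 'k fin_mat
  \<Rightarrow> 'k fin_mat \<Rightarrow> 'k fin_mat \<Rightarrow> 'k fin_mat \<Rightarrow> bool"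
  where
  "reg u m w \<phi> \<psi> G F1 F2 F3 \<longleftrightarrow>
     idem u \<and> idem m \<and> idem w \<and> \<phi> \<in> hom u m \<and> \<psi> \<in> hom w m \<and> (\<exists>H. form_on w G H) \<and>
     F1 \<in> hom u u \<and> F2 \<in> hom m m \<and> F3 \<in> hom w w \<and>
     (\<forall>A1 A2 A3 p q. sol u m w \<phi> \<psi> G F1 F2 F3 A1 A2 A3 p q \<longrightarrow>
        A1 = 0 \<and> A2 = 0 \<and> A3 = 0 \<and> p = 0 \<and> q = 0)"

text \<open>Elimination when \<open>m\<close> is the direct sum of the images of \<open>\<phi>\<close> and \<open>\<psi>\<close> and a complement \<open>m'\<close>.\<close>

lemma reg_split:
  assumes \<phi>: "\<phi> \<in> hom u m" and la: "la \<in> hom m u" and \<psi>: "\<psi> \<in> hom w m" and mu: "mu \<in> hom m w"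
    and io: "io \<in> hom m' m" and ka: "ka \<in> hom m m'"
    and i: "la * \<phi> = u" "mu * \<psi> = w" "ka * io = m'" "la * \<psi> = 0" "la * io = 0" "mu * \<phi> = 0" "mu * io = 0"
      "ka * \<phi> = 0" "ka * \<psi> = 0" and m: "\<phi> * la + \<psi> * mu + io * ka = m"
    and u: "idem u" and w: "idem w" and m': "idem m'" "idem m" and G: "form_on w G H"
    and F: "F1 \<in> hom u u" "F2 \<in> hom m m" "F3 \<in> hom w w"
  shows "reg u m w \<phi> \<psi> G F1 F2 F3 \<longleftrightarrow>
    reg u m' w (ka * F2 * \<phi>) (ka * F2 * \<psi>) G (F1 + la * F2 * \<phi>) (ka * F2 * io) (F3 + mu * F2 * \<psi>)"
    (is "?B \<longleftrightarrow> ?S")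
proof
  note ho = u[THEN idem_hom] w[THEN idem_hom] m'[THEN idem_hom] \<phi> la \<psi> mu io ka F
  note hs = ho[THEN hom_simps(1)] ho[THEN hom_simps(2)] ho[THEN hom_simps(3)] ho[THEN hom_simps(4)]
  note ii = i i[THEN mult_eq_ext]
  have dec: "X = X * \<phi> * la + X * \<psi> * mu + X * io * ka" if "X * m = X" for X
    using arg_cong[OF m, of "\<lambda>y. X * y"] that by (simp add: algebra_simps)
  {
    assume B: ?B
    have z: "A1 = 0 \<and> A' = 0 \<and> A3 = 0 \<and> x = 0 \<and> y = 0"
      if "sol u m' w (ka * F2 * \<phi>) (ka * F2 * \<psi>) G (F1 + la * F2 * \<phi>) (ka * F2 * io) (F3 + mu * F2 * \<psi>) A1 A' A3 x y"
      for A1 A' A3 x y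
    proof -
      note S = that[unfolded sol_def]
      have A: "A1 \<in> hom u u" "A' \<in> hom m' m'" "A3 \<in> hom w w" "x \<in> hom m' u" "y \<in> hom m' w"
        using S by auto
      note As = A[THEN hom_simps(1)] A[THEN hom_simps(2)] A[THEN hom_simps(3)] A[THEN hom_simps(4)]
      \<comment> \<open>In the decomposition of \<open>m\<close> the equations
        \<open>A2 * \<phi> = \<phi> * A1\<close> and \<open>A2 * \<psi> = \<psi> * A3\<close> fix
        two block columns of \<open>A2\<close>; the unknowns \<open>x\<close>, \<open>y\<close>,
        \<open>A'\<close> of the small system form the third.\<close>
      define A2 where "A2 = \<phi> * A1 * la + \<psi> * A3 * mu + io * A' * ka + \<phi> * x * ka + \<psi> * y * ka"
      have A2: "A2 \<in> hom m m" unfolding A2_def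
        by (rule homI) (simp_all add: algebra_simps hs As)
      have A2\<phi>: "A2 * \<phi> = \<phi> * A1" "A2 * \<psi> = \<psi> * A3" "A2 * io = io * A' + \<phi> * x + \<psi> * y"
        and A2l: "la * A2 = A1 * la + x * ka" "mu * A2 = A3 * mu + y * ka" "ka * A2 = A' * ka"
        by (simp_all add: A2_def algebra_simps hs As ii)
      define Z where "Z = F2 * A2 - A2 * F2"
      have Zm: "Z \<in> hom m m" unfolding Z_def
        by (rule homI) (simp_all add: algebra_simps hs A2[THEN hom_simps(1)] A2[THEN hom_simps(2)]
          A2[THEN hom_simps(3)] A2[THEN hom_simps(4)])
      have c: "A' * (ka * (F2 * \<phi>)) = ka * (F2 * (\<phi> * A1))" "A' * (ka * (F2 * \<psi>)) = ka * (F2 * (\<psi> * A3))"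
        using S by (simp_all add: mult.assoc)
      \<comment> \<open>These three blocks are exactly the equations of the small system with values
        in \<open>m'\<close>. Hence \<open>Z\<close> lies in the sum of the images of
        \<open>\<phi>\<close> and \<open>\<psi>\<close> and can be cancelled by \<open>p\<close> and
        \<open>q\<close>.\<close>
      have "ka * Z * \<phi> = 0" "ka * Z * \<psi> = 0" "ka * Z * io = 0"
        using S by (simp_all add: Z_def algebra_simps A2\<phi> A2l A2l[THEN mult_eq_ext] hs ii c)
      then have kZ: "ka * Z = 0" using dec[of "ka * Z"] Zm by (simp add: hom_simps mult.assoc)
      have mZ: "\<phi> * (la * Z) + \<psi> * (mu * Z) = Z"
        using arg_cong[OF m, of "\<lambda>y. y * Z"] kZ by (simp add: algebra_simps hom_simps(1)[OF Zm])
      \<comment> \<open>Substituting \<open>p = - (la * Z)\<close> and \<open>q = - (mu * Z)\<close>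
        is the origin of the corrections \<open>la * F2 * \<phi>\<close> and
        \<open>mu * F2 * \<psi>\<close> to \<open>F1\<close> and \<open>F3\<close>.\<close>
      have eq3: "F3 * A3 - A3 * F3 - - (mu * Z) * \<psi>
          = (F3 + mu * F2 * \<psi>) * A3 - A3 * (F3 + mu * F2 * \<psi>) - y * (ka * F2 * \<psi>)"
        and eq1: "F1 * A1 - A1 * F1 = - (la * Z) * \<phi>"
        using S by (simp_all add: Z_def algebra_simps A2\<phi> A2l A2l[THEN mult_eq_ext] hs ii)
      have "- (la * Z) \<in> hom m u" "- (mu * Z) \<in> hom m w"
        using Zm la mu by (auto intro: hom_uminus hom_mult)
      moreover have "F2 * A2 - A2 * F2 + \<phi> * - (la * Z) + \<psi> * - (mu * Z) = 0"
        using mZ by (simp add: Z_def[symmetric] algebra_simps)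
      ultimately have "sol u m w \<phi> \<psi> G F1 F2 F3 A1 A2 A3 (- (la * Z)) (- (mu * Z))"
        unfolding sol_def eq3 using S A A2 eq1 A2\<phi> by blast
      then have zz: "A1 = 0" "A2 = 0" "A3 = 0"
        using B unfolding reg_def by blast+
      have "A' = ka * A2 * io" "x = la * A2 * io" "y = mu * A2 * io"
        by (simp_all add: A2l hs As ii algebra_simps mult_eq_ext)
      then show ?thesis using zz by simp
    qed
    show ?S
      unfolding reg_def
      using z G u w m' by (auto intro!: homI simp: algebra_simps hs)
  }
  {
    assume S: ?S
    have z: "A1 = 0 \<and> A2 = 0 \<and> A3 = 0 \<and> p = 0 \<and> q = 0"
      if "sol u m w \<phi> \<psi> G F1 F2 F3 A1 A2 A3 p q" for A1 A2 A3 p q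
    proof -
      note B = that[unfolded sol_def]
      have A: "A1 \<in> hom u u" "A2 \<in> hom m m" "A3 \<in> hom w w" "p \<in> hom m u" "q \<in> hom m w"
        using B by auto
      note As = A[THEN hom_simps(1)] A[THEN hom_simps(2)] A[THEN hom_simps(3)] A[THEN hom_simps(4)]
      have E: "A2 * \<phi> = \<phi> * A1" "A2 * \<psi> = \<psi> * A3" using B by auto
      define x where "x = la * A2 * io"
      define y where "y = mu * A2 * io"
      define A' where "A' = ka * A2 * io"
      have ka2: "ka * A2 = A' * ka"
        by (subst dec[of "ka * A2"]) (simp_all add: A'_def mult.assoc As E ii)
      have la2: "la * A2 = A1 * la + x * ka"
        by (subst dec[of "la * A2"]) (simp_all add: x_def mult.assoc As E ii)
      have mu2: "mu * A2 = A3 * mu + y * ka"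
        by (subst dec[of "mu * A2"]) (simp_all add: y_def mult.assoc As E ii)
      have io2: "A2 * io = io * A' + \<phi> * x + \<psi> * y"
        using arg_cong[OF m, of "\<lambda>z. z * (A2 * io)"]
        by (simp add: algebra_simps As x_def y_def A'_def)
      note E2 = E io2 ka2 la2 mu2
      have main: "F2 * A2 - A2 * F2 + \<phi> * p + \<psi> * q = 0" using B by auto
      have e1: "F1 * A1 - A1 * F1 = p * \<phi>" using B by auto
      have R: "l * (F2 * (A2 * r)) - l * (A2 * (F2 * r)) + l * (\<phi> * (p * r)) + l * (\<psi> * (q * r)) = 0" for l r
        using arg_cong[OF main, of "\<lambda>z. l * z * r"] by (simp add: algebra_simps)
      have p\<phi>: "p * \<phi> = - (la * (F2 * (A2 * \<phi>)) - la * (A2 * (F2 * \<phi>)))"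
        using R[of la \<phi>] by (simp add: ii hs As algebra_simps eq_neg_iff_add_eq_0)
      have q\<psi>: "q * \<psi> = - (mu * (F2 * (A2 * \<psi>)) - mu * (A2 * (F2 * \<psi>)))"
        using R[of mu \<psi>] by (simp add: ii hs As algebra_simps eq_neg_iff_add_eq_0)
      have h: "A' \<in> hom m' m'" "x \<in> hom m' u" "y \<in> hom m' w"
        unfolding A'_def x_def y_def by (auto intro!: homI simp: mult.assoc hs)
      have c1: "A' * (ka * F2 * \<phi>) = ka * F2 * \<phi> * A1"
        using R[of ka \<phi>] by (simp add: ii E2 E2[THEN mult_eq_ext] mult.assoc hs)
      have c2: "A' * (ka * F2 * \<psi>) = ka * F2 * \<psi> * A3"
        using R[of ka \<psi>] by (simp add: ii E2 E2[THEN mult_eq_ext] mult.assoc hs)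
      have c3: "ka * F2 * io * A' - A' * (ka * F2 * io) + ka * F2 * \<phi> * x + ka * F2 * \<psi> * y = 0"
        using R[of ka io] by (simp add: ii E2 E2[THEN mult_eq_ext] algebra_simps hs)
      have c4: "(F1 + la * F2 * \<phi>) * A1 - A1 * (F1 + la * F2 * \<phi>) = x * (ka * F2 * \<phi>)"
        using e1 unfolding p\<phi> by (simp add: E2 E2[THEN mult_eq_ext] algebra_simps hs)
      have c5: "(F3 + mu * F2 * \<psi>) * A3 - A3 * (F3 + mu * F2 * \<psi>) - y * (ka * F2 * \<psi>)
          = F3 * A3 - A3 * F3 - q * \<psi>"
        unfolding q\<psi> by (simp add: E2 E2[THEN mult_eq_ext] algebra_simps hs)
      have "sol u m' w (ka * F2 * \<phi>) (ka * F2 * \<psi>) G (F1 + la * F2 * \<phi>) (ka * F2 * io) (F3 + mu * F2 * \<psi>) A1 A' A3 x y"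
        unfolding sol_def c5 using A B h c1 c2 c3 c4 by blast
      then have zz: "A1 = 0" "A' = 0" "A3 = 0" "x = 0" "y = 0" using S unfolding reg_def by blast+
      have A20: "A2 = 0"
        using dec[of A2] by (simp add: As E io2 zz)
      \<comment> \<open>The images of \<open>\<phi>\<close> and \<open>\<psi>\<close> are
        independent, so the two terms left in the equation over \<open>m\<close> vanish
        separately.\<close>
      have "p = la * (\<phi> * p + \<psi> * q)" "q = mu * (\<phi> * p + \<psi> * q)"
        by (simp_all add: algebra_simps ii As)
      moreover have "\<phi> * p + \<psi> * q = 0" using main A20 by simp
      ultimately show ?thesis using zz A20 by simp
    qed
    show ?B
      unfolding reg_def using z ho G u w m' by auto
  }
qed

text \<open>Elimination when \<open>\<phi>\<close> is surjective with kernel \<open>k\<close>.\<close>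

lemma reg_quotient:
  assumes \<phi>: "\<phi> \<in> hom u m" and sg: "sg \<in> hom m u" and \<psi>: "\<psi> \<in> hom w m"
    and io: "io \<in> hom k u" and ka: "ka \<in> hom u k"
    and i: "\<phi> * sg = m" "ka * io = k" "\<phi> * io = 0" "ka * sg = 0" and u: "io * ka + sg * \<phi> = u"
    and id: "idem u" "idem m" "idem w" "idem k" and G: "form_on w G H"
    and F: "F1 \<in> hom u u" "F2 \<in> hom m m" "F3 \<in> hom w w"
  shows "reg u m w \<phi> \<psi> G F1 F2 F3 \<longleftrightarrow>
    reg k m w (\<phi> * F1 * io) \<psi> G (ka * F1 * io) (F2 + \<phi> * F1 * sg) F3"
    (is "?B \<longleftrightarrow> ?S")
proof
  note ho = id[THEN idem_hom] \<phi> sg \<psi> io ka F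
  note hs = ho[THEN hom_simps(1)] ho[THEN hom_simps(2)] ho[THEN hom_simps(3)] ho[THEN hom_simps(4)]
  note ii = i i[THEN mult_eq_ext]
  have dec: "X = X * io * ka + X * sg * \<phi>" if "X * u = X" for X
    using arg_cong[OF u, of "\<lambda>y. X * y"] that by (simp add: algebra_simps)
  {
    assume B: ?B
    have z: "AK = 0 \<and> A2 = 0 \<and> A3 = 0 \<and> x = 0 \<and> q = 0"
      if "sol k m w (\<phi> * F1 * io) \<psi> G (ka * F1 * io) (F2 + \<phi> * F1 * sg) F3 AK A2 A3 x q"
      for AK A2 A3 x q
    proof -
      note S = that[unfolded sol_def]
      have A: "AK \<in> hom k k" "A2 \<in> hom m m" "A3 \<in> hom w w" "x \<in> hom m k" "q \<in> hom m w"
        using S by auto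
      note As = A[THEN hom_simps(1)] A[THEN hom_simps(2)] A[THEN hom_simps(3)] A[THEN hom_simps(4)]
      \<comment> \<open>Since \<open>\<phi>\<close> is surjective, \<open>A2\<close> is the
        endomorphism induced by \<open>A1\<close> on the quotient by \<open>k\<close>. Only the
        block row of \<open>A1\<close> with values in \<open>k\<close> is free, and it consists of
        \<open>AK\<close> and \<open>x\<close>.\<close>
      define A1 where "A1 = io * AK * ka + io * x * \<phi> + sg * A2 * \<phi>"
      have A1: "A1 \<in> hom u u" unfolding A1_def
        by (rule homI) (simp_all add: algebra_simps hs As)
      have E: "A1 * io = io * AK" "A1 * sg = io * x + sg * A2" "ka * A1 = AK * ka + x * \<phi>" "\<phi> * A1 = A2 * \<phi>"
        by (simp_all add: A1_def algebra_simps hs As ii)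
      define Z where "Z = F1 * A1 - A1 * F1"
      have Zu: "Z \<in> hom u u" unfolding Z_def
        by (rule homI) (simp_all add: algebra_simps hs A1[THEN hom_simps(1)] A1[THEN hom_simps(2)]
          A1[THEN hom_simps(3)] A1[THEN hom_simps(4)])
      have c: "A2 * (\<phi> * (F1 * io)) = \<phi> * (F1 * (io * AK))" using S by (simp add: mult.assoc)
      \<comment> \<open>Two equations of the small system say that \<open>Z\<close> vanishes on
        \<open>k\<close>; so \<open>Z\<close> factors through \<open>\<phi>\<close>, and
        \<open>Z * sg\<close> is the required \<open>p\<close>.\<close>
      have "ka * (Z * io) = 0" "\<phi> * (Z * io) = 0"
        using S by (simp_all add: Z_def algebra_simps E E[THEN mult_eq_ext] hs ii c)
      then have "Z * io = 0"
        using arg_cong[OF u, of "\<lambda>y. y * (Z * io)"]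
        by (simp add: algebra_simps Zu[THEN hom_simps(3)])
      then have Z0: "Z = Z * sg * \<phi>" using dec[of Z] Zu by (simp add: hom_simps(2)[OF Zu])
      have "Z * sg \<in> hom m u" using Zu sg by (rule hom_mult')
      moreover have "F2 * A2 - A2 * F2 + \<phi> * (Z * sg) + \<psi> * q = 0"
        using S by (simp add: Z_def algebra_simps E E[THEN mult_eq_ext] hs ii)
      ultimately have "sol u m w \<phi> \<psi> G F1 F2 F3 A1 A2 A3 (Z * sg) q"
        unfolding sol_def using S A A1 E(4) Z0 Z_def by metis
      then have zz: "A1 = 0" "A2 = 0" "A3 = 0" "q = 0" using B unfolding reg_def by blast+
      have "AK = ka * A1 * io" "x = ka * A1 * sg"
        by (simp_all add: E hs As ii algebra_simps)
      then show ?thesis using zz by simp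
    qed
    show ?S
      unfolding reg_def using z G id \<psi> by (auto intro!: homI simp: algebra_simps hs)
  }
  {
    assume S: ?S
    have z: "A1 = 0 \<and> A2 = 0 \<and> A3 = 0 \<and> p = 0 \<and> q = 0"
      if "sol u m w \<phi> \<psi> G F1 F2 F3 A1 A2 A3 p q" for A1 A2 A3 p q
    proof -
      note B = that[unfolded sol_def]
      have A: "A1 \<in> hom u u" "A2 \<in> hom m m" "A3 \<in> hom w w" "p \<in> hom m u" "q \<in> hom m w"
        using B by auto
      note As = A[THEN hom_simps(1)] A[THEN hom_simps(2)] A[THEN hom_simps(3)] A[THEN hom_simps(4)]
      have E: "\<phi> * A1 = A2 * \<phi>" using B by auto
      define AK where "AK = ka * A1 * io"
      define x where "x = ka * A1 * sg"
      have ka1: "ka * A1 = AK * ka + x * \<phi>"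
        by (subst dec[of "ka * A1"]) (simp_all add: AK_def x_def mult.assoc As)
      have io1: "A1 * io = io * AK"
        using arg_cong[OF u, of "\<lambda>z. z * (A1 * io)"]
        by (simp add: algebra_simps As AK_def E[THEN mult_eq_ext] ii)
      have sg1: "A1 * sg = io * x + sg * A2"
        using arg_cong[OF u, of "\<lambda>z. z * (A1 * sg)"]
        by (simp add: algebra_simps As x_def E[THEN mult_eq_ext] ii)
      note E2 = E ka1 io1 sg1
      have e1: "F1 * A1 - A1 * F1 = p * \<phi>" using B by auto
      have R: "l * (F1 * (A1 * r)) - l * (A1 * (F1 * r)) = l * (p * (\<phi> * r))" for l r
        using arg_cong[OF e1, of "\<lambda>z. l * z * r"] by (simp add: algebra_simps)
      have \<phi>p: "\<phi> * p = \<phi> * (F1 * (A1 * sg)) - \<phi> * (A1 * (F1 * sg))"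
        using R[of \<phi> sg] by (simp add: ii hs As)
      have h: "AK \<in> hom k k" "x \<in> hom m k"
        unfolding AK_def x_def by (auto intro!: homI simp: mult.assoc hs)
      have main: "F2 * A2 - A2 * F2 + \<phi> * p + \<psi> * q = 0" using B by auto
      have c1: "A2 * (\<phi> * F1 * io) = \<phi> * F1 * io * AK"
        using R[of \<phi> io] by (simp add: ii E2 E2[THEN mult_eq_ext] mult.assoc hs)
      have c2: "ka * F1 * io * AK - AK * (ka * F1 * io) = x * (\<phi> * F1 * io)"
        using R[of ka io] by (simp add: ii E2 E2[THEN mult_eq_ext] algebra_simps hs)
      have c3: "(F2 + \<phi> * F1 * sg) * A2 - A2 * (F2 + \<phi> * F1 * sg) + \<phi> * F1 * io * x + \<psi> * q = 0"
        using main unfolding \<phi>p by (simp add: E2 E2[THEN mult_eq_ext] algebra_simps hs)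
      have "sol k m w (\<phi> * F1 * io) \<psi> G (ka * F1 * io) (F2 + \<phi> * F1 * sg) F3 AK A2 A3 x q"
        unfolding sol_def using A B h c1 c2 c3 by blast
      then have zz: "AK = 0" "A2 = 0" "A3 = 0" "x = 0" "q = 0" using S unfolding reg_def by blast+
      have A10: "A1 = 0"
        using dec[of A1] by (simp add: As io1 sg1 zz)
      have "p = (p * \<phi>) * sg" by (simp add: ii As mult.assoc)
      then show ?thesis using zz A10 e1 by simp
    qed
    show ?B
      unfolding reg_def using z ho G id by auto
  }
qed

lemma hom_orth: "x \<in> hom a f \<Longrightarrow> y \<in> hom g b \<Longrightarrow> g * f = 0 \<Longrightarrow> y * x = 0"
  by (metis hom_simps(1,4) mult_eq_ext mult_zero_left mult_zero_right)

text \<open>Triviality of the kernel of the form that \<open>F\<close> defines on the orthogonal Lie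
  algebra of \<open>G\<close>: the second equation makes the commutator orthogonal to all skew maps
  for the trace form.\<close>

definition skew_trivial :: "'k::field fin_mat \<Rightarrow> 'k fin_mat \<Rightarrow> 'k fin_mat \<Rightarrow> bool" where
  "skew_trivial w G F \<longleftrightarrow> (\<forall>A\<in>hom w w. tp (G * A) = - (G * A) \<and>
     tp (G * (F * A - A * F)) = G * (F * A - A * F) \<longrightarrow> A = 0)"

text \<open>
  Elimination when \<open>\<phi>\<close> is injective and \<open>m\<close> is the sum of the images of \<open>\<phi>\<close> and \<open>\<psi>\<close>: here \<open>e\<close> is the
  preimage of the image of \<open>\<phi>\<close> under \<open>\<psi>\<close>, and \<open>z\<close> is its orthogonal complement in \<open>w\<close>. A skew
  endomorphism of \<open>w\<close> that preserves \<open>e\<close> also preserves \<open>z\<close>.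
\<close>

lemma reg_orthogonal:
  assumes \<phi>: "\<phi> \<in> hom u m" and la: "la \<in> hom m u" and ze: "ze \<in> hom z m" and nu: "nu \<in> hom m z"
    and th: "th \<in> hom e u"
    and i: "la * \<phi> = u" "nu * ze = z" "la * ze = 0" "nu * \<phi> = 0" "e * z = 0" "z * e = 0"
    and m: "\<phi> * la + ze * nu = m" and w: "w = e + z"
    and id: "idem u" "idem m" "idem e" "idem z"
    and Ge: "form_on e Ge He" and Gz: "form_on z Gz Hz"
    and F: "F1 \<in> hom u u" "F2 \<in> hom m m" "F3 \<in> hom w w"
  shows "reg u m w \<phi> (\<phi> * th + ze) (Ge + Gz) F1 F2 F3 \<longleftrightarrow>
    reg 0 u e 0 th Ge 0 (F1 + la * F2 * \<phi>) (e * F3 * e) \<and>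
    skew_trivial z Gz (z * F3 * z + nu * F2 * ze)"
    (is "?B \<longleftrightarrow> ?S1 \<and> ?S2")
proof
  have tpz: "tp e * tp z = 0" "tp z * tp e = 0" using i by (simp_all flip: tp_mult)
  have idw: "idem w" using id i by (simp add: w idem_def algebra_simps)
  have G: "Ge \<in> hom e (tp e)" "Gz \<in> hom z (tp z)" "tp Ge = Ge" "tp Gz = Gz"
    and H: "He \<in> hom (tp e) e" "Hz \<in> hom (tp z) z"
    and GH: "He * Ge = e" "Ge * He = tp e" "Hz * Gz = z" "Gz * Hz = tp z"
    using Ge Gz by (auto simp: form_on_def)
  note ho = id[THEN idem_hom] \<phi> la ze nu th F(1,2) G(1,2) H
  note hs = ho[THEN hom_simps(1)] ho[THEN hom_simps(2)] ho[THEN hom_simps(3)] ho[THEN hom_simps(4)]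
  note ii0 = i GH tpz
  note ii = ii0 ii0[THEN mult_eq_ext]
  note he = id(3)[THEN idem_hom] and hz = id(4)[THEN idem_hom]
  have o: "Gz * e = 0" "Ge * z = 0" "z * He = 0" "e * Hz = 0" "tp e * Gz = 0" "tp z * Ge = 0" "ze * e = 0" "th * z = 0"
    "e * nu = 0" "Gz * He = 0" "Ge * Hz = 0" "He * Gz = 0" "Hz * Ge = 0" "He * tp z = 0" "Hz * tp e = 0"
    by (rule hom_orth[OF he G(2) i(6)] hom_orth[OF hz G(1) i(5)] hom_orth[OF H(1) hz i(6)] hom_orth[OF H(2) he i(5)]
      hom_orth[OF G(2) he[THEN hom_tp] tpz(1)] hom_orth[OF G(1) hz[THEN hom_tp] tpz(2)] hom_orth[OF he ze i(6)]
      hom_orth[OF hz th i(5)] hom_orth[OF nu he i(5)] hom_orth[OF H(1) G(2) i(6)] hom_orth[OF H(2) G(1) i(5)]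
      hom_orth[OF G(2) H(1) tpz(1)] hom_orth[OF G(1) H(2) tpz(2)] hom_orth[OF hz[THEN hom_tp] H(1) tpz(1)]
      hom_orth[OF he[THEN hom_tp] H(2) tpz(2)])+
  note os = o o[THEN mult_eq_ext]
  have form: "form_on w (Ge + Gz) (He + Hz)"
    unfolding form_on_def w by (auto intro!: homI simp: algebra_simps hs ii os G)
  {
    assume S: "?S1 \<and> ?S2"
    have "A1 = 0 \<and> A2 = 0 \<and> A3 = 0 \<and> p = 0 \<and> q = 0"
      if "sol u m w \<phi> (\<phi> * th + ze) (Ge + Gz) F1 F2 F3 A1 A2 A3 p q" for A1 A2 A3 p q
    proof -
      note B = that[unfolded sol_def]
      have A: "A1 \<in> hom u u" "A2 \<in> hom m m" "A3 \<in> hom w w" "p \<in> hom m u" "q \<in> hom m w"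
        using B by auto
      have A': "A1 \<in> hom u u" "A2 \<in> hom m m" "p \<in> hom m u" using A by auto
      note As = A'[THEN hom_simps(1)] A'[THEN hom_simps(2)] A'[THEN hom_simps(3)] A'[THEN hom_simps(4)]
        hom_simps(2)[OF A(5)] hom_simps(4)[OF A(5)]
      have A3w: "e * (A3 * X) + z * (A3 * X) = A3 * X" "A3 * (e * X) + A3 * (z * X) = A3 * X" for X
        using hom_simps(3)[OF A(3), of X] hom_simps(4)[OF A(3), of X] by (simp_all add: w algebra_simps)
      have E1: "A2 * \<phi> = \<phi> * A1" and E: "A2 * (\<phi> * th + ze) = (\<phi> * th + ze) * A3" using B by auto
      note E1s = E1 E1[THEN mult_eq_ext]
      have RE: "l * (\<phi> * (A1 * (th * r))) + l * (A2 * (ze * r)) = l * (\<phi> * (th * (A3 * r))) + l * (ze * (A3 * r))" for l r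
        using arg_cong[OF E, of "\<lambda>x. l * x * r"] by (simp add: algebra_simps E1s)
      define AD where "AD = e * A3 * e"
      define AZ where "AZ = z * A3 * z"
      define q' where "q' = e * q * \<phi>"
      \<comment> \<open>On \<open>e\<close> the map \<open>\<psi>\<close> takes values in the image
        of \<open>\<phi>\<close>, which \<open>A2\<close> preserves; projecting by \<open>nu\<close>
        shows that \<open>A3\<close> maps \<open>e\<close> to itself.\<close>
      have ze3: "z * (A3 * e) = 0" using RE[of nu e] by (simp add: hs ii os)
      have sk: "l * (tp A3 * (Ge * r)) + l * (tp A3 * (Gz * r)) = - (l * (Ge * (A3 * r)) + l * (Gz * (A3 * r)))" for l r
      proof -
        have "tp ((Ge + Gz) * A3) = - ((Ge + Gz) * A3)" using B by auto
        from arg_cong[OF this, of "\<lambda>x. l * x * r"] show ?thesis by (simp add: algebra_simps G)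
      qed
      have "tp e * (tp A3 * Gz) = tp (Gz * (z * (A3 * e)))"
        by (simp add: hs G mult.assoc)
      then have "Ge * (A3 * z) = 0"
        using sk[of "tp e" z] by (simp add: hs os ze3)
      then have "He * (Ge * (A3 * z)) = 0" by simp
      then have ez3: "e * (A3 * z) = 0" by (simp add: ii)
      have A3x: "A3 = A3 * e + A3 * z"
        using hom_simps(2)[OF A(3)] by (simp add: w distrib_left)
      have A3e: "A3 * e = AD" "e * A3 = AD" "A3 * z = AZ" "z * A3 = AZ"
        using A3w(1)[of e] A3w(1)[of z] arg_cong[OF A3x, of "\<lambda>x. e * x"] arg_cong[OF A3x, of "\<lambda>x. z * x"] ze3 ez3
        by (simp_all add: AD_def AZ_def distrib_left mult.assoc hs)
      have thAZ: "th * AZ = 0" "ze * AD = 0" by (simp_all add: AZ_def AD_def os mult.assoc)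
      have AD: "AD \<in> hom e e" and AZ: "AZ \<in> hom z z" and q': "q' \<in> hom u e"
        by (auto intro!: homI simp: AD_def AZ_def q'_def mult.assoc hs)
      have A2z: "A2 * ze = ze * AZ"
        using RE[of m z] by (simp add: As hs os A3e A3e[THEN mult_eq_ext] thAZ) 
      have c1: "A1 * th = th * AD"
        using RE[of la e] A3e by (simp add: As hs os ii)
      have A2m: "nu * A2 = AZ * nu" "la * A2 = A1 * la"
        using arg_cong[OF m, of "\<lambda>x. nu * (A2 * x)"] arg_cong[OF m, of "\<lambda>x. la * (A2 * x)"]
        by (simp_all add: distrib_left mult.assoc As E1s A2z[THEN mult_eq_ext] ii hs AZ[THEN hom_simps(3)] AZ[THEN hom_simps(1)])
      note D = AD[THEN hom_simps(1)] AD[THEN hom_simps(2)] AD[THEN hom_simps(3)] AD[THEN hom_simps(4)]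
        AZ[THEN hom_simps(1)] AZ[THEN hom_simps(2)] AZ[THEN hom_simps(3)] AZ[THEN hom_simps(4)]
      note Es = E1 A3e A2z A2m c1
      note EE = Es Es[THEN mult_eq_ext]
      have main: "F2 * A2 - A2 * F2 + \<phi> * p + (\<phi> * th + ze) * q = 0" using B by auto
      have R: "l * (F2 * (A2 * r)) - l * (A2 * (F2 * r)) + l * (\<phi> * (p * r)) + l * (\<phi> * (th * (q * r))) + l * (ze * (q * r)) = 0" for l r
        using arg_cong[OF main, of "\<lambda>z. l * z * r"] by (simp add: algebra_simps)
      define Y where "Y = F3 * A3 - A3 * F3 - q * (\<phi> * th + ze)"
      have Ysym: "tp ((Ge + Gz) * Y) = (Ge + Gz) * Y" using B by (simp add: Y_def)
      have RY: "l * (tp Y * (Ge * r)) + l * (tp Y * (Gz * r)) = l * (Ge * (Y * r)) + l * (Gz * (Y * r))" for l r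
        using arg_cong[OF Ysym, of "\<lambda>x. l * x * r"] by (simp add: algebra_simps G)
      have e1: "F1 * A1 - A1 * F1 = p * \<phi>" using B by auto
      have d1: "(F1 + la * F2 * \<phi>) * A1 - A1 * (F1 + la * F2 * \<phi>) + th * q' = 0"
        using R[of la \<phi>] e1 by (simp add: q'_def algebra_simps EE ii hs As)
      have Ye: "e * (Y * e) = e * F3 * e * AD - AD * (e * F3 * e) - q' * th"
        by (simp add: Y_def q'_def algebra_simps EE hs os ii D)
      have d2: "tp (Ge * (e * (Y * e))) = Ge * (e * (Y * e))"
        using RY[of "tp e" e] by (simp add: hs os G mult.assoc)
      have tA: "tp e * tp A3 = tp AD" "tp z * tp A3 = tp AZ" by (simp_all add: A3e flip: tp_mult)
      have d3: "tp (Ge * AD) = - (Ge * AD)"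
        using sk[of "tp e" e] by (simp add: A3e hs os G D tA[THEN mult_eq_ext])
      \<comment> \<open>The former \<open>u\<close> is now the middle space and no first space is
        left, which accounts for the zeros.\<close>
      have "sol 0 u e 0 th Ge 0 (F1 + la * F2 * \<phi>) (e * F3 * e) 0 A1 AD 0 q'"
        unfolding sol_def Ye[symmetric] using A AD q' d1 d2 d3 c1 by (auto simp: hom_zero)
      then have zz: "A1 = 0" "AD = 0" "q' = 0" using S unfolding reg_def by blast+
      have zY: "z * (Y * z) = (z * F3 * z + nu * F2 * ze) * AZ - AZ * (z * F3 * z + nu * F2 * ze)"
        using R[of nu ze] by (simp add: Y_def algebra_simps EE hs os ii D)
      have f2: "tp (Gz * (z * (Y * z))) = Gz * (z * (Y * z))"
        using RY[of "tp z" z] by (simp add: hs os G mult.assoc)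
      have f3: "tp (Gz * AZ) = - (Gz * AZ)"
        using sk[of "tp z" z] by (simp add: A3e hs os G D tA[THEN mult_eq_ext])
      have AZ0: "AZ = 0" using S AZ f2 f3 unfolding skew_trivial_def zY by blast
      have A30: "A3 = 0" using A3x A3e zz AZ0 by simp
      have A20: "A2 = 0"
        using arg_cong[OF m, of "\<lambda>x. A2 * x"] by (simp add: distrib_left As E1s A2z[THEN mult_eq_ext] zz AZ0)
      have zq: "z * q = 0" using R[of nu m] by (simp add: A20 ii hs As)
      have eq: "e * q = q" using hom_simps(1)[OF A(5)] zq by (simp add: w distrib_right)
      have q\<phi>: "q * \<phi> = 0" using zz(3) eq by (simp add: q'_def)
      \<comment> \<open>At this point \<open>Y\<close> vanishes on \<open>e\<close> and maps
        \<open>z\<close> into \<open>e\<close>. Being self-adjoint for an orthogonal sum of forms,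
        it must be zero.\<close>
      have Y': "Y = - (q * ze)"
        using q\<phi>[THEN mult_eq_ext] by (simp add: Y_def A30 distrib_left)
      have "tp e * tp ze = 0" by (simp add: os flip: tp_mult)
      then have "Ge * (q * ze) = 0"
        using RY[of "tp e" z] unfolding Y' by (simp add: hs os mult_eq_ext[of "tp e" "tp ze" 0] mult.assoc)
      then have "He * (Ge * (q * ze)) = 0" by simp
      then have qze: "q * ze = 0" by (simp add: ii eq[THEN mult_eq_ext])
      have q0: "q = 0"
        using arg_cong[OF m, of "\<lambda>x. q * x"] q\<phi>[THEN mult_eq_ext] qze[THEN mult_eq_ext] by (simp add: distrib_left As)
      have "p = la * (\<phi> * p)" by (simp add: ii As)
      moreover have "\<phi> * p = 0" using main by (simp add: A20 q0)
      ultimately show ?thesis using zz A20 A30 q0 by simp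
    qed
    then show ?B
      unfolding reg_def using form ho(1-8) id idw F by (auto intro!: homI simp: algebra_simps hs os w)
  }
  {
    assume B: ?B
    have zero: "AU = 0 \<and> AD = 0 \<and> q' = 0 \<and> AZ = 0"
      if A: "AU \<in> hom u u" "AD \<in> hom e e" "q' \<in> hom u e" "AZ \<in> hom z z"
        and c1: "AU * th = th * AD"
        and d1: "(F1 + la * F2 * \<phi>) * AU - AU * (F1 + la * F2 * \<phi>) + th * q' = 0"
        and d2: "tp (Ge * (e * F3 * e * AD - AD * (e * F3 * e) - q' * th))
          = Ge * (e * F3 * e * AD - AD * (e * F3 * e) - q' * th)"
        and d3: "tp (Ge * AD) = - (Ge * AD)"
        and f2: "tp (Gz * ((z * F3 * z + nu * F2 * ze) * AZ - AZ * (z * F3 * z + nu * F2 * ze)))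
          = Gz * ((z * F3 * z + nu * F2 * ze) * AZ - AZ * (z * F3 * z + nu * F2 * ze))"
        and f3: "tp (Gz * AZ) = - (Gz * AZ)"
      for AU AD q' AZ
    proof -
      note As = A[THEN hom_simps(1)] A[THEN hom_simps(2)] A[THEN hom_simps(3)] A[THEN hom_simps(4)]
      define A2 where "A2 = \<phi> * AU * la + ze * AZ * nu"
      define A3 where "A3 = AD + AZ"
      \<comment> \<open>Index 1 refers to the \<open>u\<close> or \<open>e\<close> side and index 2
        to \<open>z\<close>. The equation over \<open>m\<close>, projected by \<open>nu\<close>,
        forces \<open>q21\<close> and \<open>q22\<close>. The symmetry condition on \<open>w\<close>
        makes its off-diagonal blocks adjoint to each other, which forces \<open>q12\<close>; the
        block from \<open>z\<close> to \<open>u\<close> then determines \<open>p2\<close>.\<close>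
      define q21 where "q21 = - (nu * F2 * \<phi> * AU - AZ * nu * F2 * \<phi>)"
      define q22 where "q22 = - (nu * F2 * ze * AZ - AZ * nu * F2 * ze)"
      define X where "X = z * F3 * AD - AZ * F3 * e - q21 * th"
      define q12 where "q12 = e * F3 * AZ - AD * F3 * z - He * tp (Gz * X)"
      define p2 where "p2 = - (la * F2 * ze * AZ - AU * la * F2 * ze) - th * q12"
      define p where "p = (F1 * AU - AU * F1) * la + p2 * nu"
      define q where "q = q' * la + q12 * nu + q21 * la + q22 * nu"
      have o2: "AD * z = 0" "z * AD = 0" "e * AZ = 0" "AZ * e = 0" "th * AZ = 0" "ze * AD = 0" "z * q' = 0" "ze * q' = 0"
        by (rule hom_orth[OF hz A(2) i(5)] hom_orth[OF A(2) hz i(6)] hom_orth[OF A(4) he i(5)] hom_orth[OF he A(4) i(6)]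
          hom_orth[OF A(4) th i(5)] hom_orth[OF A(2) ze i(6)] hom_orth[OF A(3) hz i(6)] hom_orth[OF A(3) ze i(6)])+
      have h21: "q21 \<in> hom u z" and h22: "q22 \<in> hom z z"
        unfolding q21_def q22_def by (rule homI; simp add: algebra_simps hs As)+
      note h2s = h21[THEN hom_simps(1)] h21[THEN hom_simps(2)] h21[THEN hom_simps(3)] h21[THEN hom_simps(4)]
        h22[THEN hom_simps(1)] h22[THEN hom_simps(2)] h22[THEN hom_simps(3)] h22[THEN hom_simps(4)]
      have hX: "X \<in> hom e z"
        unfolding X_def by (rule homI; simp add: algebra_simps hs As h2s)
      have htX: "tp (Gz * X) \<in> hom z (tp e)"
        using hom_tp[OF hom_mult'[OF G(2) hX]] by simp
      note hXs = htX[THEN hom_simps(1)] htX[THEN hom_simps(2)] htX[THEN hom_simps(3)] htX[THEN hom_simps(4)]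
        hX[THEN hom_simps(1)] hX[THEN hom_simps(2)] hX[THEN hom_simps(3)] hX[THEN hom_simps(4)]
      have h12: "q12 \<in> hom z e"
        unfolding q12_def by (rule homI; simp add: algebra_simps hs As hXs del: tp_mult)
      note h12s = h12[THEN hom_simps(1)] h12[THEN hom_simps(2)] h12[THEN hom_simps(3)] h12[THEN hom_simps(4)]
      have hp2: "p2 \<in> hom z u"
        unfolding p2_def by (rule homI; simp add: algebra_simps hs As h12s)
      note hp2s = hp2[THEN hom_simps(1)] hp2[THEN hom_simps(2)] hp2[THEN hom_simps(3)] hp2[THEN hom_simps(4)]
      have o3: "th * q21 = 0" "th * q22 = 0" "ze * q12 = 0" "z * q12 = 0" "e * q21 = 0" "e * q22 = 0"
        by (rule hom_orth[OF h21 th i(5)] hom_orth[OF h22 th i(5)] hom_orth[OF h12 ze i(6)] hom_orth[OF h12 hz i(6)]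
          hom_orth[OF h21 he i(5)] hom_orth[OF h22 he i(5)])+
      note oo = o2 o3 o2[THEN mult_eq_ext] o3[THEN mult_eq_ext]
      have hh: "A2 \<in> hom m m" "A3 \<in> hom w w" "p \<in> hom m u" "q \<in> hom m w"
        unfolding A2_def A3_def p_def q_def w
        by (rule homI; simp add: algebra_simps hs As h2s h12s hp2s oo)+
      have E: "A2 * \<phi> = \<phi> * AU" "A2 * ze = ze * AZ" "la * A2 = AU * la" "nu * A2 = AZ * nu"
        by (simp_all add: A2_def algebra_simps ii hs As)
      have pq: "p * \<phi> = F1 * AU - AU * F1" "p * ze = p2" "q * \<phi> = q' + q21" "q * ze = q12 + q22"
        by (simp_all add: p_def q_def algebra_simps ii hs As h2s h12s hp2s)
      note EE = E pq E[THEN mult_eq_ext] pq[THEN mult_eq_ext]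
      define M where "M = F2 * A2 - A2 * F2 + \<phi> * p + (\<phi> * th + ze) * q"
      have "la * (M * \<phi>) = 0" "la * (M * ze) = 0" "nu * (M * \<phi>) = 0" "nu * (M * ze) = 0"
        using d1 by (simp_all add: M_def algebra_simps EE ii hs As oo h2s h12s)
          (simp_all add: p2_def q21_def q22_def algebra_simps hs As)
      then have Mz: "\<phi> * (la * (M * \<phi>)) = 0" "\<phi> * (la * (M * ze)) = 0" "ze * (nu * (M * \<phi>)) = 0" "ze * (nu * (M * ze)) = 0"
        by simp_all
      have Mm: "m * M = M" "M * m = M"
        using hh by (simp_all add: M_def algebra_simps hs hom_simps)
      have "M * \<phi> = 0" "M * ze = 0"
        using Mz arg_cong[OF m, of "\<lambda>x. x * (M * \<phi>)"] arg_cong[OF m, of "\<lambda>x. x * (M * ze)"] Mm(1)[THEN mult_eq_ext]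
        by (simp_all add: distrib_right mult.assoc)
      then have M0: "M = 0"
        using arg_cong[OF m, of "\<lambda>x. M * x"] Mm(2) by (simp add: distrib_left mult_eq_ext[of M])
      define Y where "Y = F3 * A3 - A3 * F3 - q * (\<phi> * th + ze)"
      define Y1 where "Y1 = e * F3 * e * AD - AD * (e * F3 * e) - q' * th"
      define Y2 where "Y2 = (z * F3 * z + nu * F2 * ze) * AZ - AZ * (z * F3 * z + nu * F2 * ze)"
      have F3w: "R * F3 = R * (F3 * e) + R * (F3 * z)" for R
        using hom_simps(2)[OF F(3)] by (metis distrib_left w)
      have eY: "e * Y = Y1 + He * tp (Gz * X)"
        by (simp add: Y_def Y1_def A3_def q12_def algebra_simps EE hs As oo h12s h2s del: tp_mult)
          (simp add: F3w[of AD] q12_def algebra_simps del: tp_mult)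
      have zY: "z * Y = X + Y2"
        by (simp add: Y_def Y2_def A3_def algebra_simps EE hs As oo h12s h2s)
          (simp add: F3w[of AZ] X_def q22_def algebra_simps hs As ii)
      have "(Ge + Gz) * Y = Ge * (e * Y) + Gz * (z * Y)"
        by (simp add: algebra_simps hs)
      also have "\<dots> = Ge * Y1 + tp (Gz * X) + Gz * X + Gz * Y2"
        unfolding eY zY by (simp add: algebra_simps ii hXs del: tp_mult)
      finally have GY: "(Ge + Gz) * Y = Ge * Y1 + tp (Gz * X) + Gz * X + Gz * Y2" .
      have s1: "tp ((Ge + Gz) * Y) = (Ge + Gz) * Y"
        unfolding GY using d2[folded Y1_def] f2[folded Y2_def] by (simp add: algebra_simps del: tp_mult)
      have GA: "(Ge + Gz) * A3 = Ge * AD + Gz * AZ"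
        using o2(1,3) by (simp add: A3_def algebra_simps) (metis As add.right_neutral add_0 G hs o2 mult.assoc mult_zero_left mult_zero_right os)
      have s2: "tp ((Ge + Gz) * A3) = - ((Ge + Gz) * A3)"
        unfolding GA using d3 f3 by (simp add: algebra_simps del: tp_mult)
      have "(\<phi> * th + ze) * A3 = \<phi> * th * AD + ze * AZ"
        by (simp add: A3_def algebra_simps oo)
      then have s3: "A2 * (\<phi> * th + ze) = (\<phi> * th + ze) * A3"
        by (simp add: algebra_simps EE c1)
      have "sol u m w \<phi> (\<phi> * th + ze) (Ge + Gz) F1 F2 F3 AU A2 A3 p q"
        unfolding sol_def using A(1) hh E(1) s1 s2 s3 M0 pq(1) by (simp add: Y_def M_def)
      then have zz: "AU = 0" "A3 = 0" "q = 0" using B unfolding reg_def by blast+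
      have "AD = e * A3" "AZ = z * A3" "q' = e * (q * \<phi>)"
        by (simp_all add: A3_def algebra_simps hs As oo EE)
      then show ?thesis using zz by simp
    qed
    have ?S2
      unfolding skew_trivial_def using zero[of 0 0 0] by (auto simp: hom_zero)
    moreover have ?S1
      unfolding reg_def
    proof (intro conjI allI impI)
      fix A1 A2 A3 p q
      assume S: "sol 0 u e 0 th Ge 0 (F1 + la * F2 * \<phi>) (e * F3 * e) A1 A2 A3 p q"
      then show "A1 = 0" "p = 0" by (auto simp: sol_def hom_def)
      show "A2 = 0" "A3 = 0" "q = 0"
        using S zero[of A2 A3 q 0] by (auto simp: sol_def hom_zero)
    qed (use id th Ge ho F(3) in \<open>auto intro!: homI simp: idem_def hom_zero algebra_simps hs os\<close>)
    ultimately show "?S1 \<and> ?S2" by blast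
  }
qed

section \<open>Existence of regular data depends only on ranks\<close>

definition regular_on :: "'k::field fin_mat \<Rightarrow> 'k fin_mat \<Rightarrow> 'k fin_mat \<Rightarrow> bool" where
  "regular_on u m w \<longleftrightarrow> (\<exists>\<phi> \<psi> G F1 F2 F3. reg u m w \<phi> \<psi> G F1 F2 F3)"

text \<open>The form is a map into the dual space, so it is carried over by \<open>tp yw\<close>
  where the other maps use \<open>xw\<close>.\<close>

lemma reg_transport:
  assumes R: "reg u m w \<phi> \<psi> G F1 F2 F3" and id: "idem u'" "idem m'" "idem w'"
    and i: "iso_via u u' xu yu" "iso_via m m' xm ym" "iso_via w w' xw yw"
  shows "reg u' m' w' (xm * \<phi> * yu) (xm * \<psi> * yw) (tp yw * G * yw) (xu * F1 * yu) (xm * F2 * ym) (xw * F3 * yw)"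
proof -
  note R' = R[unfolded reg_def]
  obtain H where form: "form_on w G H" using R' by blast
  have ho: "\<phi> \<in> hom u m" "\<psi> \<in> hom w m" "F1 \<in> hom u u" "F2 \<in> hom m m" "F3 \<in> hom w w"
    "G \<in> hom w (tp w)" "H \<in> hom (tp w) w"
    "xu \<in> hom u u'" "yu \<in> hom u' u" "xm \<in> hom m m'" "ym \<in> hom m' m" "xw \<in> hom w w'" "yw \<in> hom w' w"
    and ii: "xu * yu = u'" "yu * xu = u" "xm * ym = m'" "ym * xm = m" "xw * yw = w'" "yw * xw = w"
    and GH: "tp G = G" "H * G = w" "G * H = tp w"
    using R' i form by (auto simp: iso_via_def form_on_def)
  have tph: "tp xw \<in> hom (tp w') (tp w)" "tp yw \<in> hom (tp w) (tp w')" "tp F3 \<in> hom (tp w) (tp w)" "tp \<psi> \<in> hom (tp m) (tp w)"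
    using ho(12,13,5,2)[THEN hom_tp] by auto
  have tpi: "tp yw * tp xw = tp w'" "tp xw * tp yw = tp w" by (simp_all add: ii flip: tp_mult)
  note ho' = ho tph
  note hs = ho'[THEN hom_simps(1)] ho'[THEN hom_simps(2)] ho'[THEN hom_simps(3)] ho'[THEN hom_simps(4)]
  note iss = ii tpi GH(2,3) ii[THEN mult_eq_ext] tpi[THEN mult_eq_ext] GH(2,3)[THEN mult_eq_ext]
  have "form_on w' (tp yw * G * yw) (xw * H * tp xw)"
    unfolding form_on_def by (auto intro!: homI simp: mult.assoc hs iss GH)
  moreover have "A1 = 0 \<and> A2 = 0 \<and> A3 = 0 \<and> p = 0 \<and> q = 0"
    if "sol u' m' w' (xm * \<phi> * yu) (xm * \<psi> * yw) (tp yw * G * yw) (xu * F1 * yu) (xm * F2 * ym) (xw * F3 * yw) A1 A2 A3 p q"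
    for A1 A2 A3 p q
  proof -
    note S = that[unfolded sol_def]
    have A: "A1 \<in> hom u' u'" "A2 \<in> hom m' m'" "A3 \<in> hom w' w'" "p \<in> hom m' u'" "q \<in> hom m' w'" using S by auto
    note As = A[THEN hom_simps(1)] A[THEN hom_simps(2)] A[THEN hom_simps(3)] A[THEN hom_simps(4)]
    have E: "A2 * (xm * \<phi> * yu) = xm * \<phi> * yu * A1" "A2 * (xm * \<psi> * yw) = xm * \<psi> * yw * A3"
      "tp ((tp yw * G * yw) * A3) = - ((tp yw * G * yw) * A3)"
      "xu * F1 * yu * A1 - A1 * (xu * F1 * yu) = p * (xm * \<phi> * yu)"
      "xm * F2 * ym * A2 - A2 * (xm * F2 * ym) + xm * \<phi> * yu * p + xm * \<psi> * yw * q = 0"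
      "tp ((tp yw * G * yw) * (xw * F3 * yw * A3 - A3 * (xw * F3 * yw) - q * (xm * \<psi> * yw)))
        = (tp yw * G * yw) * (xw * F3 * yw * A3 - A3 * (xw * F3 * yw) - q * (xm * \<psi> * yw))"
      using S by auto
    let ?A1 = "yu * A1 * xu" and ?A2 = "ym * A2 * xm" and ?A3 = "yw * A3 * xw" and ?p = "yu * p * xm" and ?q = "yw * q * xm"
    have e: "?A2 * \<phi> = \<phi> * ?A1" "?A2 * \<psi> = \<psi> * ?A3"
      "F1 * ?A1 - ?A1 * F1 = ?p * \<phi>" "F2 * ?A2 - ?A2 * F2 + \<phi> * ?p + \<psi> * ?q = 0"
      using arg_cong[OF E(1), of "\<lambda>x. ym * x * xu"] arg_cong[OF E(2), of "\<lambda>x. ym * x * xw"]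
        arg_cong[OF E(4), of "\<lambda>x. yu * x * xu"] arg_cong[OF E(5), of "\<lambda>x. ym * x * xm"]
      by (simp_all add: algebra_simps hs iss As)
    have e3: "tp (G * ?A3) = - (G * ?A3)"
      using arg_cong[OF E(3), of "\<lambda>x. tp xw * x * xw"]
      by (simp add: algebra_simps hs iss As GH)
    have e6: "tp (G * (F3 * ?A3 - ?A3 * F3 - ?q * \<psi>)) = G * (F3 * ?A3 - ?A3 * F3 - ?q * \<psi>)"
      using arg_cong[OF E(6), of "\<lambda>x. tp xw * x * xw"]
      by (simp add: algebra_simps hs iss As GH)
    have "sol u m w \<phi> \<psi> G F1 F2 F3 ?A1 ?A2 ?A3 ?p ?q"
      unfolding sol_def using e e3 e6 by (auto intro!: homI simp: mult.assoc hs)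
    then have z: "?A1 = 0" "?A2 = 0" "?A3 = 0" "?p = 0" "?q = 0" using R' by blast+
    have "A1 = xu * ?A1 * yu" "A2 = xm * ?A2 * ym" "A3 = xw * ?A3 * yw" "p = xu * ?p * ym" "q = xw * ?q * ym"
      by (simp_all add: algebra_simps hs iss As)
    then show ?thesis using z by simp
  qed
  ultimately show ?thesis
    unfolding reg_def using id by (auto intro!: homI simp: mult.assoc hs)
qed

lemma regular_on_cong:
  fixes u m w :: "'k::field_char_0 fin_mat"
  assumes "idem u" "idem m" "idem w" "idem u'" "idem m'" "idem w'" "tr u = tr u'" "tr m = tr m'" "tr w = tr w'"
  shows "regular_on u m w \<longleftrightarrow> regular_on u' m' w'"
  using assms idem_iso reg_transport unfolding regular_on_def by metis

section \<open>Trivial kernel forces maximal rank\<close>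

lemma quasi_inverse:
  assumes x: "x \<in> hom e f" and id: "idem e" "idem f"
  obtains y where "y \<in> hom f e" "x * (y * x) = x"
proof -
  obtain b where b: "x * b * x = x" using fin_mat_regular by blast
  note ho = id[THEN idem_hom] x
  note hs = ho[THEN hom_simps(1)] ho[THEN hom_simps(2)] ho[THEN hom_simps(3)] ho[THEN hom_simps(4)]
  show ?thesis
    by (rule that[of "e * b * f"]) (use b in \<open>auto intro!: homI simp: mult.assoc hs\<close>)
qed

text \<open>The idempotents \<open>e - y * x\<close> and \<open>f - x * y\<close> project onto a
  kernel and a cokernel of \<open>x\<close>. Their ranks differ by \<open>a - b\<close>, so if one
  of them is zero, the comparison of \<open>a\<close> and \<open>b\<close> tells which.\<close>

lemma hom_tr_dichotomy:
  fixes e f :: "'k::field_char_0 fin_mat"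
  assumes x: "x \<in> hom e f" and y: "y \<in> hom f e" and xyx: "x * (y * x) = x" and id: "idem e" "idem f"
    and or: "e - y * x = 0 \<or> f - x * y = 0" and t: "tr e = of_nat a" "tr f = of_nat b"
  shows "a \<le> b \<Longrightarrow> y * x = e" "b \<le> a \<Longrightarrow> x * y = f"
proof -
  note ho = id[THEN idem_hom] x y
  note hs = ho[THEN hom_simps(1)] ho[THEN hom_simps(2)] ho[THEN hom_simps(3)] ho[THEN hom_simps(4)]
  have x': "x * (y * (x * s)) = x * s" for s using xyx by (metis mult.assoc)
  have "idem (e - y * x)" "idem (f - x * y)"
    by (simp_all add: idem_def algebra_simps hs xyx x')
  then obtain r s where r: "tr (e - y * x) = of_nat r" "r = 0 \<longleftrightarrow> e - y * x = 0"
    and s: "tr (f - x * y) = of_nat s" "s = 0 \<longleftrightarrow> f - x * y = 0"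
    using idem_rank by metis
  have "(of_nat a :: 'k) + of_nat s = of_nat b + of_nat r"
    using r(1) s(1) t tr_mult_commute[of x y] by (simp add: algebra_simps)
  then have ab: "a + s = b + r" by (metis of_nat_add of_nat_eq_iff)
  show "a \<le> b \<Longrightarrow> y * x = e" using ab or r(2) s(2) by auto
  show "b \<le> a \<Longrightarrow> x * y = f" using ab or r(2) s(2) by auto
qed

text \<open>
  Solutions whose \<open>A\<close> components vanish. They rule out maps that are not of maximal rank: a nonzero
  map from the cokernel to the kernel of \<open>\<phi>\<close> (or of the induced map of \<open>\<psi>\<close>) would be such a solution.
\<close>

lemma sol_null:
  assumes "reg u m w \<phi> \<psi> G F1 F2 F3" "p \<in> hom m u" "q \<in> hom m w" "p * \<phi> = 0" "\<phi> * p + \<psi> * q = 0"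
    "tp (G * (q * \<psi>)) = G * (q * \<psi>)"
  shows "p = 0" "q = 0"
proof -
  have "sol u m w \<phi> \<psi> G F1 F2 F3 0 0 0 p q"
    using assms unfolding sol_def by (simp add: hom_zero)
  then show "p = 0" "q = 0" using assms(1) unfolding reg_def by blast+
qed

lemma reg_phi_max_rank:
  assumes R: "reg u m w \<phi> \<psi> G F1 F2 F3" and la: "la \<in> hom m u" and q: "\<phi> * (la * \<phi>) = \<phi>"
  shows "u - la * \<phi> = 0 \<or> m - \<phi> * la = 0"
proof (rule ccontr)
  assume "\<not> ?thesis"
  then obtain X where X: "(u - la * \<phi>) * X * (m - \<phi> * la) \<noteq> 0" using fin_mat_prime by blast
  have ho: "\<phi> \<in> hom u m" "u \<in> hom u u" "m \<in> hom m m" using R by (auto simp: reg_def idem_hom)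
  note ho' = ho la
  note hs = ho'[THEN hom_simps(1)] ho'[THEN hom_simps(2)] ho'[THEN hom_simps(3)] ho'[THEN hom_simps(4)]
  have q': "\<phi> * (la * (\<phi> * z)) = \<phi> * z" for z using q by (metis mult.assoc)
  have "(u - la * \<phi>) * X * (m - \<phi> * la) = 0"
    by (rule sol_null(1)[OF R _ hom_zero[of m w]]) (auto intro!: homI simp: algebra_simps hs q q')
  then show False using X by simp
qed

lemma reg_psi_max_rank:
  assumes R: "reg u m w \<phi> \<psi> G F1 F2 F3" and la: "la \<in> hom m u" and l: "la * \<phi> = u"
    and mu: "mu \<in> hom (m - \<phi> * la) w" and q: "(m - \<phi> * la) * \<psi> * (mu * ((m - \<phi> * la) * \<psi>)) = (m - \<phi> * la) * \<psi>"
  shows "w - mu * ((m - \<phi> * la) * \<psi>) = 0 \<or> (m - \<phi> * la) - (m - \<phi> * la) * \<psi> * mu = 0"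
proof (rule ccontr)
  define n where "n = m - \<phi> * la"
  define \<psi>1 where "\<psi>1 = n * \<psi>"
  assume "\<not> ?thesis"
  then obtain X where X: "(w - mu * \<psi>1) * X * (n - \<psi>1 * mu) \<noteq> 0"
    using fin_mat_prime unfolding n_def \<psi>1_def by blast
  have ho: "\<phi> \<in> hom u m" "u \<in> hom u u" "m \<in> hom m m" "\<psi> \<in> hom w m" "w \<in> hom w w"
    using R by (auto simp: reg_def idem_hom)
  note ho' = ho la
  note hs0 = ho'[THEN hom_simps(1)] ho'[THEN hom_simps(2)] ho'[THEN hom_simps(3)] ho'[THEN hom_simps(4)]
  have n0: "n * \<phi> = 0" "la * n = 0" "n * n = n" "m * n = n" "n * m = n"
    by (simp_all add: n_def algebra_simps hs0 l l[THEN mult_eq_ext])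
  note n = n0 n0[THEN mult_eq_ext]
  have p1: "\<psi>1 \<in> hom w n" unfolding \<psi>1_def by (rule homI) (simp_all add: mult.assoc n hs0)
  note ho2 = ho' p1 mu[folded n_def]
  note hs = ho2[THEN hom_simps(1)] ho2[THEN hom_simps(2)] ho2[THEN hom_simps(3)] ho2[THEN hom_simps(4)]
  have qq: "\<psi>1 * (mu * \<psi>1) = \<psi>1" using q by (simp add: \<psi>1_def n_def mult.assoc)
  have q': "\<psi>1 * (mu * (\<psi>1 * z)) = \<psi>1 * z" for z using qq by (metis mult.assoc)
  have dec: "\<psi> = \<phi> * (la * \<psi>) + \<psi>1" by (simp add: \<psi>1_def n_def algebra_simps hs)
  define q where "q = (w - mu * \<psi>1) * X * (n - \<psi>1 * mu)"
  \<comment> \<open>As \<open>\<psi>1 * q = 0\<close>, the product \<open>\<psi> * q\<close> lies in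
    the image of \<open>\<phi>\<close>, where \<open>p\<close> cancels it.\<close>
  define p where "p = - (la * \<psi> * q)"
  have nm: "\<psi>1 * (mu * m) = \<psi>1 * mu" "mu * m = mu"
    using hs n by (metis hom_simps(2) mu mult.assoc n_def)+
  have mup: "mu * \<phi> = 0" by (metis hom_simps(4) mu mult_zero_right n(1) n_def)
  have n\<psi>: "n * \<psi> = \<psi>1" by (simp add: \<psi>1_def)
  have mu\<psi>: "mu * \<psi> = mu * \<psi>1" by (metis hom_simps(4) mu n_def n\<psi>)
  note S = nm mup n\<psi> mu\<psi> nm(2)[THEN mult_eq_ext] mup[THEN mult_eq_ext] n\<psi>[THEN mult_eq_ext] mu\<psi>[THEN mult_eq_ext]
  have q\<psi>: "q * \<psi> = 0" 
    by (simp add: q_def algebra_simps S hs qq q' n)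
  have q\<phi>: "q * \<phi> = 0"
    by (simp add: q_def algebra_simps S hs qq q' n)
  have pq: "\<psi>1 * q = 0" by (simp add: q_def algebra_simps hs qq q')
  have "\<phi> * p + \<psi> * q = 0"
    using arg_cong[OF dec, of "\<lambda>x. x * q"] pq by (simp add: p_def algebra_simps)
  moreover have "p \<in> hom m u" "q \<in> hom m w"
    unfolding p_def q_def by (auto intro!: homI simp: algebra_simps hs S n)
  ultimately have "q = 0"
    using q\<phi> q\<psi> by (intro sol_null(2)[OF R, of p q]) (simp_all add: p_def mult.assoc)
  then show False using X by (simp add: q_def)
qed

section \<open>The orthogonal Lie algebra on its own\<close>

lemma fin_mat_self_neg:
  fixes A :: "'k::field_char_0 fin_mat"
  assumes "A = - A"
  shows "A = 0"
proof (rule fin_mat_eqI)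
  fix i j
  have "entry A i j = - entry A i j" using assms by (metis entry_uminus)
  then have "2 * entry A i j = 0" by (simp only: mult_2 eq_neg_iff_add_eq_0)
  then show "entry A i j = entry 0 i j" by simp
qed

text \<open>The kernel always contains the skew part of \<open>F\<close>. If that part vanishes, the
  functional is zero on the orthogonal Lie algebra, which then lies in the kernel as a whole. So
  triviality means that there are no nonzero skew maps.\<close>

lemma skew_trivial_iff_small:
  fixes w :: "'k::field_char_0 fin_mat"
  assumes form: "form_on w G H" and id: "idem w" and F: "F \<in> hom w w" and t: "tr w = of_nat t"
  shows "skew_trivial w G F \<longleftrightarrow> t \<le> 1"
proof -
  have G: "G \<in> hom w (tp w)" "tp G = G" and H: "H \<in> hom (tp w) w" "tp H = H" and GH: "H * G = w" "G * H = tp w"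
    using form form_on_tp[OF form] by (auto simp: form_on_def)
  obtain x y where i: "iso_via (dg {..<t}) w x y"
    using idem_iso[of "dg {..<t}" w] id t by (auto simp: idem_def tr_dg)
  let ?d = "dg {..<t} :: 'k fin_mat"
  have h: "x \<in> hom ?d w" "y \<in> hom w ?d" and xy: "x * y = w" "y * x = ?d" using i by (auto simp: iso_via_def)
  have tph: "tp x \<in> hom (tp w) ?d" "tp y \<in> hom ?d (tp w)" "tp F \<in> hom (tp w) (tp w)" "tp w \<in> hom (tp w) (tp w)"
    using h[THEN hom_tp] F[THEN hom_tp] idem_hom[OF id, THEN hom_tp] by auto
  note ho = G(1) H(1) F h tph idem_hom[OF id]
  note hs = ho[THEN hom_simps(1)] ho[THEN hom_simps(2)] ho[THEN hom_simps(3)] ho[THEN hom_simps(4)]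
  have tpi: "tp x * tp y = ?d" "tp y * tp x = tp w" by (simp_all add: xy flip: tp_mult)
  note ii = GH xy tpi GH[THEN mult_eq_ext] xy[THEN mult_eq_ext] tpi[THEN mult_eq_ext]
  show ?thesis
  proof
    assume t1: "t \<le> 1"
    show "skew_trivial w G F"
      unfolding skew_trivial_def
    proof (intro ballI impI, elim conjE)
      fix A assume A: "A \<in> hom w w" and sk: "tp (G * A) = - (G * A)"
      have As: "w * A = A" "A * w = A" "w * (A * s) = A * s" "A * (w * s) = A * s" for s using hom_simps[OF A] by auto
      define g where "g = tp x * (G * A) * x"
      have "tp g = - g" using arg_cong[OF sk, of "\<lambda>s. tp x * s * x"] by (simp add: g_def mult.assoc G)
      moreover have "?d * g * ?d = g" by (simp add: g_def mult.assoc hs)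
      then have "entry g i j = (if i < t \<and> j < t then entry g i j else 0)" for i j
        by (metis (no_types, lifting) entry_dg_times entry_times_dg finite_lessThan lessThan_iff)
      then have "tp g = g" using t1 by (intro fin_mat_eqI) (metis entry_tp less_one order_less_le_trans)
      ultimately have "g = 0" by (intro fin_mat_self_neg) simp
      then have "tp y * g * y = 0" by simp
      then have "G * A = 0" by (simp add: g_def mult.assoc ii hs As)
      then have "H * (G * A) = 0" by simp
      then show "A = 0" by (simp add: ii As)
    qed
  next
    assume triv: "skew_trivial w G F"
    then have triv': "A = 0" if "A \<in> hom w w" "tp (G * A) = - (G * A)" "tp (G * (F * A - A * F)) = G * (F * A - A * F)" for A
      using that unfolding skew_trivial_def by blast
    have GF0: "G * F = tp F * G"
    proof -
      \<comment> \<open>With the adjoint \<open>H * (tp F * G)\<close> of \<open>F\<close>, the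
        commutator of \<open>F\<close> and \<open>F\<close> minus its adjoint is self-adjoint, so
        this skew map satisfies both conditions.\<close>
      have "F - H * (tp F * G) = 0"
        by (rule triv') (auto intro!: homI simp: algebra_simps hs ii G H)
      then have "G * (F - H * (tp F * G)) = 0" by simp
      then show ?thesis by (simp add: algebra_simps ii hs)
    qed
    \<comment> \<open>For self-adjoint \<open>F\<close> the commutator with any skew map is
      self-adjoint, so every \<open>H * (r - tp r)\<close> lies in the kernel.\<close>
    have sym: "r = tp r" if r: "r \<in> hom w (tp w)" for r
    proof -
      have tr: "tp r \<in> hom w (tp w)" using hom_tp[OF r] by simp
      note rs = hom_simps[OF r] hom_simps[OF tr]
      have GF': "G * (F * s) = tp F * (G * s)" for s using GF0 by (metis mult.assoc)
      have "tp w * tp F = tp F" "w * F = F" using hs by auto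
      have "H * (r - tp r) = 0"
        by (rule triv') (auto intro!: homI simp: algebra_simps hs ii G H rs GF0 GF')
      then have "G * (H * (r - tp r)) = 0" by simp
      then show ?thesis by (simp add: algebra_simps ii rs)
    qed
    show "t \<le> 1"
    proof (rule ccontr)
      assume "\<not> t \<le> 1"
      define s :: "'k fin_mat" where "s = single 0 1 1"
      have "?d * s = s" "s * ?d = s"
        using \<open>\<not> t \<le> 1\<close> by (auto intro!: fin_mat_eqI simp: entry_dg_times entry_times_dg s_def)
      then have ss: "?d * s = s" "s * ?d = s" "?d * (s * r) = s * r" "s * (?d * r) = s * r" for r
        by (auto simp flip: mult.assoc)
      have st: "tp s * ?d = tp s" "?d * tp s = tp s"
        using arg_cong[OF ss(1), of tp] arg_cong[OF ss(2), of tp] by simp_all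
      have "tp y * s * y = tp (tp y * s * y)"
        by (rule sym) (auto intro!: homI simp: mult.assoc hs)
      from arg_cong[OF this, of "\<lambda>z. tp x * z * x"] have "s = tp s"
        by (simp add: mult.assoc ii ss st)
      then have "entry s 0 1 = entry (tp s) 0 1" by simp
      then show False by (simp add: s_def)
    qed
  qed
qed

text \<open>A way back from the splitting step that ends in inclusions and
  \<open>F1 = F3 = 0\<close>. The idempotents are orthogonal, so the five maps occupy disjoint
  blocks of one endomorphism of the sum, and \<open>reg_split\<close> reads them off again.\<close>

lemma reg_inclusions:
  assumes R: "reg u m' w \<phi>' \<psi>' G F1' F2' F3'"
    and o: "u * m' = 0" "m' * u = 0" "w * m' = 0" "m' * w = 0" "u * w = 0" "w * u = 0"
  shows "reg u (u + w + m') w u w G 0 (\<phi>' + \<psi>' + F2' + F1' + F3') 0"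
proof -
  obtain H where form: "form_on w G H" using R by (auto simp: reg_def)
  have id: "idem u" "idem m'" "idem w" using R by (auto simp: reg_def)
  have ho: "u \<in> hom u u" "m' \<in> hom m' m'" "w \<in> hom w w" "\<phi>' \<in> hom u m'" "\<psi>' \<in> hom w m'"
    "F1' \<in> hom u u" "F2' \<in> hom m' m'" "F3' \<in> hom w w"
    using R by (auto simp: reg_def idem_hom)
  note hs = ho[THEN hom_simps(1)] ho[THEN hom_simps(2)] ho[THEN hom_simps(3)] ho[THEN hom_simps(4)]
  have z: "s * (r * X) = 0" "s * r = 0" if "s \<in> hom a e" "r \<in> hom f b" "a * b = 0" for s r X a b e f
    using hom_orth[OF that(2,1,3)] mult_eq_ext[of s r 0] by simp_all
  note zs = z[OF ho(4) ho(3) o(5)] z[OF ho(4) ho(2) o(1)] z[OF ho(5) ho(1) o(6)]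
    z[OF ho(5) ho(2) o(3)] z[OF ho(6) ho(2) o(1)] z[OF ho(6) ho(3) o(5)] z[OF ho(7) ho(1) o(2)]
    z[OF ho(7) ho(3) o(4)] z[OF ho(8) ho(1) o(6)] z[OF ho(8) ho(2) o(3)] z[OF ho(2) ho(6) o(2)]
    z[OF ho(2) ho(8) o(4)] z[OF ho(1) ho(4) o(1)] z[OF ho(1) ho(5) o(1)] z[OF ho(1) ho(7) o(1)]
    z[OF ho(1) ho(8) o(5)] z[OF ho(3) ho(4) o(3)] z[OF ho(3) ho(5) o(3)] z[OF ho(3) ho(7) o(3)]
    z[OF ho(3) ho(6) o(6)]
  have c: "m' * (\<phi>' + \<psi>' + F2' + F1' + F3') * u = \<phi>'" "m' * (\<phi>' + \<psi>' + F2' + F1' + F3') * w = \<psi>'"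
    "m' * (\<phi>' + \<psi>' + F2' + F1' + F3') * m' = F2'" "u * (\<phi>' + \<psi>' + F2' + F1' + F3') * u = F1'"
    "w * (\<phi>' + \<psi>' + F2' + F1' + F3') * w = F3'"
    by (simp_all add: algebra_simps hs zs)
  have "reg u (u + w + m') w u w G 0 (\<phi>' + \<psi>' + F2' + F1' + F3') 0 \<longleftrightarrow>
    reg u m' w (m' * (\<phi>' + \<psi>' + F2' + F1' + F3') * u) (m' * (\<phi>' + \<psi>' + F2' + F1' + F3') * w) G
      (0 + u * (\<phi>' + \<psi>' + F2' + F1' + F3') * u) (m' * (\<phi>' + \<psi>' + F2' + F1' + F3') * m')
      (0 + w * (\<phi>' + \<psi>' + F2' + F1' + F3') * w)"
    by (rule reg_split[OF _ _ _ _ _ _ _ _ _ _ _ _ _ _ _ _ id(1) id(3) id(2) _ form])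
      (auto intro!: homI simp: idem_def algebra_simps hs o o[THEN mult_eq_ext] zs)
  then show ?thesis unfolding c using R by simp
qed

text \<open>The way back from the orthogonal step: a symmetric idempotent \<open>z\<close>, used as
  its own form, is added to the middle and the last space. Rank at most one makes its orthogonal Lie
  algebra zero, and \<open>F2\<close>, \<open>F3\<close> stay as they are.\<close>

lemma reg_orthogonal_inclusions:
  fixes z :: "'k::field_char_0 fin_mat"
  assumes R: "reg 0 u e 0 th Ge 0 F2 F3" and id: "idem z" and t: "tr z = of_nat t" "t \<le> 1"
    and tz: "tp z = z" and o: "u * z = 0" "z * u = 0" "e * z = 0" "z * e = 0"
  shows "reg u (u + z) (e + z) u (th + z) (Ge + z) 0 F2 F3"
proof -
  obtain He where form: "form_on e Ge He" using R by (auto simp: reg_def)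
  have id': "idem u" "idem e" using R by (auto simp: reg_def)
  have ho: "u \<in> hom u u" "e \<in> hom e e" "z \<in> hom z z" "th \<in> hom e u" "F2 \<in> hom u u" "F3 \<in> hom e e"
    using R id by (auto simp: reg_def idem_hom)
  note hs = ho[THEN hom_simps(1)] ho[THEN hom_simps(2)] ho[THEN hom_simps(3)] ho[THEN hom_simps(4)]
  have fz: "form_on z z z" using id tz by (simp add: form_on_def hom_def idem_def)
  have o2: "th * z = 0" "z * th = 0" "z * F2 = 0" "F2 * z = 0" "z * F3 = 0" "F3 * z = 0"
    by (rule hom_orth[OF ho(3) ho(4) o(3)] hom_orth[OF ho(4) ho(3) o(2)] hom_orth[OF ho(5) ho(3) o(2)]
      hom_orth[OF ho(3) ho(5) o(1)] hom_orth[OF ho(6) ho(3) o(4)] hom_orth[OF ho(3) ho(6) o(3)])+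
  note oo = o o2 o[THEN mult_eq_ext] o2[THEN mult_eq_ext]
  have "reg u (u + z) (e + z) u (u * th + z) (Ge + z) 0 F2 F3 \<longleftrightarrow>
    reg 0 u e 0 th Ge 0 (0 + u * F2 * u) (e * F3 * e) \<and> skew_trivial z z (z * F3 * z + z * F2 * z)"
    by (rule reg_orthogonal[OF _ _ _ _ _ _ _ _ _ _ _ _ refl id'(1) _ id'(2) id form fz])
      (auto intro!: homI simp: idem_def algebra_simps hs oo)
  moreover have "skew_trivial z z (z * F3 * z + z * F2 * z)"
    using skew_trivial_iff_small[OF fz id _ t(1)] t(2) by (simp add: oo hom_zero)
  ultimately show ?thesis using R by (simp add: hs mult.assoc)
qed

section \<open>The three reductions as statements about dimensions\<close>

lemma idem_dg [simp]: "finite I \<Longrightarrow> idem (dg I)"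
  by (simp add: idem_def)

lemma dg_disjoint: "finite I \<Longrightarrow> finite J \<Longrightarrow> I \<inter> J = {} \<Longrightarrow> dg I * dg J = 0"
  by (simp add: dg_times_dg)

lemma idem_zero [simp]: "idem 0"
  by (simp add: idem_def)

lemma reg_phi_split:
  fixes u :: "'k::field_char_0 fin_mat"
  assumes R: "reg u m w \<phi> \<psi> G F1 F2 F3" and t: "tr u = of_nat a" "tr m = of_nat b"
  obtains la where "la \<in> hom m u" "\<phi> * (la * \<phi>) = \<phi>" "a \<le> b \<Longrightarrow> la * \<phi> = u" "b \<le> a \<Longrightarrow> \<phi> * la = m"
proof -
  have ho: "\<phi> \<in> hom u m" "idem u" "idem m" using R by (auto simp: reg_def)
  obtain la where la: "la \<in> hom m u" "\<phi> * (la * \<phi>) = \<phi>" using quasi_inverse[OF ho] by blast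
  show ?thesis
    by (rule that[OF la])
      (use hom_tr_dichotomy[OF ho(1) la ho(2,3) reg_phi_max_rank[OF R la] t] in auto)
qed

text \<open>The idempotent \<open>m - \<phi> * la\<close> stands for the cokernel of
  \<open>\<phi>\<close>; it is the map from \<open>w\<close> into this cokernel that has maximal
  rank.\<close>

lemma reg_psi_split:
  fixes u :: "'k::field_char_0 fin_mat"
  assumes R: "reg u m w \<phi> \<psi> G F1 F2 F3" and t: "tr u = of_nat a" "tr m = of_nat b" "tr w = of_nat c"
    and la: "la \<in> hom m u" "la * \<phi> = u" and ab: "a \<le> b"
  obtains mu where "mu \<in> hom (m - \<phi> * la) w" "(m - \<phi> * la) * \<psi> * (mu * ((m - \<phi> * la) * \<psi>)) = (m - \<phi> * la) * \<psi>"
    "a + c \<le> b \<Longrightarrow> mu * ((m - \<phi> * la) * \<psi>) = w" "b \<le> a + c \<Longrightarrow> (m - \<phi> * la) * \<psi> * mu = m - \<phi> * la"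
proof -
  let ?n = "m - \<phi> * la"
  have ho: "\<phi> \<in> hom u m" "\<psi> \<in> hom w m" "la \<in> hom m u" and id: "idem u" "idem m" "idem w"
    using R la by (auto simp: reg_def)
  note ho' = ho id[THEN idem_hom]
  note hs = ho'[THEN hom_simps(1)] ho'[THEN hom_simps(2)] ho'[THEN hom_simps(3)] ho'[THEN hom_simps(4)]
  have idn: "idem ?n" by (simp add: idem_def algebra_simps hs la(2) mult_eq_ext[OF la(2)])
  have p: "?n * \<psi> \<in> hom w ?n" by (rule homI) (simp_all add: algebra_simps hs mult_eq_ext[OF la(2)])
  obtain mu where mu: "mu \<in> hom ?n w" "?n * \<psi> * (mu * (?n * \<psi>)) = ?n * \<psi>"
    using quasi_inverse[OF p id(3) idn] by blast
  have "tr ?n = of_nat b - of_nat a"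
    using t tr_mult_commute[of \<phi> la] la(2) by simp
  then have tn: "tr ?n = of_nat (b - a)" using ab by (simp add: of_nat_diff)
  show ?thesis
    by (rule that[OF mu])
      (use hom_tr_dichotomy[OF p mu id(3) idn reg_psi_max_rank[OF R la mu] t(3) tn] ab in auto)
qed

lemma regular_on_split:
  fixes u :: "'k::field_char_0 fin_mat"
  assumes id: "idem u" "idem m" "idem w" and t: "tr u = of_nat a" "tr m = of_nat (a + c + b)" "tr w = of_nat c"
    and id': "idem m'" and t': "tr m' = of_nat b"
  shows "regular_on u m w \<longleftrightarrow> regular_on u m' w"
proof
  assume "regular_on u m w"
  then obtain \<phi> \<psi> G F1 F2 F3 where R: "reg u m w \<phi> \<psi> G F1 F2 F3" unfolding regular_on_def by blast
  obtain la where la: "la \<in> hom m u" "la * \<phi> = u"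
    using reg_phi_split[OF R t(1,2)] by (metis add.assoc le_add1)
  let ?n = "m - \<phi> * la"
  obtain mu where mu: "mu \<in> hom ?n w" "mu * (?n * \<psi>) = w"
    using reg_psi_split[OF R t la] by (metis add.assoc le_add1)
  obtain H where form: "form_on w G H" using R by (auto simp: reg_def)
  have ho: "\<phi> \<in> hom u m" "\<psi> \<in> hom w m" "la \<in> hom m u" "F1 \<in> hom u u" "F2 \<in> hom m m" "F3 \<in> hom w w"
    using R la by (auto simp: reg_def)
  note ho' = ho id[THEN idem_hom]
  note hs0 = ho'[THEN hom_simps(1)] ho'[THEN hom_simps(2)] ho'[THEN hom_simps(3)] ho'[THEN hom_simps(4)]
  have n: "?n * m = ?n" "?n * \<phi> = 0" by (simp_all add: algebra_simps hs0 la(2))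
  have mu': "mu * m = mu" "mu * \<phi> = 0"
    using mu(1) n by (metis hom_simps(2) mult.assoc, metis hom_simps(4) mult_zero_right n(2))
  have mu\<psi>: "mu * \<psi> = w" using mu hom_simps(4)[OF mu(1), of \<psi>] by simp
  have "mu \<in> hom m w" using mu' hom_simps(1)[OF mu(1)] by (rule_tac homI)
  note ho2 = ho' this
  note hs = ho2[THEN hom_simps(1)] ho2[THEN hom_simps(2)] ho2[THEN hom_simps(3)] ho2[THEN hom_simps(4)]
  \<comment> \<open>The correction makes \<open>la'\<close> vanish on the image of
    \<open>\<psi>\<close>, so that \<open>la'\<close>, \<open>mu\<close> and \<open>m2\<close>
    belong to one direct sum decomposition of \<open>m\<close>.\<close>
  define la' where "la' = la - la * \<psi> * mu"
  define m2 where "m2 = m - \<phi> * la' - \<psi> * mu"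
  note ii = la(2) mu'(2) mu\<psi>
  note iis = ii ii[THEN mult_eq_ext]
  have la': "la' \<in> hom m u" "la' * \<phi> = u" "la' * \<psi> = 0"
    by (auto intro!: homI simp: la'_def algebra_simps hs iis)
  note hl = hom_simps[OF la'(1)] la'(2,3) la'(2,3)[THEN mult_eq_ext]
  have m2h: "m2 \<in> hom m m" "idem m2"
    unfolding idem_def by (auto intro!: homI simp: m2_def algebra_simps hs hl iis)
  have tm2: "tr m2 = tr m'"
    using t t' tr_mult_commute[of \<phi> la'] tr_mult_commute[of \<psi> mu] la'(2) mu\<psi> by (simp add: m2_def)
  have "reg u m2 w (m2 * F2 * \<phi>) (m2 * F2 * \<psi>) G (F1 + la' * F2 * \<phi>) (m2 * F2 * m2) (F3 + mu * F2 * \<psi>)"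
    using R
    by (subst reg_split[OF ho(1) la'(1) ho(2) \<open>mu \<in> hom m w\<close>, symmetric])
      (use id m2h form ho in \<open>auto intro!: homI simp: m2_def algebra_simps hs hl iis\<close>)
  then have "regular_on u m2 w" unfolding regular_on_def by blast
  then show "regular_on u m' w"
    using regular_on_cong[OF id(1) m2h(2) id(3) id(1) id' id(3)] tm2 by simp
next
  assume "regular_on u m' w"
  \<comment> \<open>Only ranks matter, so consecutive coordinate blocks may be used; they provide
    the orthogonality that \<open>reg_inclusions\<close> needs.\<close>
  define u1 w1 m1 :: "'k fin_mat" where "u1 = dg {..<a}" and "w1 = dg {a..<a+c}" and "m1 = dg {a+c..<a+c+b}"
  note d = u1_def w1_def m1_def
  have id1: "idem u1" "idem m1" "idem w1" and t1: "tr u1 = of_nat a" "tr m1 = of_nat b" "tr w1 = of_nat c"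
    by (simp_all add: d tr_dg)
  have "regular_on u1 m1 w1"
    using \<open>regular_on u m' w\<close> regular_on_cong[OF id(1) id' id(3) id1] t t' t1 by simp
  then obtain \<phi> \<psi> G F1 F2 F3 where R: "reg u1 m1 w1 \<phi> \<psi> G F1 F2 F3" unfolding regular_on_def by blast
  have "regular_on u1 (u1 + w1 + m1) w1"
    unfolding regular_on_def by (intro exI, rule reg_inclusions[OF R]) (auto simp: d intro!: dg_disjoint)
  moreover have "u1 * m1 = 0" "m1 * u1 = 0" "w1 * m1 = 0" "m1 * w1 = 0" "u1 * w1 = 0" "w1 * u1 = 0"
    by (auto simp: d intro!: dg_disjoint)
  then have "idem (u1 + w1 + m1)" using id1
    by (simp add: idem_def algebra_simps)
  ultimately show "regular_on u m w"
    using regular_on_cong[OF id(1) id(2) id(3) id1(1) _ id1(3)] t t1 by simp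
qed

lemma regular_on_quotient:
  fixes u :: "'k::field_char_0 fin_mat"
  assumes id: "idem u" "idem m" "idem w" "idem k" and t: "tr u = of_nat (a + b)" "tr m = of_nat b" "tr k = of_nat a"
  shows "regular_on u m w \<longleftrightarrow> regular_on k m w"
proof
  assume "regular_on u m w"
  then obtain \<phi> \<psi> G F1 F2 F3 where R: "reg u m w \<phi> \<psi> G F1 F2 F3" unfolding regular_on_def by blast
  obtain sg where sg: "sg \<in> hom m u" "\<phi> * sg = m"
    using reg_phi_split[OF R t(1,2)] by (metis le_add2)
  obtain H where form: "form_on w G H" using R by (auto simp: reg_def)
  have ho: "\<phi> \<in> hom u m" "\<psi> \<in> hom w m" "sg \<in> hom m u" "F1 \<in> hom u u" "F2 \<in> hom m m" "F3 \<in> hom w w"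
    using R sg by (auto simp: reg_def)
  note ho' = ho id[THEN idem_hom]
  note hs = ho'[THEN hom_simps(1)] ho'[THEN hom_simps(2)] ho'[THEN hom_simps(3)] ho'[THEN hom_simps(4)]
  define k' where "k' = u - sg * \<phi>"
  have idk: "idem k'" by (simp add: idem_def k'_def algebra_simps hs mult_eq_ext[OF sg(2)])
  have tk: "tr k' = tr k" using t tr_mult_commute[of \<phi> sg] sg(2) by (simp add: k'_def)
  have "reg k' m w (\<phi> * F1 * k') \<psi> G (k' * F1 * k') (F2 + \<phi> * F1 * sg) F3"
    using R
    by (subst reg_quotient[OF ho(1) sg(1) ho(2), symmetric])
      (use id idk form ho in \<open>auto intro!: homI simp: k'_def algebra_simps hs sg(2) mult_eq_ext[OF sg(2)]\<close>)
  then have "regular_on k' m w" unfolding regular_on_def by blast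
  then show "regular_on k m w"
    using regular_on_cong[OF idk id(2,3) id(4) id(2,3)] tk by simp
next
  assume "regular_on k m w"
  define m1 k1 :: "'k fin_mat" where "m1 = dg {..<b}" and "k1 = dg {b..<a+b}"
  have id1: "idem k1" "idem m1" and t1: "tr k1 = of_nat a" "tr m1 = of_nat b"
    by (simp_all add: k1_def m1_def tr_dg)
  have o: "k1 * m1 = 0" "m1 * k1 = 0" by (auto simp: k1_def m1_def intro!: dg_disjoint)
  have "regular_on k1 m1 w"
    using \<open>regular_on k m w\<close> regular_on_cong[OF id(4) id(2) id(3) id1 id(3)] t t1 by simp
  then obtain \<phi> \<psi> G F1 F2 F3 where R: "reg k1 m1 w \<phi> \<psi> G F1 F2 F3" unfolding regular_on_def by blast
  obtain H where form: "form_on w G H" using R by (auto simp: reg_def)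
  have ho: "\<phi> \<in> hom k1 m1" "\<psi> \<in> hom w m1" "F1 \<in> hom k1 k1" "F2 \<in> hom m1 m1" "F3 \<in> hom w w"
    using R by (auto simp: reg_def)
  note ho' = ho id1[THEN idem_hom] id(3)[THEN idem_hom]
  note hs = ho'[THEN hom_simps(1)] ho'[THEN hom_simps(2)] ho'[THEN hom_simps(3)] ho'[THEN hom_simps(4)]
  have o2: "\<phi> * m1 = 0" "m1 * F1 = 0" "k1 * \<phi> = 0" "F1 * m1 = 0"
    by (rule hom_orth[OF ho'(7) ho'(1) o(1)] hom_orth[OF ho'(3) ho'(7) o(2)] hom_orth[OF ho'(1) ho'(6) o(1)]
        hom_orth[OF ho'(7) ho'(3) o(1)])+
  note oo = o o2 o[THEN mult_eq_ext] o2[THEN mult_eq_ext]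
  have idu: "idem (k1 + m1)" by (simp add: idem_def algebra_simps hs oo)
  \<comment> \<open>The surjection is the coordinate projection \<open>m1\<close>. The old
    \<open>\<phi>\<close>, a block from \<open>k1\<close> to \<open>m1\<close>, is stored inside the
    endomorphism \<open>F1 + \<phi>\<close> of the larger space.\<close>
  have "reg (k1 + m1) m1 w m1 \<psi> G (F1 + \<phi>) F2 F3 \<longleftrightarrow>
    reg k1 m1 w (m1 * (F1 + \<phi>) * k1) \<psi> G (k1 * (F1 + \<phi>) * k1) (F2 + m1 * (F1 + \<phi>) * m1) F3"
    by (rule reg_quotient[OF _ _ ho(2) _ _ _ _ _ _ _ idu id1(2) id(3) id1(1) form])
      (auto intro!: homI simp: algebra_simps hs oo ho)
  then have "reg (k1 + m1) m1 w m1 \<psi> G (F1 + \<phi>) F2 F3"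
    using R by (simp add: algebra_simps hs oo)
  then have "regular_on (k1 + m1) m1 w" unfolding regular_on_def by blast
  then show "regular_on u m w"
    using regular_on_cong[OF id(1,2,3) idu id1(2) id(3)] t t1 by simp
qed

text \<open>The point is that the form stays nondegenerate on the preimage of the image of
  \<open>\<phi>\<close> under \<open>\<psi>\<close>: a nonzero radical vector there would give a
  nonzero solution with vanishing \<open>A\<close> components. Only then does the orthogonal
  decomposition needed for \<open>reg_orthogonal\<close> exist. The rank of the complement is
  \<open>b - a\<close>, and the vanishing of its orthogonal Lie algebra gives the bound.\<close>

lemma reg_orthogonal_decompose:
  fixes u :: "'k::field_char_0 fin_mat"
  assumes R: "reg u m w \<phi> \<psi> G F1 F2 F3" and t: "tr u = of_nat a" "tr m = of_nat b" "tr w = of_nat c"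
    and le: "a \<le> b" "b \<le> a + c"
  obtains e th Ge F2' F3' where "reg 0 u e 0 th Ge 0 F2' F3'" "tr e = of_nat (a + c - b)" "b - a \<le> 1"
proof -
  have id: "idem u" "idem m" "idem w" using R by (auto simp: reg_def)
  obtain la where la: "la \<in> hom m u" "la * \<phi> = u"
    using reg_phi_split[OF R t(1,2)] le by metis
  define n where "n = m - \<phi> * la"
  define \<psi>1 where "\<psi>1 = n * \<psi>"
  obtain mu where mu: "mu \<in> hom n w" "\<psi>1 * (mu * \<psi>1) = \<psi>1" "\<psi>1 * mu = n"
    using reg_psi_split[OF R t la le(1)] le(2) unfolding n_def \<psi>1_def by metis
  obtain H where form: "form_on w G H" using R by (auto simp: reg_def)
  have G: "G \<in> hom w (tp w)" "tp G = G" and H: "H \<in> hom (tp w) w" "tp H = H" and GH: "H * G = w" "G * H = tp w"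
    using form form_on_tp[OF form] by (auto simp: form_on_def)
  have ho: "\<phi> \<in> hom u m" "\<psi> \<in> hom w m" "la \<in> hom m u" "F1 \<in> hom u u" "F2 \<in> hom m m" "F3 \<in> hom w w"
    using R la by (auto simp: reg_def)
  note ho' = ho id[THEN idem_hom] G(1) H(1) id(3)[THEN idem_hom, THEN hom_tp]
  note hs0 = ho'[THEN hom_simps(1)] ho'[THEN hom_simps(2)] ho'[THEN hom_simps(3)] ho'[THEN hom_simps(4)]
  have n: "n * m = n" "n * \<phi> = 0" "m * n = n" by (simp_all add: n_def algebra_simps hs0 la(2))
  have mu': "mu * m = mu" "mu * \<phi> = 0" "mu * n = mu"
    using n hom_simps(2)[OF mu(1)] hom_simps(4)[OF mu(1)] by (metis mult.assoc mult_zero_right)+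
  have mu\<psi>: "mu * \<psi> = mu * \<psi>1" using hom_simps(4)[OF mu(1), of \<psi>] by (simp add: \<psi>1_def)
  have hmu: "mu \<in> hom m w" using mu' hom_simps(1)[OF mu(1)] by (rule_tac homI)
  have hp1: "\<psi>1 \<in> hom w m" unfolding \<psi>1_def by (rule homI) (simp_all add: mult.assoc hs0 n mult_eq_ext[OF n(3)])
  note ho2 = ho' hmu hp1
  note hs = ho2[THEN hom_simps(1)] ho2[THEN hom_simps(2)] ho2[THEN hom_simps(3)] ho2[THEN hom_simps(4)]
  have p1: "\<psi>1 * (mu * \<psi>1) = \<psi>1" "n * \<psi> = \<psi>1" "n * \<psi>1 = \<psi>1"
    using mu by (simp_all add: \<psi>1_def n_def algebra_simps hs0 la(2)[THEN mult_eq_ext])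
  note ii = la(2) mu'(2,3) mu\<psi> n p1 mu(3) GH
  have p1s: "\<psi>1 * (mu * (\<psi>1 * s)) = \<psi>1 * s" for s using mu(2) by (metis mult.assoc)
  note iis = ii ii[THEN mult_eq_ext] p1s
  \<comment> \<open>\<open>d\<close> projects onto the kernel of \<open>\<psi>1\<close>, but along a
    complement that depends on \<open>mu\<close>; the orthogonal projection \<open>e\<close> with
    the same image replaces it below.\<close>
  define d where "d = w - mu * \<psi>1"
  have hd: "d \<in> hom d d" "d \<in> hom w w" and idd: "idem d" and d0: "\<psi>1 * d = 0"
    unfolding idem_def by (auto intro!: homI simp: d_def algebra_simps hs iis)
  have htd: "tp d \<in> hom (tp d) (tp d)" "tp d \<in> hom (tp w) (tp w)" using hd[THEN hom_tp] by auto
  define GD where "GD = tp d * G * d"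
  have GD: "GD \<in> hom d (tp d)" "tp GD = GD"
    unfolding GD_def by (auto intro!: homI simp: mult.assoc G hom_simps[OF hd(1)] hom_simps[OF htd(1)])
  obtain K where K: "K \<in> hom (tp d) d" "GD * (K * GD) = GD"
    using quasi_inverse[OF GD(1) idd] idd by (metis idem_def tp_mult)
  have dec: "\<psi> = \<phi> * (la * \<psi>) + \<psi>1" by (simp add: \<psi>1_def n_def algebra_simps hs)
  have KG: "K * GD = d"
  proof (rule ccontr)
    assume "K * GD \<noteq> d"
    define k where "k = d - K * GD"
    have hk: "k \<in> hom d d" unfolding k_def
      by (auto intro!: homI simp: algebra_simps hom_simps[OF hd(1)] hom_simps[OF K(1)] hom_simps[OF GD(1)])
    then have "k * w = k" "w * k = k" using hd by (metis hom_simps mult.assoc)+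
    then have hkw: "k \<in> hom w w" by (rule_tac homI)
    have "k \<noteq> 0" using \<open>K * GD \<noteq> d\<close> by (simp add: k_def)
    then obtain i j where ij: "entry k i j \<noteq> 0" using fin_mat_nonzero by blast
    have dk: "d * k = k" using hk hom_simps by metis
    have GDk: "GD * k = 0" by (simp add: k_def algebra_simps K hom_simps[OF GD(1)])
    then have dGk: "tp d * (G * k) = 0" by (simp add: GD_def mult.assoc dk)
    have kGd: "tp k * (G * d) = 0"
      using arg_cong[OF dGk, of tp] by (simp add: G mult.assoc)
    have "w = d + mu * \<psi>1" by (simp add: d_def)
    then have "tp k * (G * w) = tp k * (G * d) + tp k * (G * (mu * \<psi>1))" by (metis distrib_left)
    then have kG: "tp k * G = tp k * (G * (mu * \<psi>1))" using kGd by (simp add: hs)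
    \<comment> \<open>Then \<open>q * \<psi>\<close> is \<open>k * single j j 1 * tp k * G\<close>,
      a rank-one map made of a radical vector and self-adjoint for \<open>G\<close>; passing through
      \<open>mu\<close> loses nothing because of \<open>kG\<close>.\<close>
    define q where "q = k * single j j 1 * tp k * G * mu"
    define p where "p = - (la * \<psi> * q)"
    have tk: "tp k \<in> hom (tp w) (tp w)" using hom_tp[OF hkw] .
    have hq: "q \<in> hom m w" unfolding q_def
      by (auto intro!: homI simp: mult.assoc hs hom_simps[OF hkw])
    have q\<phi>: "q * \<phi> = 0" by (simp add: q_def mult.assoc iis)
    have q\<psi>: "q * \<psi> = k * single j j 1 * tp k * G"
      by (simp add: q_def mult.assoc iis kG)
    have "\<psi>1 * k = 0" using d0 dk by (metis mult.assoc mult_zero_left)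
    then have "\<psi>1 * q = 0" by (simp add: q_def mult.assoc mult_eq_ext[of \<psi>1 k 0])
    then have "\<phi> * p + \<psi> * q = 0"
      using arg_cong[OF dec, of "\<lambda>x. x * q"] by (simp add: p_def algebra_simps)
    moreover have "p \<in> hom m u" unfolding p_def
      by (auto intro!: homI simp: mult.assoc hs hom_simps[OF hq])
    ultimately have "q = 0"
      using hq q\<phi> q\<psi> by (intro sol_null(2)[OF R, of p q]) (simp_all add: p_def mult.assoc G)
    then have "k * single j j 1 * tp k * G * H = 0" using q\<psi> by simp
    then have "k * (single j j 1 * tp k) = 0" by (simp add: mult.assoc iis hom_simps[OF tk])
    then have "entry (k * (single j j 1 * tp k)) i i = 0" by simp
    moreover have "entry (k * (single j j 1 * tp k)) i i = entry k i j * entry k i j"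
      by (subst entry_times[of "{j}"]) (auto simp: entry_single_times split: if_splits)
    ultimately show False using ij by simp
  qed
  have tK: "tp K = K"
  proof -
    have h: "tp K \<in> hom (tp d) d" using hom_tp[OF K(1)] by simp
    have tt: "GD * tp K = tp d" using arg_cong[OF KG, of tp] by (simp add: GD)
    have "K * (GD * tp K) = d * tp K" by (simp add: KG mult_eq_ext)
    then show ?thesis using tt hom_simps[OF h] hom_simps[OF K(1)] by simp
  qed
  \<comment> \<open>\<open>K\<close> inverts the form restricted to \<open>d\<close>, so
    \<open>K * G\<close> is the orthogonal projection onto the image of \<open>d\<close>.\<close>
  define e where "e = K * G"
  define z where "z = w - e"
  have Kw: "K * tp w = K" "w * K = K" "K * tp d = K" "d * K = K" "d * w = d" "w * d = d"
    using hom_simps[OF K(1)] hom_simps[OF hd(2)] hom_simps[OF htd(2)] by (metis mult.assoc)+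
  have KGd: "K * (G * d) = d" using KG Kw by (metis GD_def mult.assoc)
  have KGK: "K * (G * K) = K" using KGd Kw by (metis mult.assoc)
  have KGKs: "K * (G * (K * s)) = K * s" for s using KGK by (metis mult.assoc)
  have de: "d * e = e" "e * d = d" by (simp_all add: e_def KGd mult.assoc Kw mult_eq_ext[OF Kw(4)])
  have he: "e \<in> hom w w" "idem e"
    by (auto intro!: homI simp: e_def idem_def mult.assoc hs KGK mult_eq_ext[OF Kw(2)] KGKs)
  have Ge: "tp e = G * K" "G * e = tp e * G" by (simp_all add: e_def tK G mult.assoc)
  have idz: "idem z" and hz: "z \<in> hom w w" and ez: "e * z = 0" "z * e = 0"
    using he unfolding z_def idem_def by (auto intro!: homI simp: algebra_simps hs hom_simps[OF he(1)])
  have ee: "e * e = e" using he(2) by (simp add: idem_def)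
  have p1e: "\<psi>1 * e = 0" using d0 de by (metis mult.assoc mult_zero_left)
  have zd: "z * d = 0" by (simp add: z_def algebra_simps Kw de)
  have Gz: "G * z = tp z * G" by (simp add: z_def algebra_simps hs Ge)
  have te: "tp e * tp e = tp e" "tp z * tp z = tp z" "tp e * tp z = 0" "tp z * tp e = 0"
    using ee idz ez by (simp_all add: idem_def flip: tp_mult)
  have zz: "z * z = z" using idz by (simp add: idem_def)
  have zmu: "z * (mu * \<psi>1) = z"
  proof -
    have "z * w = z * d + z * (mu * \<psi>1)" by (simp add: d_def algebra_simps)
    then show ?thesis using zd hom_simps[OF hz] by simp
  qed
  have zmus: "z * (mu * (\<psi>1 * s)) = z * s" for s using zmu by (metis mult.assoc)
  define nu where "nu = z * mu"
  define ze where "ze = \<psi> * z"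
  define th where "th = la * \<psi> * e"
  \<comment> \<open>Corrected so as to vanish on the image of \<open>ze\<close>, since
    \<open>reg_orthogonal\<close> asks for projections belonging to one decomposition of
    \<open>m\<close>.\<close>
  define la' where "la' = la - la * ze * nu"
  note ii2 = ee zz ez p1e zmu KGK
  note iis2 = ii2 ii2[THEN mult_eq_ext] iis KGKs zmus
  note hz' = hom_simps[OF hz] hom_simps[OF he(1)]
  have nuze: "nu * ze = z" by (simp add: nu_def ze_def mult.assoc iis2)
  have hh: "nu \<in> hom m z" "ze \<in> hom z m" "th \<in> hom e u" "la' \<in> hom m u"
    by (auto intro!: homI simp: nu_def ze_def th_def la'_def algebra_simps hs hz' iis2)
  have nuphi: "nu * \<phi> = 0" by (simp add: nu_def mult.assoc iis2)
  have la'phi: "la' * \<phi> = u" by (simp add: la'_def algebra_simps iis2 nuphi)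
  have la'ze: "la' * ze = 0" by (simp add: la'_def algebra_simps nuze hom_simps[OF hh(2)])
  have "\<psi>1 * (z * mu) = n"
    using p1e by (simp add: z_def algebra_simps hs iis mult_eq_ext[OF p1e])
  moreover have "\<phi> * (la * (\<psi> * (z * mu))) + \<psi>1 * (z * mu) = \<psi> * (z * mu)"
    using arg_cong[OF dec, of "\<lambda>x. x * (z * mu)"] by (simp add: algebra_simps)
  ultimately have m: "\<phi> * la' + ze * nu = m"
    by (simp add: la'_def ze_def nu_def algebra_simps zz mult_eq_ext[OF zz]) (simp add: n_def algebra_simps)
  have we: "w = e + z" by (simp add: z_def)
  have "\<psi> * e = \<phi> * (la * (\<psi> * e))"
    using arg_cong[OF dec, of "\<lambda>x. x * e"] p1e by (simp add: algebra_simps)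
  then have psi: "\<phi> * th + ze = \<psi>"
    using hom_simps(2)[OF ho(2)] we by (simp add: th_def ze_def mult.assoc flip: distrib_left)
  define Ge' where "Ge' = tp e * G * e"
  define Gz' where "Gz' = tp z * G * z"
  have form_e: "form_on e Ge' K"
    unfolding form_on_def Ge'_def
    by (auto intro!: homI simp: mult.assoc G Ge te te[THEN mult_eq_ext] ee) 
      (auto simp: e_def tK mult.assoc KGK Kw KGKs)
  have g1: "z * (H * (tp z * G)) = z"
    by (simp add: Gz[symmetric] iis hz' zz)
  have g2: "tp z * (G * (z * (H * tp z))) = tp z"
    by (simp add: mult_eq_ext[OF Gz] mult.assoc te te[THEN mult_eq_ext] iis hom_simps[OF hom_tp[OF hz]])
  have form_z: "form_on z Gz' (z * H * tp z)"
    unfolding form_on_def Gz'_def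
    by (auto intro!: homI simp: mult.assoc G Gz te te[THEN mult_eq_ext] zz mult_eq_ext[OF zz] g1 g2)
  have GG: "Ge' + Gz' = G"
    using hom_simps(2)[OF G(1)] by (simp add: Ge'_def Gz'_def mult.assoc Ge(2) Gz te[THEN mult_eq_ext] mult_eq_ext[OF Ge(2), symmetric] mult_eq_ext[OF Gz, symmetric] ee zz) (simp add: we distrib_left Ge(2) Gz)
  have iff: "reg u m w \<phi> (\<phi> * th + ze) (Ge' + Gz') F1 F2 F3 \<longleftrightarrow>
    reg 0 u e 0 th Ge' 0 (F1 + la' * F2 * \<phi>) (e * F3 * e) \<and>
    skew_trivial z Gz' (z * F3 * z + nu * F2 * ze)"
    by (rule reg_orthogonal[OF ho(1) hh(4) hh(2) hh(1) hh(3) la'phi nuze la'ze nuphi ez m we id(1,2) he(2) idz form_e form_z ho(4-6)])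
  have ze_tr: "tr z = of_nat (b - a)"
    using t tr_mult_commute[of \<phi> la'] tr_mult_commute[of ze nu] arg_cong[OF m, of tr] nuze la'phi le
    by (simp add: of_nat_diff algebra_simps)
  have "tr e = tr w - tr z" by (simp add: z_def)
  then have te_tr: "tr e = of_nat (a + c - b)" using t ze_tr le by (simp add: of_nat_diff algebra_simps)
  have sk: "skew_trivial z Gz' (z * F3 * z + nu * F2 * ze)" and rg: "reg 0 u e 0 th Ge' 0 (F1 + la' * F2 * \<phi>) (e * F3 * e)"
    using iff R unfolding psi GG by auto
  have "z * F3 * z + nu * F2 * ze \<in> hom z z"
    by (auto intro!: homI simp: algebra_simps mult_eq_ext[OF zz] zz hom_simps[OF hh(1)] hom_simps[OF hh(2)])
  then have "b - a \<le> 1"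
    using sk skew_trivial_iff_small[OF form_z idz _ ze_tr] by blast
  then show ?thesis using that rg te_tr by blast
qed

lemma regular_on_orthogonal:
  fixes u :: "'k::field_char_0 fin_mat"
  assumes id: "idem u" "idem m" "idem w" "idem e" and t: "tr u = of_nat a" "tr m = of_nat b" "tr w = of_nat c"
    and le: "a \<le> b" "b \<le> a + c" and te: "tr e = of_nat (a + c - b)"
  shows "regular_on u m w \<longleftrightarrow> b - a \<le> 1 \<and> regular_on 0 u e"
proof
  assume "regular_on u m w"
  then obtain \<phi> \<psi> G F1 F2 F3 where R: "reg u m w \<phi> \<psi> G F1 F2 F3" unfolding regular_on_def by blast
  from reg_orthogonal_decompose[OF R t le] obtain e' th Ge F2' F3' where
    R': "reg 0 u e' 0 th Ge 0 F2' F3'" "tr e' = of_nat (a + c - b)" "b - a \<le> 1" .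
  then have "regular_on 0 u e'" "idem e'" unfolding regular_on_def reg_def by blast+
  then show "b - a \<le> 1 \<and> regular_on 0 u e"
    using regular_on_cong[of 0 u e' 0 u e] id R' te by simp
next
  assume r: "b - a \<le> 1 \<and> regular_on 0 u e"
  define k where "k = a + c - b"
  \<comment> \<open>\<open>u1\<close> and \<open>e1\<close> may overlap; only \<open>z1\<close> has
    to be orthogonal to both.\<close>
  define u1 e1 z1 :: "'k fin_mat" where "u1 = dg {..<a}" and "e1 = dg {..<k}" and "z1 = dg {a+k..<a+k+(b-a)}"
  have id1: "idem u1" "idem e1" "idem z1" "tp z1 = z1"
    and t1: "tr u1 = of_nat a" "tr e1 = of_nat k" "tr z1 = of_nat (b - a)"
    by (simp_all add: u1_def e1_def z1_def tr_dg)
  have o: "u1 * z1 = 0" "z1 * u1 = 0" "e1 * z1 = 0" "z1 * e1 = 0"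
    by (auto simp: u1_def e1_def z1_def intro!: dg_disjoint)
  have "regular_on 0 u1 e1"
    using r regular_on_cong[of 0 u e 0 u1 e1] id id1 t t1 te by (simp add: k_def)
  then obtain \<phi> \<psi> G F1 F2 F3 where R: "reg 0 u1 e1 \<phi> \<psi> G F1 F2 F3" unfolding regular_on_def by blast
  then have "\<phi> = 0" "F1 = 0" by (auto simp: reg_def hom_def)
  then have "regular_on u1 (u1 + z1) (e1 + z1)"
    unfolding regular_on_def
    using reg_orthogonal_inclusions[OF _ id1(3) t1(3) _ id1(4) o] R r by blast
  moreover have "idem (u1 + z1)" "idem (e1 + z1)" using id1 o by (simp_all add: idem_def algebra_simps)
  ultimately show "regular_on u m w"
    using regular_on_cong[of u m w u1 "u1 + z1" "e1 + z1"] id id1 t t1 le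
    by (simp add: k_def of_nat_diff)
qed

section \<open>The arithmetic of the reduction\<close>

text \<open>The first disjunct has no counterpart in the theorem, where \<open>m = n > 0\<close>.\<close>

definition num_cond :: "nat \<Rightarrow> nat \<Rightarrow> nat \<Rightarrow> bool" where
  "num_cond a m t \<longleftrightarrow> (t = 0 \<and> a = 0 \<and> m = 0) \<or> (t = 1 \<and> gcd m (a + 1) = 1) \<or>
     (t = 2 \<and> gcd m (a + 2) = 1) \<or> (t = 3 \<and> gcd m (a + 3) = 2)"

lemma num_cond_split:
  assumes "0 < t"
  shows "num_cond a (a + t + b) t \<longleftrightarrow> num_cond a b t"
proof -
  have "gcd (a + t + b) (a + t) = gcd b (a + t)" by (metis add.commute gcd_add1)
  then show ?thesis using assms unfolding num_cond_def by auto
qed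

lemma num_cond_quotient:
  assumes "0 < t"
  shows "num_cond (a + m) m t \<longleftrightarrow> num_cond a m t"
proof -
  have "gcd m (a + m + t) = gcd m (a + t)"
    by (metis add.assoc add.commute gcd_add2)
  then show ?thesis using assms unfolding num_cond_def by auto
qed

text \<open>The gcd 2 and the bound 3 originate here. For \<open>m > a + 1\<close> the right side
  fails, and the left would need \<open>t = 3\<close> and \<open>m = a + 2\<close>, where the gcd is
  1. For \<open>m = a + 1\<close>, both sides hold at \<open>t = 2\<close>; at \<open>t = 3\<close>
  they say that \<open>a + 1\<close> is even and that \<open>a\<close> is odd; at
  \<open>t = 4\<close> both fail because \<open>gcd a 3\<close> is never 2.\<close>

lemma num_cond_orthogonal:
  assumes "0 < t" "a < m" "m < a + t"
  shows "num_cond a m t \<longleftrightarrow> m - a \<le> 1 \<and> num_cond 0 a (a + t - m)"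
proof (cases "m = Suc a")
  case True
  have g: "gcd (Suc a) (a + s) = gcd (Suc a) (s - 1)" if "s > 0" for s
    using that gcd_add2[of "Suc a" "s - 1"] by (simp add: add.commute)
  have "coprime (Suc a) (a + 2)"
    using coprime_Suc_right_nat[of "Suc a"] by simp
  then have g2: "gcd (Suc a) (a + 2) = 1" by simp
  have e2: "gcd (Suc a) 2 = 2 \<longleftrightarrow> gcd a 2 = 1"
  proof -
    have "gcd (Suc a) 2 = 2 \<longleftrightarrow> even (Suc a)"
      by (metis gcd_dvd1 gcd_proj2_if_dvd_nat)
    moreover have "gcd a 2 = 1 \<longleftrightarrow> odd a"
      by (metis coprime_iff_gcd_eq_1 coprime_right_2_iff_odd)
    ultimately show ?thesis by simp
  qed
  have g3: "gcd a 3 \<noteq> 2"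
  proof
    assume "gcd a 3 = 2"
    then have "2 dvd (3::nat)" by (metis gcd_dvd2)
    then show False by simp
  qed
  have "t = 1 \<or> t = 2 \<or> t = 3 \<or> t = 4 \<or> t > 4" using assms by linarith
  then show ?thesis
    using assms True g[of 3] g2 e2 g3 unfolding num_cond_def by (auto simp flip: numeral_2_eq_2)
next
  case False
  then have "m = a + 2 \<or> m = a + 3 \<or> m > a + 3" using assms by linarith
  moreover have "coprime (a + 2) (a + 3)"
    using coprime_Suc_right_nat[of "a + 2"] by (simp add: numeral_3_eq_3)
  ultimately show ?thesis
    using assms False unfolding num_cond_def by (auto simp: coprime_iff_gcd_eq_1)
qed

lemma num_cond_0: "num_cond a 0 t \<longleftrightarrow> a = 0 \<and> t \<le> 1"
  unfolding num_cond_def by auto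

section \<open>Base cases and the Euclidean induction\<close>

lemma regular_on_no_form:
  fixes u :: "'k::field_char_0 fin_mat"
  shows "regular_on u m 0 \<longleftrightarrow> u = 0 \<and> m = 0"
proof
  assume "regular_on u m 0"
  then obtain \<phi> \<psi> G F1 F2 F3 where R: "reg u m 0 \<phi> \<psi> G F1 F2 F3" unfolding regular_on_def by blast
  then have ho: "u \<in> hom u u" "m \<in> hom m m" "\<phi> \<in> hom u m" "F1 \<in> hom u u" "F2 \<in> hom m m" and "\<psi> = 0"
    by (auto simp: reg_def idem_def hom_def)
  \<comment> \<open>The pair of identities commutes with all the data, and for \<open>w = 0\<close>
    no skewness condition excludes it.\<close>
  have "sol u m 0 \<phi> \<psi> G F1 F2 F3 u m 0 0 0"
    using ho \<open>\<psi> = 0\<close> unfolding sol_def by (simp add: hom_zero hom_simps[OF ho(3)] hom_simps[OF ho(4)] hom_simps[OF ho(5)])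
  then show "u = 0 \<and> m = 0" using R unfolding reg_def by blast
next
  assume "u = 0 \<and> m = 0"
  moreover have "reg 0 0 0 0 0 0 0 0 (0 :: 'k fin_mat)"
    by (auto simp: reg_def sol_def hom_def form_on_def)
  ultimately show "regular_on u m 0" unfolding regular_on_def by blast
qed

text \<open>With \<open>m = 0\<close> the maps \<open>\<phi>\<close>, \<open>\<psi>\<close>,
  \<open>p\<close>, \<open>q\<close> disappear. The identity of \<open>u\<close> commutes with
  \<open>F1\<close> and must vanish, and what remains is the orthogonal Lie algebra of
  \<open>w\<close> alone.\<close>

lemma regular_on_no_middle:
  fixes u :: "'k::field_char_0 fin_mat"
  assumes "idem w" "tr w = of_nat t"
  shows "regular_on u 0 w \<Longrightarrow> u = 0" "regular_on 0 0 w \<longleftrightarrow> t \<le> 1"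
proof -
  assume "regular_on u 0 w"
  then obtain \<phi> \<psi> G F1 F2 F3 where R: "reg u 0 w \<phi> \<psi> G F1 F2 F3" unfolding regular_on_def by blast
  then have ho: "u \<in> hom u u" "F1 \<in> hom u u" and "\<phi> = 0" "\<psi> = 0" "F2 = 0"
    by (auto simp: reg_def idem_def hom_def)
  then have "sol u 0 w \<phi> \<psi> G F1 F2 F3 u 0 0 0 0"
    unfolding sol_def by (simp add: hom_zero hom_simps[OF ho(2)])
  then show "u = 0" using R unfolding reg_def by blast
next
  show "regular_on 0 0 w \<longleftrightarrow> t \<le> 1"
  proof
    assume "regular_on 0 0 w"
    then obtain \<phi> \<psi> G F1 F2 F3 where R: "reg 0 0 w \<phi> \<psi> G F1 F2 F3" unfolding regular_on_def by blast
    then have z: "\<phi> = 0" "\<psi> = 0" "F1 = 0" "F2 = 0" and F3: "F3 \<in> hom w w" by (auto simp: reg_def hom_def)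
    obtain H where form: "form_on w G H" using R by (auto simp: reg_def)
    have "skew_trivial w G F3"
      unfolding skew_trivial_def
    proof (intro ballI impI)
      fix A assume "A \<in> hom w w" "tp (G * A) = - (G * A) \<and> tp (G * (F3 * A - A * F3)) = G * (F3 * A - A * F3)"
      then have "sol 0 0 w \<phi> \<psi> G F1 F2 F3 0 0 A 0 0" by (simp add: sol_def z hom_zero)
      then show "A = 0" using R unfolding reg_def by blast
    qed
    then show "t \<le> 1" using skew_trivial_iff_small[OF form assms(1) F3 assms(2)] by simp
  next
    assume t: "t \<le> 1"
    define w1 :: "'k fin_mat" where "w1 = dg {..<t}"
    have id: "idem w1" "tr w1 = of_nat t" "tp w1 = w1" by (simp_all add: w1_def tr_dg)
    have form: "form_on w1 w1 w1" using id by (simp add: form_on_def hom_def idem_def)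
    have sk: "skew_trivial w1 w1 0" using skew_trivial_iff_small[OF form id(1) _ id(2)] t by (simp add: hom_zero)
    have "reg 0 0 w1 0 0 w1 0 0 0"
      unfolding reg_def
    proof (intro conjI allI impI)
      fix A1 A2 A3 p q
      assume S: "sol 0 0 w1 0 0 w1 0 0 0 A1 A2 A3 p q"
      then show "A1 = 0" "A2 = 0" "p = 0" "q = 0" by (auto simp: sol_def hom_def)
      show "A3 = 0" using S sk unfolding skew_trivial_def sol_def by auto
    qed (use id form in \<open>auto simp: hom_zero\<close>)
    then have "regular_on 0 0 w1" unfolding regular_on_def by blast
    then show "regular_on 0 0 w"
      using regular_on_cong[of 0 0 w 0 0 w1] assms id by simp
  qed
qed

text \<open>Every reduction lowers \<open>a + b\<close>: the quotient step by \<open>b\<close>, the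
  splitting step by \<open>a + t\<close>, the orthogonal step by \<open>b\<close>. The cases
  \<open>t = 0\<close> and \<open>b = 0\<close>, where a step could stall, form the base.\<close>

theorem regular_on_iff:
  fixes u m w :: "'k::field_char_0 fin_mat"
  assumes "idem u" "idem m" "idem w" "tr u = of_nat a" "tr m = of_nat b" "tr w = of_nat t"
  shows "regular_on u m w \<longleftrightarrow> num_cond a b t"
  using assms
proof (induction "a + b" arbitrary: u m w a b t rule: less_induct)
  case less
  note id = less.prems(1-3) and tr = less.prems(4-6)
  have zero: "x = 0 \<longleftrightarrow> r = 0" if "idem x" "tr x = of_nat r" for x :: "'k fin_mat" and r
    using idem_rank[OF that(1)] that(2) by (metis of_nat_eq_iff)
  have idt: "idem (dg {..<r} :: 'k fin_mat)" "tr (dg {..<r} :: 'k fin_mat) = of_nat r" for r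
    by (simp_all add: tr_dg)
  consider "t = 0" | "t > 0" "b = 0" | "t > 0" "b > 0" "b \<le> a" | "t > 0" "b \<ge> a + t" | "t > 0" "a < b" "b < a + t"
    by linarith
  then show ?case
  proof cases
    case 1
    then have "w = 0" using zero id(3) tr(3) by blast
    then show ?thesis
      using 1 regular_on_no_form zero[OF id(1) tr(1)] zero[OF id(2) tr(2)] by (auto simp: num_cond_def)
  next
    case 2
    then have m: "m = 0" using zero id(2) tr(2) by blast
    show ?thesis
      using 2 regular_on_no_middle[OF id(3) tr(3)] zero[OF id(1) tr(1)] unfolding m by (auto simp: num_cond_0)
  next
    case 3
    have "regular_on u m w \<longleftrightarrow> regular_on (dg {..<a - b}) m w"
      by (rule regular_on_quotient[OF id idt(1) _ tr(2) idt(2)]) (use 3 tr in simp)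
    also have "\<dots> \<longleftrightarrow> num_cond (a - b) b t"
      by (rule less.hyps) (use 3 id tr idt in auto)
    also have "\<dots> \<longleftrightarrow> num_cond a b t" using num_cond_quotient[of t "a - b" b] 3 by simp
    finally show ?thesis .
  next
    case 4
    have "regular_on u m w \<longleftrightarrow> regular_on u (dg {..<b - a - t}) w"
      by (rule regular_on_split[OF id tr(1) _ tr(3) idt]) (use 4 tr in simp)
    also have "\<dots> \<longleftrightarrow> num_cond a (b - a - t) t"
      by (rule less.hyps) (use 4 id tr idt in auto)
    also have "\<dots> \<longleftrightarrow> num_cond a b t" using num_cond_split[of t a "b - a - t"] 4 by simp
    finally show ?thesis .
  next
    case 5
    have "regular_on u m w \<longleftrightarrow> b - a \<le> 1 \<and> regular_on 0 u (dg {..<a + t - b})"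
      by (rule regular_on_orthogonal[OF id idt(1) tr _ _ idt(2)]) (use 5 in auto)
    moreover have "regular_on 0 u (dg {..<a + t - b}) \<longleftrightarrow> num_cond 0 a (a + t - b)"
      by (rule less.hyps) (use 5 id tr idt in auto)
    ultimately show ?thesis using num_cond_orthogonal[of t a b] 5 by simp
  qed
qed

section \<open>Standard parabolic subalgebras of the symplectic Lie algebra\<close>

text \<open>The signs of the symplectic form that pairs the index \<open>i\<close> with
  \<open>2*n+1-i\<close>.\<close>

definition sg :: "nat \<Rightarrow> nat \<Rightarrow> 'k::field" where
  "sg n i = (if i \<le> n then 1 else - 1)"

lemma sg_simps [simp]: "sg n i * sg n i = 1" "sg n i * (sg n i * x) = x" "sg n i \<noteq> 0"
  "sg n i * (sg n j * (sg n i * x)) = sg n j * x" "sg n i * (sg n j * (sg n i * sg n j)) = 1"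
  "sg n i * sg n j * (sg n j * sg n i) = 1"
  by (auto simp: sg_def)

lemma sg_reflect: "i \<in> {1..2*n} \<Longrightarrow> sg n (2*n+1-i) = - sg n i"
  by (auto simp: sg_def)

lemma block_mat_simps:
  "i \<in> {1..n} \<Longrightarrow> j \<in> {1..n} \<Longrightarrow> block_mat n A B C D i j = A i j"
  "i \<in> {1..n} \<Longrightarrow> j \<in> {n+1..2*n} \<Longrightarrow> block_mat n A B C D i j = B i (j - n)"
  "i \<in> {n+1..2*n} \<Longrightarrow> j \<in> {1..n} \<Longrightarrow> block_mat n A B C D i j = C (i - n) j"
  "i \<in> {n+1..2*n} \<Longrightarrow> j \<in> {n+1..2*n} \<Longrightarrow> block_mat n A B C D i j = D (i - n) (j - n)"
  by (auto simp: block_mat_def)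

text \<open>A signed reflection in the antidiagonal encodes all block conditions at once. On the
  diagonal blocks the two signs agree, which gives the minus of \<open>- antitranspose n A\<close>;
  on the other blocks they differ, which gives the symmetry of \<open>B\<close> and
  \<open>C\<close>.\<close>

lemma sp_iff:
  "X \<in> sp n \<longleftrightarrow> X \<in> square_mats (2*n) \<and>
     (\<forall>i\<in>{1..2*n}. \<forall>j\<in>{1..2*n}. X i j = - (sg n i * sg n j * X (2*n+1-j) (2*n+1-i)))"
proof
  assume "X \<in> sp n"
  then obtain A B C where X: "X = block_mat n A B C (- antitranspose n A)"
    and BC: "B = antitranspose n B" "C = antitranspose n C"
    unfolding sp_def by blast
  have BC': "B i j = B (n + 1 - j) (n + 1 - i)" "C i j = C (n + 1 - j) (n + 1 - i)" for i j
    using fun_cong[OF fun_cong[OF BC(1)], of i j] fun_cong[OF fun_cong[OF BC(2)], of i j]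
    by (simp_all add: antitranspose_def)
  have "X i j = - (sg n i * sg n j * X (2*n+1-j) (2*n+1-i))" if "i \<in> {1..2*n}" "j \<in> {1..2*n}" for i j
  proof -
    consider "i \<le> n" "j \<le> n" | "i \<le> n" "j > n" | "i > n" "j \<le> n" | "i > n" "j > n" by linarith
    then show ?thesis
    proof cases
      case 1
      have e: "n + 1 - (2 * n + 1 - i - n) = i" "n + 1 - (2 * n + 1 - j - n) = j"
        and r: "i \<in> {1..n}" "j \<in> {1..n}" "2*n+1-i \<in> {n+1..2*n}" "2*n+1-j \<in> {n+1..2*n}" using 1 that by auto
      show ?thesis
        unfolding X block_mat_simps(1)[OF r(1,2)] block_mat_simps(4)[OF r(4,3)] using r
        by (simp only: fun_Compl_def antitranspose_def e) (simp add: sg_def)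
    next
      case 2
      have e: "n + 1 - (j - n) = 2 * n + 1 - j" "n + 1 - i = 2 * n + 1 - i - n"
        and r: "i \<in> {1..n}" "j \<in> {n+1..2*n}" "2*n+1-i \<in> {n+1..2*n}" "2*n+1-j \<in> {1..n}" using 2 that by auto
      show ?thesis
        unfolding X block_mat_simps(2)[OF r(1,2)] block_mat_simps(2)[OF r(4,3)] using r BC'(1)[of i "j - n"]
        by (simp only: e) (simp add: sg_def)
    next
      case 3
      have e: "n + 1 - (i - n) = 2 * n + 1 - i" "n + 1 - j = 2 * n + 1 - j - n"
        and r: "i \<in> {n+1..2*n}" "j \<in> {1..n}" "2*n+1-i \<in> {1..n}" "2*n+1-j \<in> {n+1..2*n}" using 3 that by auto
      show ?thesis
        unfolding X block_mat_simps(3)[OF r(1,2)] block_mat_simps(3)[OF r(4,3)] using r BC'(2)[of "i - n" j]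
        by (simp only: e) (simp add: sg_def)
    next
      case 4
      have e: "n + 1 - (i - n) = 2 * n + 1 - i" "n + 1 - (j - n) = 2 * n + 1 - j"
        and r: "i \<in> {n+1..2*n}" "j \<in> {n+1..2*n}" "2*n+1-i \<in> {1..n}" "2*n+1-j \<in> {1..n}" using 4 that by auto
      show ?thesis
        unfolding X block_mat_simps(4)[OF r(1,2)] block_mat_simps(1)[OF r(4,3)] using r
        by (simp only: fun_Compl_def antitranspose_def e) (simp add: sg_def)
    qed
  qed
  moreover have "X \<in> square_mats (2*n)"
    by (auto simp: square_mats_def X block_mat_def split: if_splits)
  ultimately show "X \<in> square_mats (2*n) \<and>
     (\<forall>i\<in>{1..2*n}. \<forall>j\<in>{1..2*n}. X i j = - (sg n i * sg n j * X (2*n+1-j) (2*n+1-i)))" by blast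
next
  assume X: "X \<in> square_mats (2*n) \<and>
     (\<forall>i\<in>{1..2*n}. \<forall>j\<in>{1..2*n}. X i j = - (sg n i * sg n j * X (2*n+1-j) (2*n+1-i)))"
  then have X0: "X i j = 0" if "i \<notin> {1..2*n} \<or> j \<notin> {1..2*n}" for i j
    using that unfolding square_mats_def by blast
  have XX: "X i j = - (sg n i * sg n j * X (2*n+1-j) (2*n+1-i))" if "i \<in> {1..2*n}" "j \<in> {1..2*n}" for i j
    using X that by blast
  define A where "A i j = (if i \<in> {1..n} \<and> j \<in> {1..n} then X i j else 0)" for i j
  define B where "B i j = (if i \<in> {1..n} \<and> j \<in> {1..n} then X i (j + n) else 0)" for i j
  define C where "C i j = (if i \<in> {1..n} \<and> j \<in> {1..n} then X (i + n) j else 0)" for i j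
  have "A \<in> square_mats n" "B \<in> square_mats n" "C \<in> square_mats n"
    by (auto simp: square_mats_def A_def B_def C_def split: if_splits)
  moreover have "B = antitranspose n B"
  proof (intro ext)
    fix i j
    show "B i j = antitranspose n B i j"
    proof (cases "i \<in> {1..n} \<and> j \<in> {1..n}")
      case True
      have "2 * n + 1 - (j + n) = n + 1 - j" "2 * n + 1 - i = n + 1 - i + n" using True by auto
      then show ?thesis using True XX[of i "j + n"] by (auto simp: B_def antitranspose_def sg_def)
    next
      case False then show ?thesis by (auto simp: B_def antitranspose_def)
    qed
  qed
  moreover have "C = antitranspose n C"
  proof (intro ext)
    fix i j
    show "C i j = antitranspose n C i j"
    proof (cases "i \<in> {1..n} \<and> j \<in> {1..n}")
      case True
      have "2 * n + 1 - (i + n) = n + 1 - i" "2 * n + 1 - j = n + 1 - j + n" using True by auto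
      then show ?thesis using True XX[of "i + n" j] by (auto simp: C_def antitranspose_def sg_def)
    next
      case False then show ?thesis by (auto simp: C_def antitranspose_def)
    qed
  qed
  moreover have "X = block_mat n A B C (- antitranspose n A)"
  proof (intro ext)
    fix i j
    consider "i \<notin> {1..2*n} \<or> j \<notin> {1..2*n}" | "i \<in> {1..n}" "j \<in> {1..n}" | "i \<in> {1..n}" "j \<in> {n+1..2*n}"
      | "i \<in> {n+1..2*n}" "j \<in> {1..n}" | "i \<in> {n+1..2*n}" "j \<in> {n+1..2*n}"
      by (fastforce simp: not_le)
    then show "X i j = block_mat n A B C (- antitranspose n A) i j"
    proof cases
      case 1 then show ?thesis using X0 by (auto simp: block_mat_def)
    next
      case 2 then show ?thesis by (simp only: block_mat_simps A_def) simp
    next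
      case 3
      then have "j - n \<in> {1..n}" "j - n + n = j" by auto
      then show ?thesis using 3 by (simp only: block_mat_simps B_def) simp
    next
      case 4
      then have "i - n \<in> {1..n}" "i - n + n = i" by auto
      then show ?thesis using 4 by (simp only: block_mat_simps C_def) simp
    next
      case 5
      then have e: "n + 1 - (i - n) = 2 * n + 1 - i" "n + 1 - (j - n) = 2 * n + 1 - j"
        and r: "2 * n + 1 - i \<in> {1..n}" "2 * n + 1 - j \<in> {1..n}" "i \<in> {1..2*n}" "j \<in> {1..2*n}"
        and s: "sg n i = (- 1 :: 'a)" "sg n j = (- 1 :: 'a)" by (auto simp: sg_def)
      show ?thesis using XX[OF r(3,4)] r(1,2)
        by (simp only: block_mat_simps(4)[OF 5] fun_Compl_def antitranspose_def e A_def s) simp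
    qed
  qed
  ultimately show "X \<in> sp n" unfolding sp_def by blast
qed

section \<open>The reflection equation and the bracket\<close>

lemma sp_reflect:
  "X \<in> sp n \<Longrightarrow> i \<in> {1..2*n} \<Longrightarrow> j \<in> {1..2*n} \<Longrightarrow> X i j = - (sg n i * sg n j * X (2*n+1-j) (2*n+1-i))"
  unfolding sp_iff by blast

lemma sp_range: "X \<in> sp n \<Longrightarrow> X i j \<noteq> 0 \<Longrightarrow> i \<in> {1..2*n} \<and> j \<in> {1..2*n}"
  unfolding sp_iff square_mats_def by blast

lemma mat_mult_square: "A \<in> square_mats N \<Longrightarrow> B \<in> square_mats N \<Longrightarrow> mat_mult N A B \<in> square_mats N"
proof -
  assume A: "A \<in> square_mats N" and B: "B \<in> square_mats N"
  have "i \<in> {1..N} \<and> j \<in> {1..N}" if "mat_mult N A B i j \<noteq> 0" for i j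
  proof -
    have "(\<Sum>k=1..N. A i k * B k j) \<noteq> 0" using that by (simp add: mat_mult_def)
    then obtain k where "A i k * B k j \<noteq> 0" by (rule sum.not_neutral_contains_not_neutral)
    then have "A i k \<noteq> 0" "B k j \<noteq> 0" by auto
    then show ?thesis using A B unfolding square_mats_def by blast
  qed
  then show ?thesis unfolding square_mats_def by blast
qed

lemma sp_subspace: "gl.subspace (sp n)"
proof (rule gl.subspaceI)
  show "0 \<in> sp n" by (simp add: sp_iff square_mats_def)
next
  fix x y :: "'a matrix" assume x: "x \<in> sp n" and y: "y \<in> sp n"
  have "x + y \<in> square_mats (2*n)"
    using sp_range[OF x] sp_range[OF y] unfolding square_mats_def by (simp) (metis add.right_neutral add_0)
  moreover have "(x + y) i j = - (sg n i * sg n j * (x + y) (2*n+1-j) (2*n+1-i))"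
    if "i \<in> {1..2*n}" "j \<in> {1..2*n}" for i j
    using sp_reflect[OF x that] sp_reflect[OF y that] by (simp only: plus_fun_apply distrib_left minus_add_distrib)
  ultimately show "x + y \<in> sp n" unfolding sp_iff by blast
next
  fix c and x :: "'a matrix" assume x: "x \<in> sp n"
  have "mat_scale c x \<in> square_mats (2*n)"
    using sp_range[OF x] by (auto simp: square_mats_def mat_scale_def)
  moreover have "mat_scale c x i j = - (sg n i * sg n j * mat_scale c x (2*n+1-j) (2*n+1-i))"
    if "i \<in> {1..2*n}" "j \<in> {1..2*n}" for i j
    by (subst mat_scale_def, subst sp_reflect[OF x that]) (simp add: mat_scale_def)
  ultimately show "mat_scale c x \<in> sp n" unfolding sp_iff by blast
qed

text \<open>The signed reflection reverses products, as seen by reversing the summation index, and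
  \<open>sp n\<close> is where it acts as minus the identity; such a space is closed under
  commutators.\<close>

lemma commutator_sp:
  assumes "X \<in> sp n" "Y \<in> sp n"
  shows "commutator (2*n) X Y \<in> sp n"
proof -
  have sq: "X \<in> square_mats (2*n)" "Y \<in> square_mats (2*n)" using assms by (auto simp: sp_iff)
  have "commutator (2*n) X Y \<in> square_mats (2*n)"
    using mat_mult_square[OF sq] mat_mult_square[OF sq(2,1)]
    unfolding commutator_def square_mats_def by auto (metis diff_self)+
  moreover have "commutator (2*n) X Y i j =
      - (sg n i * sg n j * commutator (2*n) X Y (2*n+1-j) (2*n+1-i))"
    if ij: "i \<in> {1..2*n}" "j \<in> {1..2*n}" for i j
  proof -
    have rev: "(\<Sum>k=1..2*n. f k) = (\<Sum>k=1..2*n. f (2*n+1-k))" for f :: "nat \<Rightarrow> 'a"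
      by (rule sum.reindex_bij_witness[of _ "\<lambda>k. 2*n+1-k" "\<lambda>k. 2*n+1-k"]) auto
    have P: "mat_mult (2*n) A B (2*n+1-j) (2*n+1-i) = sg n i * sg n j * mat_mult (2*n) B A i j"
      if "A \<in> sp n" "B \<in> sp n" for A B :: "'a matrix"
    proof -
      have "A (2*n+1-j) (2*n+1-k) * B (2*n+1-k) (2*n+1-i) = sg n i * sg n j * (B i k * A k j)"
        if k: "k \<in> {1..2*n}" for k
        using sp_reflect[OF \<open>A \<in> sp n\<close> k ij(2)] sp_reflect[OF \<open>B \<in> sp n\<close> ij(1) k]
        by (simp add: algebra_simps)
      then show ?thesis
        unfolding mat_mult_def by (subst rev) (simp add: sum_distrib_left)
    qed
    show ?thesis
      unfolding commutator_def using P[OF assms] P[OF assms(2,1)] by (simp add: algebra_simps)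
  qed
  ultimately show ?thesis unfolding sp_iff by blast
qed

text \<open>A matrix unit made symplectic by subtracting its signed reflection. For
  \<open>j = 2*n+1-i\<close> the two terms coincide and the entry becomes 2; for
  \<open>i = j\<close> the result is a Cartan element.\<close>

definition root_vec :: "nat \<Rightarrow> nat \<Rightarrow> nat \<Rightarrow> 'k::field matrix" where
  "root_vec n i j = (\<lambda>p q. (if p = i \<and> q = j then 1 else 0)
     - sg n i * sg n j * (if p = 2*n+1-j \<and> q = 2*n+1-i then 1 else 0))"

lemma root_vec_sp: "i \<in> {1..2*n} \<Longrightarrow> j \<in> {1..2*n} \<Longrightarrow> (root_vec n i j :: 'k::field matrix) \<in> sp n"
proof -
  assume ij: "i \<in> {1..2*n}" "j \<in> {1..2*n}"
  have "(root_vec n i j :: 'k matrix) \<in> square_mats (2*n)"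
    using ij by (auto simp: square_mats_def root_vec_def split: if_splits)
  moreover have "root_vec n i j p q = (- (sg n p * sg n q *  root_vec n i j (2*n+1-q) (2*n+1-p)) :: 'k)"
    if "p \<in> {1..2*n}" "q \<in> {1..2*n}" for p q
  proof -
    have e: "2*n+1-q = i \<longleftrightarrow> q = 2*n+1-i" "2*n+1-p = j \<longleftrightarrow> p = 2*n+1-j"
      "2*n+1-q = 2*n+1-j \<longleftrightarrow> q = j" "2*n+1-p = 2*n+1-i \<longleftrightarrow> p = i"
      using ij that by auto
    define P where "P \<longleftrightarrow> p = i \<and> q = j"
    define Q where "Q \<longleftrightarrow> p = 2*n+1-j \<and> q = 2*n+1-i"
    have v1: "root_vec n i j p q = (if P then 1 else 0) - sg n i * sg n j * (if Q then 1 else (0::'k))"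
      by (simp only: root_vec_def P_def Q_def)
    have v2: "root_vec n i j (2*n+1-q) (2*n+1-p) = (if Q then 1 else 0) - sg n i * sg n j * (if P then 1 else (0::'k))"
      by (simp only: root_vec_def P_def Q_def e conj_commute)
    have sP: "P \<Longrightarrow> sg n p * sg n q = (sg n i * sg n j :: 'k)" by (simp add: P_def)
    have sQ: "Q \<Longrightarrow> sg n p * sg n q = (sg n i * sg n j :: 'k)"
      using sg_reflect[OF ij(1), where 'a='k] sg_reflect[OF ij(2), where 'a='k] by (simp add: Q_def mult.commute)
    show ?thesis unfolding v1 v2
      using sP sQ by (cases P; cases Q) (simp_all add: right_diff_distrib mult.assoc mult.left_commute[of "sg n j"])
  qed
  ultimately show ?thesis unfolding sp_iff by blast
qed

lemma mat_mult_root_vec: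
  assumes "i \<in> {1..2*n}" "j \<in> {1..2*n}"
  shows "mat_mult (2*n) (root_vec n i j) M p q = (if p = i then M j q else 0)
     - sg n i * sg n j * (if p = 2*n+1-j then M (2*n+1-i) q else 0)"
proof -
  have "mat_mult (2*n) (root_vec n i j) M p q
    = (\<Sum>k=1..2*n. (if k = j then if p = i then M k q else 0 else 0)
       - (if k = 2*n+1-i then sg n i * sg n j * (if p = 2*n+1-j then M k q else 0) else 0))"
    unfolding mat_mult_def by (rule sum.cong) (auto simp: root_vec_def algebra_simps)
  also have "\<dots> = (if p = i then M j q else 0) - sg n i * sg n j * (if p = 2*n+1-j then M (2*n+1-i) q else 0)"
    unfolding sum_subtractf sum.delta'[OF finite_atLeastAtMost] sum.delta[OF finite_atLeastAtMost] using assms by auto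
  finally show ?thesis .
qed

section \<open>Weights and root components\<close>

definition dcoeff :: "nat \<Rightarrow> nat \<Rightarrow> nat \<Rightarrow> 'k::field" where
  "dcoeff n k p = (if p = k then 1 else 0) - (if p = 2*n+1-k then 1 else 0)"

lemma root_vec_diag: "root_vec n k k = (\<lambda>p q. if p = q then dcoeff n k p else 0)"
  by (auto simp: root_vec_def dcoeff_def fun_eq_iff)

lemma root_vec_cartan: "k \<in> {1..2*n} \<Longrightarrow> root_vec n k k \<in> cartan n"
  unfolding cartan_def using root_vec_sp[of k n k] by (auto simp: root_vec_diag)

lemma commutator_diag:
  assumes "\<And>i j. i \<noteq> j \<Longrightarrow> H i j = 0" "X \<in> square_mats N"
  shows "commutator N H X p q = (H p p - H q q) * X p q"
proof (cases "p \<in> {1..N} \<and> q \<in> {1..N}")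
  case True
  have "mat_mult N H X p q = (\<Sum>k=1..N. if k = p then H p p * X p q else 0)"
    unfolding mat_mult_def by (rule sum.cong) (use assms(1) in auto)
  moreover have "mat_mult N X H p q = (\<Sum>k=1..N. if k = q then X p q * H q q else 0)"
    unfolding mat_mult_def by (rule sum.cong) (use assms(1) in auto)
  ultimately show ?thesis using True by (simp add: commutator_def algebra_simps)
next
  case False
  then have X0: "X p q = 0" using assms(2) unfolding square_mats_def by blast
  have "mat_mult N H X p q = 0" "mat_mult N X H p q = 0"
    unfolding mat_mult_def by (rule sum.neutral, metis X0 assms(1) mult_zero_left mult_zero_right)+
  then show ?thesis by (simp add: commutator_def X0)
qed

lemma dcoeff_one:
  "i \<in> {1..2*n} \<Longrightarrow> dcoeff n i p - dcoeff n i q = (1 :: 'k::field_char_0) \<Longrightarrow> p = i \<or> q = 2*n+1-i"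
  "i \<in> {1..2*n} \<Longrightarrow> dcoeff n i p - dcoeff n i q = (- 1 :: 'k::field_char_0) \<Longrightarrow> q = i \<or> p = 2*n+1-i"
  by (auto simp: dcoeff_def split: if_splits)

lemma dcoeff_root:
  fixes n i j p q :: nat
  assumes "i \<in> {1..2*n}" "j \<in> {1..2*n}" "i \<noteq> j" "j \<noteq> 2*n+1-i"
    and "dcoeff n i p - dcoeff n i q = (1 :: 'k::field_char_0)" "dcoeff n j p - dcoeff n j q = (- 1 :: 'k)"
  shows "(p = i \<and> q = j) \<or> (p = 2*n+1-j \<and> q = 2*n+1-i)"
proof -
  have "i \<noteq> 2*n+1-j" using assms(1,2,4) by auto
  then show ?thesis
    using dcoeff_one(1)[OF assms(1,5)] dcoeff_one(2)[OF assms(2,6)] assms(3,4) by auto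
qed

lemma dcoeff_long:
  fixes n i p q :: nat
  assumes "i \<in> {1..2*n}" "dcoeff n i p - dcoeff n i q = (2 :: 'k::field_char_0)"
  shows "p = i \<and> q = 2*n+1-i"
  using assms by (auto simp: dcoeff_def split: if_splits)


lemma sp_eq_root_vec:
  fixes X :: "'k::field_char_0 matrix"
  assumes X: "X \<in> sp n" and ij: "i \<in> {1..2*n}" "j \<in> {1..2*n}" "i \<noteq> j"
    and supp: "\<And>p q. X p q \<noteq> 0 \<Longrightarrow> (p = i \<and> q = j) \<or> (p = 2*n+1-j \<and> q = 2*n+1-i)"
  shows "X = mat_scale (if j = 2*n+1-i then X i j / 2 else X i j) (root_vec n i j)"
proof (intro ext)
  fix p q
  have r: "X (2*n+1-j) (2*n+1-i) = - (sg n i * sg n j * X i j)"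
    using sp_reflect[OF X ij(1,2)] by (simp add: mult.assoc[symmetric]) (simp add: mult.assoc)
  have e: "2*n+1-j = i \<longleftrightarrow> j = 2*n+1-i" "2*n+1-i = j \<longleftrightarrow> j = 2*n+1-i" using ij by auto
  show "X p q = mat_scale (if j = 2*n+1-i then X i j / 2 else X i j) (root_vec n i j) p q"
  proof (cases "j = 2*n+1-i")
    case True
    have s: "sg n i * sg n j = (- 1 :: 'k)" using sg_reflect[OF ij(1), where 'a='k] True by simp
    have j: "2*n+1-j = i" using e True by blast
    have "X p q = 0" if "\<not> (p = i \<and> q = j)" using supp[of p q] that j True by auto
    then show ?thesis using True[symmetric] j by (auto simp: mat_scale_def root_vec_def s)
  next
    case False
    then have "X p q = 0" if "\<not> (p = i \<and> q = j)" "\<not> (p = 2*n+1-j \<and> q = 2*n+1-i)" using supp[of p q] that by auto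
    then show ?thesis using False r e by (auto simp: mat_scale_def root_vec_def)
  qed
qed

text \<open>The root components of an element of a subalgebra containing the Cartan subalgebra are cut
  out by polynomials in \<open>ad H\<close>, where \<open>H\<close> runs through the matrices \<open>root_vec n k k\<close>.\<close>

lemma root_component:
  fixes p :: "'k::field_char_0 matrix set"
  assumes p: "gl.lie_subalgebra (2*n) p" "p \<subseteq> sp n" "cartan n \<subseteq> p"
    and X: "X \<in> p" "X i j \<noteq> 0" "i \<noteq> j"
  shows "root_vec n i j \<in> p"
proof -
  have sub: "gl.subspace p" and br: "\<And>x y. x \<in> p \<Longrightarrow> y \<in> p \<Longrightarrow> commutator (2*n) x y \<in> p"
    using p(1) unfolding gl.lie_subalgebra_def by blast+
  have ij: "i \<in> {1..2*n}" "j \<in> {1..2*n}" using sp_range X p(2) by blast+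
  define wt where "wt k r s = (dcoeff n k r - dcoeff n k s :: 'k)" for k r s
  define op where "op k c Y = (\<lambda>r s. (wt k r s - c) * Y r s)" for k c and Y :: "'k matrix"
  have op: "op k c Y \<in> p" if k: "k \<in> {1..2*n}" and Y: "Y \<in> p" for k c Y
  proof -
    have "root_vec n k k \<in> p" using root_vec_cartan[OF k] p(3) by blast
    then have "commutator (2*n) (root_vec n k k) Y - mat_scale c Y \<in> p"
      using br Y gl.subspace_diff[OF sub] gl.subspace_scale[OF sub] by blast
    moreover have "Y \<in> square_mats (2*n)" using Y p(2) sp_iff by blast
    then have "commutator (2*n) (root_vec n k k) Y r s = wt k r s * Y r s" for r s
      by (subst commutator_diag) (auto simp: root_vec_diag wt_def)
    then have "commutator (2*n) (root_vec n k k) Y - mat_scale c Y = op k c Y"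
      by (auto simp: fun_eq_iff op_def mat_scale_def algebra_simps)
    ultimately show ?thesis by simp
  qed
  have wt_vals: "wt k r s \<in> {-2, -1, 0, 1, 2}" for k r s
    by (auto simp: wt_def dcoeff_def)
  have "\<exists>Z\<in>p. Z i j \<noteq> 0 \<and> (\<forall>r s. Z r s \<noteq> 0 \<longrightarrow> (r = i \<and> s = j) \<or> (r = 2*n+1-j \<and> s = 2*n+1-i))"
  proof (cases "j = 2*n+1-i")
    case True
    \<comment> \<open>All weights lie between -2 and 2; these factors remove every weight of
      \<open>root_vec n i i\<close> except 2, which only the position \<open>(i, j)\<close>
      has.\<close>
    define Z where "Z = op i 0 (op i 1 (op i (- 1) (op i (- 2) X)))"
    have Z: "Z r s = (wt i r s - 0) * ((wt i r s - 1) * ((wt i r s - - 1) * ((wt i r s - - 2) * X r s)))" for r s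
      by (simp add: Z_def op_def)
    have "2*n+1-i \<noteq> i" using ij by presburger
    then have "wt i i j = 2" using True ij by (auto simp: wt_def dcoeff_def)
    then have "Z i j \<noteq> 0" using X by (simp add: Z)
    moreover have "r = i \<and> s = j" if "Z r s \<noteq> 0" for r s
    proof -
      have "wt i r s = 2" using that wt_vals[of i r s] by (auto simp: Z)
      then show ?thesis using dcoeff_long[OF ij(1), of r s] True by (auto simp: wt_def)
    qed
    moreover have "Z \<in> p" using op ij X by (simp add: Z_def)
    ultimately show ?thesis by blast
  next
    case False
    \<comment> \<open>What survives has weight 1 for index \<open>i\<close> and weight -1 for index
      \<open>j\<close>; this leaves only \<open>(i, j)\<close> and its reflection.\<close>
    define Z where "Z = op i 0 (op i 2 (op i (- 1) (op i (- 2) (op j 0 (op j 1 (op j 2 (op j (- 2) X)))))))"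
    have Z: "Z r s = (wt i r s - 0) * ((wt i r s - 2) * ((wt i r s - - 1) * ((wt i r s - - 2) *
      ((wt j r s - 0) * ((wt j r s - 1) * ((wt j r s - 2) * ((wt j r s - - 2) * X r s)))))))" for r s
      by (simp add: Z_def op_def)
    have "2*n+1-i \<noteq> i" "2*n+1-j \<noteq> j" "2*n+1-j \<noteq> i" using False ij by presburger+ 
    then have "wt i i j = 1" "wt j i j = -1" using False X(3) by (auto simp: wt_def dcoeff_def)
    then have "Z i j \<noteq> 0" using X by (simp add: Z)
    moreover have "(r = i \<and> s = j) \<or> (r = 2*n+1-j \<and> s = 2*n+1-i)" if "Z r s \<noteq> 0" for r s
    proof -
      have "wt i r s = 1" "wt j r s = -1" using that wt_vals[of i r s] wt_vals[of j r s] by (auto simp: Z)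
      then show ?thesis using dcoeff_root[OF ij X(3) False, of r s] unfolding wt_def by blast
    qed
    moreover have "Z \<in> p" using op ij X by (simp add: Z_def)
    ultimately show ?thesis by blast
  qed
  then obtain Z where Z: "Z \<in> p" "Z i j \<noteq> 0"
    "\<And>r s. Z r s \<noteq> 0 \<Longrightarrow> (r = i \<and> s = j) \<or> (r = 2*n+1-j \<and> s = 2*n+1-i)" by blast
  define c where "c = (if j = 2*n+1-i then Z i j / 2 else Z i j)"
  have "Z = mat_scale c (root_vec n i j)"
    unfolding c_def by (rule sp_eq_root_vec) (use Z ij X p in auto)
  moreover have "c \<noteq> 0" using Z(2) by (auto simp: c_def)
  ultimately have "root_vec n i j = mat_scale (1 / c) Z" by (auto simp: mat_scale_def fun_eq_iff)
  then show ?thesis using Z(1) gl.subspace_scale[OF sub] by metis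
qed

text \<open>The bracket of the two root vectors has entry 1 or 2 at \<open>(i, l)\<close>: the extra
  terms that arise when two of the indices are reflections of each other add up instead of
  cancelling. \<open>root_component\<close> then extracts the root vector.\<close>

lemma root_vec_trans:
  fixes p :: "'k::field_char_0 matrix set"
  assumes p: "gl.lie_subalgebra (2*n) p" "p \<subseteq> sp n" "cartan n \<subseteq> p"
    and ij: "i \<in> {1..2*n}" "j \<in> {1..2*n}" "l \<in> {1..2*n}" "i \<noteq> j" "j \<noteq> l" "i \<noteq> l"
    and r: "root_vec n i j \<in> p" "root_vec n j l \<in> p"
  shows "root_vec n i l \<in> p"
proof -
  let ?Z = "commutator (2*n) (root_vec n i j) (root_vec n j l) :: 'k matrix"
  have Z: "?Z \<in> p" using p(1) r unfolding gl.lie_subalgebra_def by blast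
  have e: "2*n+1-j = i \<longleftrightarrow> i = 2*n+1-j" "2*n+1-i = j \<longleftrightarrow> i = 2*n+1-j" "2*n+1-l = j \<longleftrightarrow> j = 2*n+1-l"
    "2*n+1-j = l \<longleftrightarrow> j = 2*n+1-l" "2*n+1-l = i \<longleftrightarrow> i = 2*n+1-l" "2*n+1-i = l \<longleftrightarrow> i = 2*n+1-l"
    using ij by auto
  have sr: "i = 2*n+1-j \<Longrightarrow> sg n i = (- sg n j :: 'k)" "j = 2*n+1-l \<Longrightarrow> sg n j = (- sg n l :: 'k)"
    "i = 2*n+1-l \<Longrightarrow> sg n i = (- sg n l :: 'k)"
    using sg_reflect ij by blast+
  have Zil: "?Z i l = root_vec n j l j l
      - sg n i * sg n j * (if i = 2*n+1-j then root_vec n j l (2*n+1-i) l else 0)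
      + sg n j * sg n l * (if i = 2*n+1-l then root_vec n i j (2*n+1-j) l else 0)"
    unfolding commutator_def fun_diff_def mat_mult_root_vec[OF ij(1,2)] mat_mult_root_vec[OF ij(2,3)]
    using ij(4) by simp
  consider "i = 2*n+1-j" "j \<noteq> 2*n+1-l" "i \<noteq> 2*n+1-l" | "i \<noteq> 2*n+1-j" "j = 2*n+1-l" "i \<noteq> 2*n+1-l"
    | "i \<noteq> 2*n+1-j" "j \<noteq> 2*n+1-l" "i = 2*n+1-l" | "i \<noteq> 2*n+1-j" "j \<noteq> 2*n+1-l" "i \<noteq> 2*n+1-l"
    using ij by fastforce
  then have "?Z i l = 1 \<or> ?Z i l = 2"
  proof cases
    case 1 then show ?thesis unfolding Zil unfolding root_vec_def using e ij(4-6) sr(1) by auto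
  next
    case 2 then show ?thesis unfolding Zil unfolding root_vec_def using e ij(4-6) sr(2) by auto
  next
    case 3 then show ?thesis unfolding Zil unfolding root_vec_def using e ij(4-6) sr(3) by auto
  next
    case 4 then show ?thesis unfolding Zil unfolding root_vec_def using e ij(4-6) by auto
  qed
  then have "?Z i l \<noteq> 0" by auto
  then show ?thesis using root_component[OF p Z] ij by blast
qed


text \<open>The stabilizer of the spans of the first \<open>k\<close> basis vectors for
  \<open>k\<close> in \<open>K\<close>. For \<open>k \<le> n\<close> these spans are isotropic, and
  a symplectic matrix preserving one of them also preserves its orthogonal complement.\<close>

definition flag_stabilizer :: "nat \<Rightarrow> nat set \<Rightarrow> 'k::field matrix set" where
  "flag_stabilizer n K = {X \<in> sp n. \<forall>k\<in>K. \<forall>i j. j \<le> k \<and> k < i \<longrightarrow> X i j = 0}"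

lemma flag_stabilizer_subalgebra: "gl.lie_subalgebra (2*n) (flag_stabilizer n K)"
  unfolding gl.lie_subalgebra_def
proof
  show "gl.subspace (flag_stabilizer n K)"
    using sp_subspace unfolding gl.subspace_def flag_stabilizer_def by (auto simp: mat_scale_def)
  have "commutator (2*n) X Y \<in> flag_stabilizer n K"
    if "X \<in> flag_stabilizer n K" "Y \<in> flag_stabilizer n K" for X Y :: "'a matrix"
  proof -
    have "mat_mult (2*n) A B i j = 0"
      if "A \<in> flag_stabilizer n K" "B \<in> flag_stabilizer n K" "k \<in> K" "j \<le> k" "k < i"
      for A B :: "'a matrix" and i j k
      unfolding mat_mult_def
    proof (rule sum.neutral, rule ballI)
      fix l
      show "A i l * B l j = 0"
        using that by (cases "l \<le> k") (auto simp: flag_stabilizer_def)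
    qed
    then have "commutator (2*n) X Y i j = 0" if "k \<in> K" "j \<le> k" "k < i" for i j k
      using that \<open>X \<in> flag_stabilizer n K\<close> \<open>Y \<in> flag_stabilizer n K\<close> by (simp add: commutator_def)
    then show ?thesis
      using commutator_sp that by (auto simp: flag_stabilizer_def)
  qed
  then show "\<forall>X\<in>flag_stabilizer n K. \<forall>Y\<in>flag_stabilizer n K. commutator (2*n) X Y \<in> (flag_stabilizer n K :: 'a matrix set)"
    by blast
qed

lemma simple_root_dcoeff:
  assumes "k \<in> {1..n}"
  shows "- simple_root n k (root_vec n k k) = (if k < n then - 1 else - 2 :: 'k::field_char_0)"
    "- simple_root n k (root_vec n (k+1) (k+1)) = (if k < n then 1 else 2 :: 'k)"
proof -
  have "Suc k \<noteq> 2*n-k" "2*n+1-k \<noteq> k" using assms by (auto, presburger+)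
  then show "- simple_root n k (root_vec n k k) = (if k < n then - 1 else - 2 :: 'k::field_char_0)"
    "- simple_root n k (root_vec n (k+1) (k+1)) = (if k < n then 1 else 2 :: 'k)"
    using assms by (auto simp: simple_root_def root_vec_diag dcoeff_def)
qed

text \<open>Short and long simple roots are treated alike: at \<open>k = n\<close> the position
  \<open>(n+1, n)\<close> is fixed by the reflection and carries the negative of the long
  root.\<close>

lemma root_vec_root_space:
  assumes "k \<in> {1..n}"
  shows "(root_vec n (k+1) k :: 'k::field_char_0 matrix) \<in> root_space n (- simple_root n k)"
proof -
  have k: "k + 1 \<in> {1..2*n}" "k \<in> {1..2*n}" using assms by auto
  have sp: "(root_vec n (k+1) k :: 'k matrix) \<in> sp n" using root_vec_sp k by blast
  have "commutator (2*n) H (root_vec n (k+1) k) = mat_scale ((- simple_root n k) H) (root_vec n (k+1) k)"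
    if H: "H \<in> cartan n" for H :: "'k matrix"
  proof (intro ext)
    fix p q
    have H0: "\<And>i j. i \<noteq> j \<Longrightarrow> H i j = 0" and Hsp: "H \<in> sp n" using H by (auto simp: cartan_def)
    have Hi: "H (2*n+1-i) (2*n+1-i) = - H i i" if "i \<in> {1..2*n}" for i
      using sp_reflect[OF Hsp that that] by simp
    note Hk = Hi[OF k(2)] Hi[OF k(1)]
    have "(H p p - H q q) * root_vec n (k+1) k p q = (- simple_root n k) H * root_vec n (k+1) k p q"
    proof (cases "p = k + 1 \<and> q = k \<or> p = 2*n+1-k \<and> q = 2*n+1-(k+1)")
      case True
      have E: "H (k+1) (k+1) - H k k = (- simple_root n k) H"
      proof (cases "k < n")
        case False
        then have "k = n" "2*n+1-k = k+1" using assms by auto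
        then show ?thesis using Hk(1) by (simp add: simple_root_def)
      qed (simp add: simple_root_def)
      have "H p p - H q q = H (k+1) (k+1) - H k k"
        using True
      proof
        assume "p = 2*n+1-k \<and> q = 2*n+1-(k+1)"
        then show ?thesis by (simp only: Hk) simp
      qed simp
      then show ?thesis unfolding E by simp
    next
      case False
      then have "root_vec n (k+1) k p q = (0::'k)" by (auto simp: root_vec_def)
      then show ?thesis by simp
    qed
    then show "commutator (2*n) H (root_vec n (k+1) k) p q = mat_scale ((- simple_root n k) H) (root_vec n (k+1) k) p q"
      using commutator_diag[OF H0, where X = "root_vec n (k+1) k" and N = "2*n" and p = p and q = q] sp unfolding sp_iff mat_scale_def by simp
  qed
  then show ?thesis using sp unfolding root_space_def by blast
qed

lemma root_space_multiple:
  assumes k: "k \<in> {1..n}" and X: "(X :: 'k::field_char_0 matrix) \<in> root_space n (- simple_root n k)"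
  shows "\<exists>c. X = mat_scale c (root_vec n (k+1) k)"
proof -
  have k': "k + 1 \<in> {1..2*n}" "k \<in> {1..2*n}" using k by auto
  have sp: "X \<in> sp n" and comm: "\<And>H. H \<in> cartan n \<Longrightarrow> commutator (2*n) H X = mat_scale ((- simple_root n k) H) X"
    using X unfolding root_space_def by blast+
  have wt: "dcoeff n l p - dcoeff n l q = - simple_root n k (root_vec n l l :: 'k matrix)"
    if l: "l \<in> {1..2*n}" and "X p q \<noteq> 0" for l p q
  proof -
    have "commutator (2*n) (root_vec n l l) X p q = (root_vec n l l p p - root_vec n l l q q) * X p q"
      by (rule commutator_diag) (use sp sp_iff in \<open>auto simp: root_vec_diag\<close>)
    moreover have "commutator (2*n) (root_vec n l l) X p q = - simple_root n k (root_vec n l l) * X p q"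
      using comm[OF root_vec_cartan[OF l]] by (simp add: mat_scale_def)
    ultimately have "(root_vec n l l p p - root_vec n l l q q) * X p q = - simple_root n k (root_vec n l l) * X p q"
      by (rule trans[OF sym])
    then have "(root_vec n l l :: 'k matrix) p p - root_vec n l l q q = - simple_root n k (root_vec n l l)"
      using that(2) by (simp only: mult_cancel_right) simp
    moreover have "root_vec n l l r r = (dcoeff n l r :: 'k)" for r by (simp add: root_vec_diag)
    ultimately show ?thesis by simp
  qed
  have "(p = k + 1 \<and> q = k) \<or> (p = 2*n+1-k \<and> q = 2*n+1-(k+1))" if "X p q \<noteq> 0" for p q
  proof (cases "k < n")
    case True
    then have "k + 1 \<noteq> k" "k \<noteq> 2*n+1-(k+1)" by auto
    then show ?thesis
      using True dcoeff_root[OF k', of p q] wt[OF k'(1) that] wt[OF k'(2) that] simple_root_dcoeff[OF k, where 'k='k] k by auto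
  next
    case False
    then show ?thesis
      using dcoeff_long[OF k'(1), of p q] wt[OF k'(1) that] simple_root_dcoeff[OF k, where 'k='k] k by auto
  qed
  then show ?thesis using sp_eq_root_vec[OF sp k'] by auto
qed

lemma root_space_subset_iff:
  fixes p :: "'k::field_char_0 matrix set"
  assumes "k \<in> {1..n}" "gl.subspace p"
  shows "root_space n (- simple_root n k) \<subseteq> p \<longleftrightarrow> root_vec n (k+1) k \<in> p"
  using root_vec_root_space[OF assms(1)] root_space_multiple[OF assms(1)] gl.subspace_scale[OF assms(2)] by blast

text \<open>A simple root is recovered from the position of the vector spanning the opposite root
  space.\<close>

lemma inj_simple_root: "inj_on (simple_root n :: nat \<Rightarrow> 'k::field_char_0 matrix \<Rightarrow> 'k) {1..n}"
proof (rule inj_onI)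
  fix k l assume kl: "k \<in> {1..n}" "l \<in> {1..n}" and e: "simple_root n k = (simple_root n l :: 'k matrix \<Rightarrow> 'k)"
  have "(root_vec n (k+1) k :: 'k matrix) \<in> root_space n (- simple_root n l)"
    using root_vec_root_space[OF kl(1), where 'k='k] unfolding e .
  then obtain c :: 'k where c: "root_vec n (k+1) k = mat_scale c (root_vec n (l+1) l)"
    using root_space_multiple[OF kl(2)] by blast
  have "root_vec n (k+1) k (k+1) k \<noteq> (0 :: 'k)" 
    using kl by (auto simp: root_vec_def sg_def)
  then have "root_vec n (l+1) l (k+1) k \<noteq> (0 :: 'k)" unfolding c mat_scale_def by auto
  then have "k = l \<or> (k + 1 = 2*n+1-l \<and> k = 2*n+1-(l+1))" by (auto simp: root_vec_def split: if_splits)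
  then show "k = l" using kl by auto
qed

lemma flag_stabilizer_root_vec:
  assumes "K \<subseteq> {1..n}" "k \<in> {1..n}"
  shows "(root_vec n (k+1) k :: 'k::field_char_0 matrix) \<in> flag_stabilizer n K \<longleftrightarrow> k \<notin> K"
proof
  have "root_vec n (k+1) k (k+1) k \<noteq> (0 :: 'k)"
    using assms by (auto simp: root_vec_def sg_def)
  then show "(root_vec n (k+1) k :: 'k matrix) \<in> flag_stabilizer n K \<Longrightarrow> k \<notin> K"
    unfolding flag_stabilizer_def by fastforce
  assume kK: "k \<notin> K"
  have "root_vec n (k+1) k i j = (0::'k)" if l: "l \<in> K" "j \<le> l" "l < i" for i j l
  proof -
    have "\<not> (i = k + 1 \<and> j = k)" using l kK by (metis Suc_eq_plus1 le_antisym less_Suc_eq_le)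
    \<comment> \<open>The reflected entry crosses only the level \<open>2*n-k\<close>, which lies in
      \<open>{1..n}\<close> only for \<open>k = n\<close>, where it equals \<open>k\<close>.\<close>
    moreover have "\<not> (i = 2*n+1-k \<and> j = 2*n+1-(k+1))"
    proof
      assume "i = 2*n+1-k \<and> j = 2*n+1-(k+1)"
      then have "l = 2*n-k" using l assms by auto
      moreover have "l \<le> n" using l assms by auto
      ultimately have "l = k" using assms by auto
      then show False using l kK by blast
    qed
    ultimately show ?thesis by (auto simp: root_vec_def)
  qed
  then show "(root_vec n (k+1) k :: 'k matrix) \<in> flag_stabilizer n K"
    unfolding flag_stabilizer_def using root_vec_sp[of "k+1" n k] assms by auto
qed

section \<open>Classification of the standard parabolic subalgebras\<close>

lemma sum_matrix_apply: "(\<Sum>a\<in>A. f a) r s = (\<Sum>a\<in>A. (f a :: 'k::field matrix) r s)"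
  by (induction A rule: infinite_finite_induct) auto

text \<open>A subalgebra containing the Cartan subalgebra is determined by its root vectors.
  Brackets with the upper root vectors, all of which lie in \<open>p\<close>, shrink a lower one to
  each subdiagonal position \<open>(k+1, k)\<close> below it; conversely,
  \<open>root_vec_trans\<close> chains those together. So everything is decided at the simple
  roots.\<close>

lemma parabolic_unique:
  fixes p :: "'k::field_char_0 matrix set"
  assumes K: "K \<subseteq> {1..n}" and p: "gl.lie_subalgebra (2*n) p" "p \<subseteq> sp n"
    and b: "{H + U | H U. H \<in> cartan n \<and> U \<in> u_plus n} \<subseteq> p"
    and roots: "{\<alpha> \<in> simple_roots n. \<not> root_space n (- \<alpha>) \<subseteq> p} = simple_root n ` K"
  shows "p = flag_stabilizer n K"
proof -
  have sub: "gl.subspace p" using p unfolding gl.lie_subalgebra_def by blast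
  have c: "cartan n \<subseteq> p"
  proof
    fix H :: "'k matrix" assume "H \<in> cartan n"
    moreover have "(0 :: 'k matrix) \<in> u_plus n"
      using gl.subspace_0[OF sp_subspace] unfolding u_plus_def by auto
    ultimately show "H \<in> p" using b by force
  qed
  have u: "u_plus n \<subseteq> p"
  proof
    fix U :: "'k matrix" assume "U \<in> u_plus n"
    moreover have "(0 :: 'k matrix) \<in> cartan n"
      using gl.subspace_0[OF sp_subspace] unfolding cartan_def by auto
    ultimately show "U \<in> p" using b by force
  qed
  have lev: "root_vec n (k+1) k \<in> p \<longleftrightarrow> k \<notin> K" if k: "k \<in> {1..n}" for k
  proof -
    have "simple_root n k \<in> {\<alpha> \<in> simple_roots n. \<not> root_space n (- \<alpha>) \<subseteq> p} \<longleftrightarrow> \<not> root_space n (- simple_root n k) \<subseteq> p"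
      using k by (auto simp: simple_roots_def)
    moreover have "simple_root n k \<in> (simple_root n ` K :: ('k matrix \<Rightarrow> 'k) set) \<longleftrightarrow> k \<in> K"
      using inj_on_image_mem_iff[OF inj_simple_root k K] .
    ultimately show ?thesis using roots root_space_subset_iff[OF k sub] by auto
  qed
  note tr = root_vec_trans[OF p c]
  have up: "root_vec n i j \<in> p" if "i \<in> {1..2*n}" "j \<in> {1..2*n}" "i < j" for i j
  proof -
    have "root_vec n i j \<in> u_plus n"
      unfolding u_plus_def using root_vec_sp[OF that(1,2)] that by (auto simp: root_vec_def)
    then show ?thesis using u by blast
  qed
  have rfl: "root_vec n i j \<in> p \<Longrightarrow> root_vec n (2*n+1-j) (2*n+1-i) \<in> p"
    if ij: "i \<in> {1..2*n}" "j \<in> {1..2*n}" for i j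
  proof -
    assume r: "root_vec n i j \<in> p"
    have e: "2*n+1-(2*n+1-i) = i" "2*n+1-(2*n+1-j) = j" using ij by auto
    have "root_vec n (2*n+1-j) (2*n+1-i) = mat_scale (- (sg n i * sg n j)) (root_vec n i j :: 'k matrix)"
      unfolding root_vec_def e using sg_reflect[OF ij(1), where 'a='k] sg_reflect[OF ij(2), where 'a='k]
      by (auto simp: fun_eq_iff mat_scale_def algebra_simps)
    then show ?thesis using gl.subspace_scale[OF sub r] by metis
  qed
  \<comment> \<open>Subdiagonal positions beyond \<open>n\<close> are reflections of earlier ones
    and give proportional root vectors.\<close>
  have lev2: "root_vec n (k+1) k \<in> p \<longleftrightarrow> k \<notin> K \<and> 2*n-k \<notin> K" if k: "k \<in> {1..<2*n}" for k
  proof -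
    have e: "2*n+1-k = (2*n-k) + 1" "2*n+1-(k+1) = 2*n-k" "2*n-(2*n-k) = k" using k by auto
    have r: "root_vec n (k+1) k \<in> p \<longleftrightarrow> root_vec n (2*n-k+1) (2*n-k) \<in> p"
      using rfl[of "k+1" k] rfl[of "2*n-k+1" "2*n-k"] k e by auto
    show ?thesis
    proof (cases "k \<le> n")
      case True
      moreover have "2*n-k \<notin> K \<or> k = n" using K True by (auto dest!: subsetD)
      ultimately show ?thesis using lev[of k] k by auto
    next
      case False
      then have "k \<notin> K" "2*n-k \<in> {1..n}" using K k by auto
      then show ?thesis using lev[of "2*n-k"] r by auto
    qed
  qed
  have down: "root_vec n i j \<in> p \<longleftrightarrow> (\<forall>k\<in>{j..<i}. k \<notin> K \<and> 2*n-k \<notin> K)"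
    if ij: "i \<in> {1..2*n}" "j \<in> {1..2*n}" "j < i" for i j
  proof
    assume r: "root_vec n i j \<in> p"
    show "\<forall>k\<in>{j..<i}. k \<notin> K \<and> 2*n-k \<notin> K"
    proof
      fix k assume k: "k \<in> {j..<i}"
      have "root_vec n (k+1) j \<in> p"
        using tr[of "k+1" i j] up[of "k+1" i] r ij k by (cases "k + 1 = i") auto
      then have "root_vec n (k+1) k \<in> p"
        using tr[of "k+1" j k] up[of j k] ij k by (cases "j = k") auto
      then show "k \<notin> K \<and> 2*n-k \<notin> K" using lev2[of k] k ij by auto
    qed
  next
    assume "\<forall>k\<in>{j..<i}. k \<notin> K \<and> 2*n-k \<notin> K"
    then show "root_vec n i j \<in> p" using ij(1,3)
    proof (induction i)
      case (Suc i)
      have "root_vec n (Suc i) i \<in> p" using lev2[of i] Suc.prems ij by auto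
      then show ?case using Suc.IH Suc.prems tr[of "Suc i" i j] ij by (cases "i = j") auto
    qed simp
  qed
  show ?thesis
  proof
    show "p \<subseteq> flag_stabilizer n K"
    proof
      fix X assume X: "X \<in> p"
      have "X i j = 0" if k: "k \<in> K" "j \<le> k" "k < i" for i j k
      proof (rule ccontr)
        assume x: "X i j \<noteq> 0"
        then have ij: "i \<in> {1..2*n}" "j \<in> {1..2*n}" using sp_range X p(2) by blast+
        have "root_vec n i j \<in> p" using root_component[OF p c X x] k by auto
        then show False using down[OF ij] k by auto
      qed
      then show "X \<in> flag_stabilizer n K" unfolding flag_stabilizer_def using X p(2) by blast
    qed
    show "flag_stabilizer n K \<subseteq> p"
    proof
      fix X :: "'k matrix" assume X: "X \<in> flag_stabilizer n K"
      then have sp: "X \<in> sp n" by (simp add: flag_stabilizer_def)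
      have rv: "mat_scale (X i j) (root_vec n i j) \<in> p" if ij: "i \<noteq> j" for i j
      proof (cases "X i j = 0")
        case True
        then have "mat_scale (X i j) (root_vec n i j) = 0" by (auto simp: mat_scale_def zero_fun_def)
        then show ?thesis using gl.subspace_0[OF sub] by (simp only:)
      next
        case False
        then have r: "i \<in> {1..2*n}" "j \<in> {1..2*n}" using sp_range[OF sp] by blast+
        have "root_vec n i j \<in> p"
        proof (cases "i < j")
          case True then show ?thesis using up r by blast
        next
          case lt: False
          have "k \<notin> K \<and> 2*n-k \<notin> K" if k: "k \<in> {j..<i}" for k
          proof
            show "k \<notin> K" using X False k unfolding flag_stabilizer_def by auto
            have "X (2*n+1-j) (2*n+1-i) \<noteq> 0" using False sp_reflect[OF sp r] by auto
            moreover have "2*n+1-i \<le> 2*n-k" "2*n-k < 2*n+1-j" using k r by auto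
            ultimately show "2*n-k \<notin> K" using X unfolding flag_stabilizer_def by blast
          qed
          then show ?thesis using down[OF r] lt ij by auto
        qed
        then show ?thesis using gl.subspace_scale[OF sub] by blast
      qed
      define D where "D = (\<lambda>r s. if r = s then X r s else 0)"
      have "D \<in> cartan n"
      proof -
        have "D \<in> square_mats (2*n)" using sp_range[OF sp] by (auto simp: D_def square_mats_def)
        moreover have "D i j = - (sg n i * sg n j * D (2*n+1-j) (2*n+1-i))"
          if ij: "i \<in> {1..2*n}" "j \<in> {1..2*n}" for i j
        proof (cases "i = j")
          case True then show ?thesis using sp_reflect[OF sp ij] by (simp add: D_def)
        next
          case False then have "2*n+1-j \<noteq> 2*n+1-i" using ij by auto
          then show ?thesis using False by (simp add: D_def)
        qed
        ultimately show ?thesis unfolding cartan_def sp_iff by (auto simp: D_def)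
      qed
      \<comment> \<open>Every off-diagonal entry of \<open>X\<close> is produced twice, once by its
        own position and once by the reflected one, whence the later division by 2.\<close>
      define S where "S = (\<Sum>(i,j)\<in>({1..2*n} \<times> {1..2*n}) - {(i,j). i = j}. mat_scale (X i j) (root_vec n i j))"
      have "S \<in> p" unfolding S_def
        by (rule gl.subspace_sum[OF sub]) (use rv in auto)
      have "X r s = D r s + S r s / 2" for r s
      proof -
        let ?I = "({1..2*n} \<times> {1..2*n}) - {(i,j). i = j}"
        have "S r s = (\<Sum>a\<in>?I. (if a = (r, s) then X r s else 0)
            - (if a = (2*n+1-s, 2*n+1-r) then sg n (2*n+1-s) * sg n (2*n+1-r) * X (2*n+1-s) (2*n+1-r) else 0))"
          unfolding S_def sum_matrix_apply
        proof (rule sum.cong[OF refl])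
          fix a assume "a \<in> ?I"
          then obtain i j where a: "a = (i, j)" "i \<in> {1..2*n}" "j \<in> {1..2*n}" by auto
          have e: "(r = 2*n+1-j \<and> s = 2*n+1-i) \<longleftrightarrow> (i = 2*n+1-s \<and> j = 2*n+1-r) \<and> r \<in> {1..2*n} \<and> s \<in> {1..2*n}"
            using a by auto
          have z: "X i j = 0" if "i = 2*n+1-s" "j = 2*n+1-r" "\<not> (r \<in> {1..2*n} \<and> s \<in> {1..2*n})"
            using a that by auto
          show "(case a of (i, j) \<Rightarrow> mat_scale (X i j) (root_vec n i j)) r s = (if a = (r, s) then X r s else 0)
            - (if a = (2*n+1-s, 2*n+1-r) then sg n (2*n+1-s) * sg n (2*n+1-r) * X (2*n+1-s) (2*n+1-r) else 0)"
          proof -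
            have t1: "X i j * (if r = i \<and> s = j then 1 else 0) = (if (i, j) = (r, s) then X r s else 0)" by auto
            have t2: "X i j * (sg n i * sg n j * (if (i = 2*n+1-s \<and> j = 2*n+1-r) \<and> r \<in> {1..2*n} \<and> s \<in> {1..2*n} then 1 else 0))
              = (if (i, j) = (2*n+1-s, 2*n+1-r) then sg n (2*n+1-s) * sg n (2*n+1-r) * X (2*n+1-s) (2*n+1-r) else 0)"
            proof (cases "i = 2*n+1-s \<and> j = 2*n+1-r")
              case True
              then have h: "2*n+1-s = i" "2*n+1-r = j" by auto
              show ?thesis unfolding h
                using z[OF h(1)[symmetric] h(2)[symmetric]] by (cases "r \<in> {1..2*n} \<and> s \<in> {1..2*n}") (simp_all only: if_True simp_thms prod.inject mult.commute, simp_all)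
            next
              case False
              then have "(i, j) \<noteq> (2*n+1-s, 2*n+1-r)" by simp
              then show ?thesis using False by (simp only: if_False simp_thms) simp
            qed
            show ?thesis
              unfolding a prod.case mat_scale_def root_vec_def e right_diff_distrib t1 t2 ..
          qed
        qed
        also have "\<dots> = (if (r, s) \<in> ?I then X r s else 0)
            - (if (2*n+1-s, 2*n+1-r) \<in> ?I then sg n (2*n+1-s) * sg n (2*n+1-r) * X (2*n+1-s) (2*n+1-r) else 0)"
          unfolding sum_subtractf by (subst (1 2) sum.delta) auto
        also have "\<dots> = (if r = s then 0 else 2 * X r s)"
        proof (cases "(r, s) \<in> ?I")
          case True
          then have rs: "r \<in> {1..2*n}" "s \<in> {1..2*n}" "r \<noteq> s" by auto
          then have "(2*n+1-s, 2*n+1-r) \<in> ?I" by auto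
          moreover have "sg n (2*n+1-s) * sg n (2*n+1-r) * X (2*n+1-s) (2*n+1-r) = - X r s"
            using sp_reflect[OF sp rs(1,2)] sg_reflect[OF rs(1), where 'a='k] sg_reflect[OF rs(2), where 'a='k]
            by (simp only: mult_minus_left mult_minus_right minus_minus mult.commute)
          ultimately show ?thesis using True rs by simp
        next
          case False
          then have h: "(2*n+1-s, 2*n+1-r) \<notin> ?I" "r = s \<or> X r s = 0" using sp_range[OF sp, of r s] by auto
          show ?thesis unfolding if_not_P[OF False] if_not_P[OF h(1)] using h(2) by auto
        qed
        finally show ?thesis by (simp add: D_def)
      qed
      then have "X = D + mat_scale (1/2) S" by (auto simp: fun_eq_iff mat_scale_def)
      then show "X \<in> p"
        using c \<open>D \<in> cartan n\<close> \<open>S \<in> p\<close> gl.subspace_add[OF sub] gl.subspace_scale[OF sub] by blast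
    qed
  qed
qed


lemma flag_stabilizer_parabolic:
  fixes K :: "nat set"
  assumes K: "K \<subseteq> {1..n}"
  shows "gl.lie_subalgebra (2*n) (flag_stabilizer n K :: 'k::field_char_0 matrix set)"
    "flag_stabilizer n K \<subseteq> (sp n :: 'k matrix set)"
    "{H + U | H U. H \<in> cartan n \<and> U \<in> u_plus n} \<subseteq> (flag_stabilizer n K :: 'k matrix set)"
    "{\<alpha> \<in> simple_roots n. \<not> root_space n (- \<alpha>) \<subseteq> (flag_stabilizer n K :: 'k matrix set)} = simple_root n ` K"
proof -
  show sa: "gl.lie_subalgebra (2*n) (flag_stabilizer n K :: 'k matrix set)" by (rule flag_stabilizer_subalgebra)
  show "flag_stabilizer n K \<subseteq> (sp n :: 'k matrix set)" unfolding flag_stabilizer_def by blast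
  have "H + U \<in> flag_stabilizer n K" if "H \<in> cartan n" "U \<in> u_plus n" for H U :: "'k matrix"
    using that gl.subspace_add[OF sp_subspace] unfolding flag_stabilizer_def cartan_def u_plus_def by auto
  then show "{H + U | H U. H \<in> cartan n \<and> U \<in> u_plus n} \<subseteq> (flag_stabilizer n K :: 'k matrix set)" by blast
  have sub: "gl.subspace (flag_stabilizer n K :: 'k matrix set)" using sa unfolding gl.lie_subalgebra_def by blast
  have "root_space n (- simple_root n k) \<subseteq> (flag_stabilizer n K :: 'k matrix set) \<longleftrightarrow> k \<notin> K" if "k \<in> {1..n}" for k
    using root_space_subset_iff[OF that sub] flag_stabilizer_root_vec[OF K that] by blast
  then show "{\<alpha> \<in> simple_roots n. \<not> root_space n (- \<alpha>) \<subseteq> (flag_stabilizer n K :: 'k matrix set)} = simple_root n ` K"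
    using K unfolding simple_roots_def by blast
qed

lemma parabolic_plus_eq:
  assumes "K \<subseteq> {1..n}"
  shows "parabolic_plus n (simple_root n ` K) = (flag_stabilizer n K :: 'k::field_char_0 matrix set)"
  unfolding parabolic_plus_def
proof (rule the_equality)
  fix p :: "'k matrix set"
  assume "gl.lie_subalgebra (2 * n) p \<and> p \<subseteq> sp n \<and> {H + U | H U. H \<in> cartan n \<and> U \<in> u_plus n} \<subseteq> p \<and>
     {\<alpha> \<in> simple_roots n. \<not> root_space n (- \<alpha>) \<subseteq> p} = simple_root n ` K"
  then show "p = flag_stabilizer n K" by (elim conjE) (rule parabolic_unique[OF assms])
qed (intro conjI flag_stabilizer_parabolic[OF assms])

section \<open>Transposition and the opposite parabolic subalgebras\<close>

definition mtr :: "'k matrix \<Rightarrow> 'k matrix" where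
  "mtr X = (\<lambda>i j. X j i)"

lemma mtr_mtr [simp]: "mtr (mtr X) = X"
  by (simp add: mtr_def)

lemma mtr_image_iff: "X \<in> mtr ` S \<longleftrightarrow> mtr X \<in> S"
  by (metis imageE imageI mtr_mtr)

lemma mtr_add: "mtr (X + Y) = mtr X + mtr (Y :: 'k::field matrix)"
  and mtr_scale: "mtr (mat_scale c X) = mat_scale c (mtr X)"
  and mtr_0: "mtr 0 = (0 :: 'k::field matrix)"
  by (auto simp: mtr_def mat_scale_def fun_eq_iff)

lemma mtr_commutator: "mtr (commutator N X Y) = commutator N (mtr Y) (mtr X)"
  by (auto simp: mtr_def commutator_def mat_mult_def fun_eq_iff mult.commute)

lemma mtr_sp: "mtr X \<in> sp n \<longleftrightarrow> X \<in> sp n"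
proof -
  have "mtr X \<in> sp n" if X: "X \<in> sp n" for X :: "'a matrix"
  proof -
    have "mtr X \<in> square_mats (2*n)" using sp_range[OF X] by (auto simp: mtr_def square_mats_def)
    moreover have "mtr X i j = - (sg n i * sg n j * mtr X (2*n+1-j) (2*n+1-i))"
      if "i \<in> {1..2*n}" "j \<in> {1..2*n}" for i j
      using sp_reflect[OF X that(2,1)] by (simp add: mtr_def mult.commute)
    ultimately show ?thesis unfolding sp_iff by blast
  qed
  then show ?thesis by (metis mtr_mtr)
qed

lemma mtr_cartan: "mtr H \<in> cartan n \<longleftrightarrow> H \<in> cartan n"
  unfolding cartan_def using mtr_sp[of H n] by (auto simp: mtr_def)

lemma mtr_cartan_eq: "H \<in> cartan n \<Longrightarrow> mtr H = H"
proof (intro ext)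
  fix i j
  assume "H \<in> cartan n"
  then show "mtr H i j = H i j" by (cases "i = j") (auto simp: cartan_def mtr_def)
qed

lemma mtr_u_minus: "mtr U \<in> u_plus n \<longleftrightarrow> U \<in> u_minus n"
  unfolding u_plus_def u_minus_def using mtr_sp[of U n] by (auto simp: mtr_def)

lemma mtr_root_space:
  "mtr X \<in> root_space n (- \<alpha>) \<longleftrightarrow> X \<in> root_space n \<alpha>"
proof -
  have *: "commutator (2*n) H (mtr X) = mat_scale ((- \<alpha>) H) (mtr X) \<longleftrightarrow> commutator (2*n) H X = mat_scale (\<alpha> H) X"
    if "H \<in> cartan n" for H
  proof -
    have "commutator (2*n) H (mtr X) = mtr (commutator (2*n) X H)"
      using mtr_cartan_eq[OF that] by (simp add: mtr_commutator)
    also have "\<dots> = mtr (- commutator (2*n) H X)" by (simp add: commutator_def)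
    finally have e: "commutator (2*n) H (mtr X) = mtr (- commutator (2*n) H X)" .
    have e': "mat_scale ((- \<alpha>) H) (mtr X) = mtr (mat_scale (- \<alpha> H) X)" by (simp add: mtr_def mat_scale_def)
    have "commutator (2*n) H (mtr X) = mat_scale ((- \<alpha>) H) (mtr X) \<longleftrightarrow>
      mtr (- commutator (2*n) H X) = mtr (mat_scale (- \<alpha> H) X)" unfolding e e' ..
    also have "\<dots> \<longleftrightarrow> - commutator (2*n) H X = mat_scale (- \<alpha> H) X" by (metis mtr_mtr)
    also have "\<dots> \<longleftrightarrow> commutator (2*n) H X = mat_scale (\<alpha> H) X"
      by (auto simp: fun_eq_iff mat_scale_def)
    finally show ?thesis .
  qed
  show ?thesis unfolding root_space_def using * mtr_sp[of X n] by blast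
qed

lemma mtr_subalgebra: "gl.lie_subalgebra N (mtr ` p) \<longleftrightarrow> gl.lie_subalgebra N p"
proof -
  have "gl.lie_subalgebra N (mtr ` p)" if "gl.lie_subalgebra N p" for p :: "'a matrix set"
    using that unfolding gl.lie_subalgebra_def gl.subspace_def
    by (auto simp: mtr_image_iff mtr_add mtr_scale mtr_0 mtr_commutator)
  moreover have "mtr ` mtr ` p = p" by (auto simp: image_image)
  ultimately show ?thesis by metis
qed

text \<open>Transposition reverses brackets, fixes the Cartan subalgebra, and exchanges
  \<open>u_plus\<close> with \<open>u_minus\<close> and each root space with its opposite. It thus
  turns the defining conditions into those of \<open>parabolic_plus\<close>, and uniqueness carries
  over.\<close>

lemma parabolic_minus_eq:
  assumes "K \<subseteq> {1..n}"
  shows "parabolic_minus n (simple_root n ` K) = mtr ` (flag_stabilizer n K :: 'k::field_char_0 matrix set)"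
proof -
  have c: "(gl.lie_subalgebra (2 * n) p \<and> p \<subseteq> sp n \<and> {H + U | H U. H \<in> cartan n \<and> U \<in> u_minus n} \<subseteq> p \<and>
     {\<alpha> \<in> simple_roots n. \<not> root_space n \<alpha> \<subseteq> p} = simple_root n ` K) \<longleftrightarrow>
    (gl.lie_subalgebra (2 * n) (mtr ` p) \<and> mtr ` p \<subseteq> sp n \<and> {H + U | H U. H \<in> cartan n \<and> U \<in> u_plus n} \<subseteq> mtr ` p \<and>
     {\<alpha> \<in> simple_roots n. \<not> root_space n (- \<alpha>) \<subseteq> mtr ` p} = simple_root n ` K)" for p :: "'k matrix set"
  proof -
    have "{H + U | H U. H \<in> cartan n \<and> U \<in> u_minus n} \<subseteq> p \<longleftrightarrow>
      {H + U | H U. H \<in> cartan n \<and> U \<in> u_plus n} \<subseteq> mtr ` p" (is "?a \<longleftrightarrow> ?b")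
    proof
      assume a: ?a
      have "H + U \<in> mtr ` p" if "H \<in> cartan n" "U \<in> u_plus n" for H U :: "'k matrix"
        unfolding mtr_image_iff mtr_add using a that mtr_cartan[of H n] mtr_u_minus[of "mtr U" n] by auto
      then show ?b by blast
    next
      assume b: ?b
      have "H + U \<in> p" if "H \<in> cartan n" "U \<in> u_minus n" for H U :: "'k matrix"
      proof -
        have "mtr (H + U) \<in> mtr ` p"
          unfolding mtr_add using b that mtr_cartan[of H n] mtr_u_minus[of U n] by auto
        then show ?thesis by (simp only: mtr_image_iff mtr_mtr)
      qed
      then show ?a by blast
    qed
    moreover have "root_space n \<alpha> \<subseteq> p \<longleftrightarrow> root_space n (- \<alpha>) \<subseteq> mtr ` p" for \<alpha> :: "'k matrix \<Rightarrow> 'k"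
      using mtr_root_space[where 'a='k] mtr_image_iff by (smt (verit) mtr_mtr subset_iff)
    moreover have "p \<subseteq> sp n \<longleftrightarrow> mtr ` p \<subseteq> sp n" using mtr_sp by auto
    ultimately show ?thesis unfolding mtr_subalgebra by simp
  qed
  have u: "mtr ` p = flag_stabilizer n K \<longleftrightarrow> p = mtr ` flag_stabilizer n K" for p :: "'k matrix set"
  proof -
    have mm: "mtr ` mtr ` q = q" for q :: "'k matrix set" by (simp add: image_image)
    show ?thesis using mm[of p] mm[of "flag_stabilizer n K"] by auto
  qed
  show ?thesis
    unfolding parabolic_minus_def
  proof (rule the_equality)
    show "gl.lie_subalgebra (2 * n) (mtr ` (flag_stabilizer n K :: 'k matrix set)) \<and> mtr ` (flag_stabilizer n K :: 'k matrix set) \<subseteq> sp n \<and>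
      {H + U | H U. H \<in> cartan n \<and> U \<in> u_minus n} \<subseteq> mtr ` (flag_stabilizer n K :: 'k matrix set) \<and>
      {\<alpha> \<in> simple_roots n. \<not> root_space n \<alpha> \<subseteq> mtr ` (flag_stabilizer n K :: 'k matrix set)} = simple_root n ` K"
      unfolding c using flag_stabilizer_parabolic[OF assms, where 'k='k] by (simp add: image_image)
  next
    fix p :: "'k matrix set"
    assume "gl.lie_subalgebra (2 * n) p \<and> p \<subseteq> sp n \<and> {H + U | H U. H \<in> cartan n \<and> U \<in> u_minus n} \<subseteq> p \<and>
     {\<alpha> \<in> simple_roots n. \<not> root_space n \<alpha> \<subseteq> p} = simple_root n ` K"
    then have "mtr ` p = flag_stabilizer n K"
      unfolding c by (elim conjE) (rule parabolic_unique[OF assms])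
    then show "p = mtr ` flag_stabilizer n K" unfolding u .
  qed
qed

lemma seaweed_two_one:
  assumes "a > 0" "b > 0" "c > 0" "a + b = n" "c \<le> n"
  shows "(seaweed n [a, b] [c] :: 'k::field_char_0 matrix set) =
    {X \<in> sp n. \<forall>i j. (j \<le> a \<and> a < i \<or> j \<le> n \<and> n < i \<or> i \<le> c \<and> c < j) \<longrightarrow> X i j = 0}"
proof -
  have "roots_of_string n [a, b] = (simple_root n ` {a, n} :: ('k matrix \<Rightarrow> 'k) set)"
  proof -
    have "{k. 1 \<le> k \<and> k \<le> length [a, b]} = {1, 2}" by auto
    then have "roots_of_string n [a, b] = ((\<lambda>k. simple_root n (sum_list (take k [a, b]))) ` {1, 2} :: ('k matrix \<Rightarrow> 'k) set)"
      unfolding roots_of_string_def by blast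
    then show ?thesis using assms by (auto simp: numeral_2_eq_2)
  qed
  moreover have "roots_of_string n [c] = (simple_root n ` {c} :: ('k matrix \<Rightarrow> 'k) set)"
  proof -
    have "{k. 1 \<le> k \<and> k \<le> length [c]} = {1}" by auto
    then have "roots_of_string n [c] = ((\<lambda>k. simple_root n (sum_list (take k [c]))) ` {1} :: ('k matrix \<Rightarrow> 'k) set)"
      unfolding roots_of_string_def by blast
    then show ?thesis by auto
  qed
  ultimately have "(seaweed n [a, b] [c] :: 'k matrix set) = flag_stabilizer n {a, n} \<inter> mtr ` flag_stabilizer n {c}"
    unfolding seaweed_def seaweed_roots_def
    using parabolic_plus_eq[of "{a, n}" n, where 'k='k] parabolic_minus_eq[of "{c}" n, where 'k='k] assms by simp
  also have "\<dots> = {X \<in> sp n. \<forall>i j. (j \<le> a \<and> a < i \<or> j \<le> n \<and> n < i \<or> i \<le> c \<and> c < j) \<longrightarrow> X i j = 0}"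
    by (auto simp: flag_stabilizer_def mtr_image_iff mtr_sp) (auto simp: mtr_def)
  finally show ?thesis .
qed

section \<open>The seaweed subalgebra and its dual\<close>

text \<open>The data must consist of inclusions with \<open>F1 = F3 = 0\<close>. If
  \<open>a \<le> c\<close> the two coordinate subspaces are disjoint and a single splitting step is
  reversed. If \<open>a > c\<close> they overlap in \<open>c+1..a\<close>; then a splitting inside
  \<open>1..a\<close> is reversed first and \<open>a+1..n\<close> is added by the orthogonal
  step.\<close>

lemma reg_inclusions_exists:
  fixes a c n :: nat
  assumes "0 < a" "a < n" "0 < c" "c \<le> n" and N: "num_cond a n (n - c)"
  shows "\<exists>F G. reg (dg {1..a}) (dg {1..n}) (dg {c+1..n}) (dg {1..a}) (dg {c+1..n}) G 0 F (0 :: 'k::field_char_0 fin_mat)"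
proof -
  have t: "0 < n - c" using N assms unfolding num_cond_def by auto
  show ?thesis
  proof (cases "a \<le> c")
    case True
    have "num_cond a (c - a) (n - c)" using num_cond_split[OF t, of a "c - a"] N True assms by simp
    then have "regular_on (dg {1..a}) (dg {a+1..c}) (dg {c+1..n} :: 'k fin_mat)"
      by (subst regular_on_iff) (auto simp: tr_dg of_nat_diff)
    then obtain \<phi> \<psi> G F1 F2 F3 where R: "reg (dg {1..a}) (dg {a+1..c}) (dg {c+1..n} :: 'k fin_mat) \<phi> \<psi> G F1 F2 F3"
      unfolding regular_on_def by blast
    have "dg {1..a} + dg {c+1..n} + dg {a+1..c} = (dg {1..n} :: 'k fin_mat)"
      using True assms by (intro fin_mat_eqI) auto
    then show ?thesis
      using reg_inclusions[OF R] True by (fastforce intro!: dg_disjoint)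
  next
    case False
    then have N': "n - a \<le> 1" "num_cond 0 a (a - c)"
      using num_cond_orthogonal[OF t, of a n] N assms by (simp_all add: algebra_simps)
    have "num_cond 0 c (a - c)" using num_cond_split[of "a - c" 0 c] N' False by simp
    then have "regular_on 0 (dg {1..c}) (dg {c+1..a} :: 'k fin_mat)"
      using False by (subst regular_on_iff) (auto simp: tr_dg of_nat_diff)
    then obtain \<phi> \<psi> G F1 F2 F3 where R: "reg 0 (dg {1..c}) (dg {c+1..a} :: 'k fin_mat) \<phi> \<psi> G F1 F2 F3"
      unfolding regular_on_def by blast
    have s: "0 + dg {c+1..a} + dg {1..c} = (dg {1..a} :: 'k fin_mat)"
      "dg {1..a} + dg {a+1..n} = (dg {1..n} :: 'k fin_mat)"
      "dg {c+1..a} + dg {a+1..n} = (dg {c+1..n} :: 'k fin_mat)"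
      using False assms by (intro fin_mat_eqI; auto)+
    have "reg 0 (dg {1..a}) (dg {c+1..a}) 0 (dg {c+1..a}) G 0 (\<phi> + \<psi> + F2 + F1 + F3) 0"
      using reg_inclusions[OF R] unfolding s by (auto simp: dg_disjoint)
    from reg_orthogonal_inclusions[OF this, of "dg {a+1..n}" "n - a"] N'(1)
    show ?thesis unfolding s using assms by (auto simp: dg_disjoint tr_dg)
  qed
qed

definition allowed :: "nat \<Rightarrow> nat \<Rightarrow> nat \<Rightarrow> (nat \<times> nat) set" where
  "allowed n a c = {(i,j). i \<in> {1..n} \<and> j \<in> {1..n} \<and> \<not> (j \<le> a \<and> a < i) \<and> \<not> (i \<le> c \<and> c < j)}"

definition gl_part :: "nat \<Rightarrow> nat \<Rightarrow> nat \<Rightarrow> 'k::field fin_mat set" where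
  "gl_part n a c = {A. \<forall>i j. entry A i j \<noteq> 0 \<longrightarrow> (i, j) \<in> allowed n a c}"

definition sym_part :: "nat \<Rightarrow> nat \<Rightarrow> 'k::field fin_mat set" where
  "sym_part n c = {B. tp B = B \<and> (\<forall>i j. entry B i j \<noteq> 0 \<longrightarrow> i \<in> {c+1..n} \<and> j \<in> {c+1..n})}"

text \<open>The first equation is orthogonality of the bracket to symmetric \<open>B'\<close>, the
  second to \<open>A'\<close> in \<open>gl_part\<close>; the indices are swapped because functionals
  are trace pairings. \<open>B * G\<close> occurs twice because the two terms in the bracket of
  \<open>A'\<close> with \<open>B\<close> have the same trace against \<open>G\<close>.\<close>

definition nondeg :: "nat \<Rightarrow> nat \<Rightarrow> nat \<Rightarrow> 'k::field fin_mat \<Rightarrow> 'k fin_mat \<Rightarrow> bool" where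
  "nondeg n a c F G \<longleftrightarrow> (\<forall>A\<in>gl_part n a c. \<forall>B\<in>sym_part n c.
     dg {c+1..n} * (G * A + tp A * G) * dg {c+1..n} = 0 \<and>
     (\<forall>(i,j)\<in>allowed n a c. entry (F * A - A * F - (B * G + B * G)) j i = 0) \<longrightarrow> A = 0 \<and> B = 0)"

lemma hom_dg_iff:
  "finite I \<Longrightarrow> finite J \<Longrightarrow> A \<in> hom (dg I) (dg J) \<longleftrightarrow> (\<forall>i j. entry A i j \<noteq> 0 \<longrightarrow> i \<in> J \<and> j \<in> I)"
  unfolding hom_def by (auto simp: entry_dg_times entry_times_dg dest!: arg_cong[where f = entry] 
      intro!: fin_mat_eqI) (metis entry_dg_times entry_times_dg)+

lemma ex_scaled: "\<exists>Y. \<forall>i j. entry Y i j = c * entry X i j"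
proof -
  obtain N where "\<forall>i j. entry X i j \<noteq> 0 \<longrightarrow> i < N \<and> j < N" using entry_bound by blast
  then have "entry (mk_mat (\<lambda>i j. c * entry X i j)) = (\<lambda>i j. c * entry X i j)"
    by (intro entry_mk[of "{..<N}"]) auto
  then show ?thesis by metis
qed

text \<open>A kernel element \<open>(A, B)\<close> corresponds to a solution: \<open>A1\<close>,
  \<open>A3\<close> are the restrictions of \<open>A\<close> to \<open>u\<close> and
  \<open>w\<close>, while \<open>p\<close>, \<open>q\<close> collect what functionals on
  \<open>gl_part\<close> cannot see. The matrix \<open>B\<close> is recovered from
  \<open>q * w\<close>. Invertibility of \<open>G\<close> on \<open>w\<close>, demanded by
  \<open>reg\<close>, has to be deduced from \<open>nondeg\<close>.\<close>

lemma reg_iff_nondeg: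
  assumes "a < n" "c \<le> n"
  shows "(\<exists>F G. reg (dg {1..a}) (dg {1..n}) (dg {c+1..n}) (dg {1..a}) (dg {c+1..n}) G 0 F (0 :: 'k::field_char_0 fin_mat)) \<longleftrightarrow>
    (\<exists>F G. F \<in> hom (dg {1..n}) (dg {1..n}) \<and> G \<in> hom (dg {c+1..n}) (dg {c+1..n}) \<and> tp G = G \<and> nondeg n a c F (G :: 'k fin_mat))"
proof -
  define u m w :: "'k fin_mat" where "u = dg {1..a}" and "m = dg {1..n}" and "w = dg {c+1..n}"
  have id: "u * u = u" "m * m = m" "w * w = w" "m * u = u" "u * m = u" "m * w = w" "w * m = w"
    "tp u = u" "tp m = m" "tp w = w"
    using assms by (auto simp: u_def m_def w_def dg_times_dg intro!: arg_cong[of _ _ dg])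
  note ids = id id(1-7)[THEN mult_eq_ext]
  have e: "entry (u * X) i j = (if i \<in> {1..a} then entry X i j else 0)" "entry (X * u) i j = (if j \<in> {1..a} then entry X i j else 0)"
    "entry (m * X) i j = (if i \<in> {1..n} then entry X i j else 0)" "entry (X * m) i j = (if j \<in> {1..n} then entry X i j else 0)"
    "entry (w * X) i j = (if i \<in> {c+1..n} then entry X i j else 0)" "entry (X * w) i j = (if j \<in> {c+1..n} then entry X i j else 0)"
    for X :: "'k fin_mat" and i j
    by (simp_all only: u_def m_def w_def entry_dg_times entry_times_dg finite_atLeastAtMost)
  have glp: "A \<in> gl_part n a c \<longleftrightarrow> A \<in> hom m m \<and> A * u = u * (A * u) \<and> A * w = w * (A * w)" for A :: "'k fin_mat"
  proof
    assume A: "A \<in> gl_part n a c"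
    have z: "entry A i j = 0" if "(i, j) \<notin> allowed n a c" for i j
      using A that unfolding gl_part_def by blast
    show "A \<in> hom m m \<and> A * u = u * (A * u) \<and> A * w = w * (A * w)"
    proof (intro conjI)
      show "A \<in> hom m m" using A by (auto simp: m_def hom_dg_iff gl_part_def allowed_def)
      have "entry (A * u) i j = entry (u * (A * u)) i j" for i j
        using z[of i j] assms by (auto simp: e allowed_def)
      then show "A * u = u * (A * u)" by (rule fin_mat_eqI)
      have "entry (A * w) i j = entry (w * (A * w)) i j" for i j
        using z[of i j] assms by (auto simp: e allowed_def)
      then show "A * w = w * (A * w)" by (rule fin_mat_eqI)
    qed
  next
    assume A: "A \<in> hom m m \<and> A * u = u * (A * u) \<and> A * w = w * (A * w)"
    have "(i, j) \<in> allowed n a c" if "entry A i j \<noteq> 0" for i j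
    proof -
      have "i \<in> {1..n} \<and> j \<in> {1..n}" using A that unfolding m_def by (auto simp: hom_dg_iff)
      moreover have "entry (A * u) i j = entry (u * (A * u)) i j" "entry (A * w) i j = entry (w * (A * w)) i j"
        using A by auto
      ultimately show ?thesis using that assms by (auto simp: e allowed_def split: if_splits)
    qed
    then show "A \<in> gl_part n a c" unfolding gl_part_def by blast
  qed
  have hw: "i \<in> {c+1..n} \<and> j \<in> {c+1..n}" if "A \<in> hom w w" "entry A i j \<noteq> 0" for A i j
    using that unfolding w_def by (simp add: hom_dg_iff)
  have sp: "B \<in> sym_part n c \<longleftrightarrow> B \<in> hom w w \<and> tp B = B" for B :: "'k fin_mat"
    unfolding sym_part_def w_def by (auto simp: hom_dg_iff)
  \<comment> \<open>Orthogonality to \<open>gl_part\<close> for the trace form, on the left, means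
    being a map into \<open>u\<close> that kills \<open>u\<close> plus a map into \<open>w\<close>
    that kills \<open>w\<close>.\<close>
  have off: "(\<forall>(i,j)\<in>allowed n a c. entry Y j i = 0) \<longleftrightarrow> Y = u * Y * (m - u) + w * Y * (m - w)"
    if "Y \<in> hom m m" for Y :: "'k fin_mat"
  proof -
    have Y0: "entry Y i j = 0" if "\<not> (i \<in> {1..n} \<and> j \<in> {1..n})" for i j
      using \<open>Y \<in> hom m m\<close> that unfolding m_def by (auto simp: hom_dg_iff)
    have ent: "entry (u * Y * (m - u) + w * Y * (m - w)) j i =
      (if j \<le> a \<and> a < i \<or> i \<le> c \<and> c < j then entry Y j i else 0)" for i j
      using Y0[of j i] assms by (auto simp: right_diff_distrib e)
    show ?thesis
    proof
      assume h: "\<forall>(i,j)\<in>allowed n a c. entry Y j i = 0"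
      show "Y = u * Y * (m - u) + w * Y * (m - w)"
      proof (rule fin_mat_eqI)
        fix j i
        show "entry Y j i = entry (u * Y * (m - u) + w * Y * (m - w)) j i"
          unfolding ent using h Y0[of j i] by (auto simp: allowed_def)
      qed
    next
      assume "Y = u * Y * (m - u) + w * Y * (m - w)"
      then have Y: "entry Y j i = (if j \<le> a \<and> a < i \<or> i \<le> c \<and> c < j then entry Y j i else 0)" for i j
        using ent by metis
      show "\<forall>(i,j)\<in>allowed n a c. entry Y j i = 0"
      proof clarify
        fix i j assume "(i, j) \<in> allowed n a c"
        then show "entry Y j i = 0" using Y[of j i] unfolding allowed_def by (auto split: if_splits)
      qed
    qed
  qed
  \<comment> \<open>Either \<open>a \<le> c\<close>, and the images of \<open>u\<close> and
    \<open>w\<close> meet in 0, or \<open>a > c\<close>, and together they span the image of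
    \<open>m\<close>.\<close>
  have disj: "x = 0" if "x \<in> hom m u" "x \<in> hom m w" "x * u = 0" "x * w = 0" for x :: "'k fin_mat"
  proof (rule fin_mat_eqI)
    fix i j
    have "entry (u * x) i j = entry x i j" "entry (w * x) i j = entry x i j" "entry (x * m) i j = entry x i j"
      using that by (auto simp: hom_def)
    moreover have "entry (x * u) i j = 0" "entry (x * w) i j = 0" using that by auto
    ultimately show "entry x i j = entry 0 i j" by (auto simp: e split: if_splits)
  qed
  show ?thesis unfolding u_def[symmetric] m_def[symmetric] w_def[symmetric]
  proof (intro iffI; elim exE)
    fix F G
    assume R: "reg u m w u w G 0 F 0"
    then obtain H where form: "form_on w G H" and F: "F \<in> hom m m" unfolding reg_def by blast
    have G: "G \<in> hom w w" "tp G = G" and H: "H \<in> hom w w" and GH: "H * G = w" "G * H = w"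
      using form unfolding form_on_def id by auto
    have "nondeg n a c F G"
      unfolding nondeg_def w_def[symmetric]
    proof (intro ballI impI, elim conjE)
      fix A B
      define Y where "Y = F * A - A * F - (B * G + B * G)"
      assume A': "A \<in> gl_part n a c" and B': "B \<in> sym_part n c" and s: "w * (G * A + tp A * G) * w = 0"
        and y: "\<forall>(i,j)\<in>allowed n a c. entry (F * A - A * F - (B * G + B * G)) j i = 0"
      have A: "A \<in> hom m m" "A * u = u * (A * u)" "A * w = w * (A * w)" using A' glp by auto
      have B: "B \<in> hom w w" "tp B = B" using B' sp by auto
      note ho = A(1) B(1) F G(1)
      note hs = ho[THEN hom_simps(1)] ho[THEN hom_simps(2)] ho[THEN hom_simps(3)] ho[THEN hom_simps(4)]
      have mG: "m * B = B" "G * m = G" using hs id by (metis mult.assoc)+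
      have Ym: "Y \<in> hom m m" unfolding Y_def
        by (rule homI) (simp_all add: algebra_simps hs mG mult_eq_ext[OF mG(1)])
      \<comment> \<open>Minus the two pieces of \<open>Y\<close>. The extra term in \<open>q\<close>
        gives \<open>q * w = - (B * G + B * G)\<close>, which turns the symmetry of \<open>B\<close>
        into that of \<open>G * (q * w)\<close>.\<close>
      define p where "p = - (u * Y * (m - u))"
      define q where "q = - (w * Y * (m - w)) - (B * G + B * G)"
      have h: "u * (A * u) \<in> hom u u" "w * (A * w) \<in> hom w w" "p \<in> hom m u" "q \<in> hom m w"
        unfolding p_def q_def by (auto intro!: homI simp: algebra_simps ids hs mG)
      have YY: "Y = u * Y * (m - u) + w * Y * (m - w)" using off[OF Ym] y by (simp add: Y_def)
      have sum: "F * A - A * F + u * p + w * q = 0"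
      proof -
        have "u * p = p" "w * q = q" using h by (auto simp: hom_def)
        moreover have "p + q = - Y - (B * G + B * G)" 
          by (subst YY) (simp add: p_def q_def)
        ultimately show ?thesis by (simp add: Y_def algebra_simps)
      qed
      have qw: "q * w = - (B * G + B * G)" "p * u = 0"
        by (simp_all add: q_def p_def algebra_simps ids hs)
      have "tp (G * (q * w)) = G * (q * w)" unfolding qw by (simp add: algebra_simps G B)
      then have qsym: "w * (tp q * G) = G * (q * w)" by (simp add: id G mult.assoc)
      have sk: "tp (G * (w * (A * w))) = - (G * (w * (A * w)))"
      proof -
        have wG: "w * (G * x) = G * x" "G * (w * x) = G * x" for x using hs by auto
        have "G * (A * w) + w * (tp A * (G * w)) = 0" using s by (simp add: algebra_simps hs)
        then have "w * (tp A * G) = - (G * (A * w))" using hs by (simp add: eq_neg_iff_add_eq_0 add.commute)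
        then show ?thesis by (simp add: wG G id mult.assoc hs)
      qed
      have "sol u m w u w G 0 F 0 (u * (A * u)) A (w * (A * w)) p q"
        unfolding sol_def using A h sum qw sk 
        by (auto simp: ids algebra_simps G B qsym)
      then have z: "A = 0" "q = 0" using R unfolding reg_def by blast+
      then have "B * G = - (B * G)" using qw(1) by simp
      then have "B * G = 0" by (rule fin_mat_self_neg)
      then have "B * G * H = 0" by simp
      then have "B = 0" using GH hs by (simp add: mult.assoc)
      then show "A = 0 \<and> B = 0" using z by blast
    qed
    then show "\<exists>F G. F \<in> hom m m \<and> G \<in> hom w w \<and> tp G = G \<and> nondeg n a c F G" using F G by blast
  next
    fix F G
    assume "F \<in> hom m m \<and> G \<in> hom w w \<and> tp G = G \<and> nondeg n a c F G"
    then have F: "F \<in> hom m m" and G: "G \<in> hom w w" "tp G = G" and nd: "nondeg n a c F G" by auto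
    have nd': "A = 0 \<and> B = 0"
      if "A \<in> gl_part n a c" "B \<in> sym_part n c" "w * (G * A + tp A * G) * w = 0"
        "\<forall>(i,j)\<in>allowed n a c. entry (F * A - A * F - (B * G + B * G)) j i = 0" for A B
      using nd that unfolding nondeg_def w_def by blast
    have idw: "idem w" "idem u" "idem m" using id by (auto simp: idem_def)
    obtain K where K: "K \<in> hom w w" "G * (K * G) = G" using quasi_inverse[OF G(1) idw(1,1)] by blast
    note hs = hom_simps[OF G(1)] hom_simps[OF K(1)]
    have KG: "K * G = w"
    proof (rule ccontr)
      assume "K * G \<noteq> w"
      define k where "k = w - K * G"
      have k: "k \<in> hom w w" "k \<noteq> 0" "G * k = 0"
        using \<open>K * G \<noteq> w\<close> by (auto intro!: homI simp: k_def algebra_simps ids hs K)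
      then obtain i j where ij: "entry k i j \<noteq> 0" using fin_mat_nonzero by blast
      \<comment> \<open>A column of \<open>k\<close> times its own transpose: a symmetric matrix
        with \<open>B * G = 0\<close>, so that \<open>(0, B)\<close> would lie in the
        kernel.\<close>
      define B where "B = k * (single j j 1 * tp k)"
      have "tp k \<in> hom w w" using hom_tp[OF k(1)] by (simp add: id)
      then have B: "B \<in> sym_part n c"
        unfolding sp B_def by (auto intro!: homI simp: mult.assoc hom_simps[OF k(1)] hom_simps[of "tp k" w w])
      have "tp k * G = 0" using arg_cong[OF k(3), of tp] G by simp
      then have "B * G = 0" by (simp add: B_def mult.assoc)
      then have "B = 0"
        using nd'[OF _ B, of 0] glp[of 0] by (simp add: hom_zero case_prod_beta)
      moreover have "entry B i i = entry k i j * entry k i j"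
        unfolding B_def by (subst entry_times[of "{j}"]) (auto simp: entry_single_times split: if_splits)
      ultimately show False using ij by simp
    qed
    have tK: "tp K \<in> hom w w" using hom_tp[OF K(1)] by (simp add: id)
    have GK: "G * tp K = w" using arg_cong[OF KG, of tp] by (simp add: G id)
    have "K * (G * tp K) = tp K" using KG hom_simps[OF tK] by (simp flip: mult.assoc)
    then have "K = tp K" unfolding GK using hs by simp
    then have form: "form_on w G K" using G K KG GK by (auto simp: form_on_def id)
    have "A1 = 0 \<and> A2 = 0 \<and> A3 = 0 \<and> p = 0 \<and> q = 0" if "sol u m w u w G 0 F 0 A1 A2 A3 p q" for A1 A2 A3 p q
    proof -
      note S = that[unfolded sol_def]
      have A: "A1 \<in> hom u u" "A2 \<in> hom m m" "A3 \<in> hom w w" "p \<in> hom m u" "q \<in> hom m w" using S by auto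
      note As = A[THEN hom_simps(1)] A[THEN hom_simps(2)] A[THEN hom_simps(3)] A[THEN hom_simps(4)]
      have E: "A2 * u = A1" "A2 * w = A3" "p * u = 0" "tp (G * A3) = - (G * A3)"
        and main: "F * A2 - A2 * F + p + q = 0" and sq: "tp (q * w) * G = G * (q * w)"
        using S by (auto simp: As G)
      let ?X = "q * (w * K)"
      have X: "?X \<in> hom w w" by (rule homI) (simp_all add: mult.assoc As hs)
      have Xs: "tp ?X = ?X"
      proof -
        have "tp (w * q) = tp q" by (simp only: As)
        then have "tp q * w = tp q" by (simp add: id)
        then have tq: "tp (q * w) * w = tp (q * w)" by (simp add: id mult.assoc)
        have "K * (tp (q * w) * G) * K = K * (G * (q * w)) * K" using sq by simp
        then have "K * (tp (q * w) * (G * K)) = w * (q * w) * K" using KG by (simp add: mult.assoc mult_eq_ext[OF KG])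
        moreover have "G * K = w" using GK \<open>K = tp K\<close> by simp
        ultimately have "K * tp (q * w) = w * (q * w) * K" using tq by simp
        then show ?thesis using \<open>K = tp K\<close>[symmetric] by (simp add: mult.assoc As id)
      qed
      \<comment> \<open>This solves \<open>q * w = - (B * G + B * G)\<close> for \<open>B\<close>,
        with \<open>K\<close> the inverse of \<open>G\<close> on \<open>w\<close>.\<close>
      obtain B where Be: "\<And>i j. entry B i j = (- 1 / 2) * entry ?X i j" using ex_scaled by blast
      have BB: "B + B = - ?X" by (rule fin_mat_eqI) (simp add: Be)
      have B: "B \<in> sym_part n c"
        unfolding sym_part_def
      proof (intro CollectI conjI allI impI)
        show "tp B = B" using Xs by (intro fin_mat_eqI) (metis Be entry_tp)
        fix i j assume "entry B i j \<noteq> 0"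
        then have "entry ?X i j \<noteq> 0" by (auto simp: Be)
        then show "i \<in> {c+1..n}" "j \<in> {c+1..n}"
          using hw[OF X] by blast+
      qed
      have A2: "A2 \<in> gl_part n a c" unfolding glp using A E As by auto
      have "B * G + B * G = - (?X * G)" using BB by (metis distrib_right mult_minus_left)
      then have BG: "B * G + B * G = - (q * w)" by (simp add: mult.assoc KG id)
      have skew: "w * (G * A2 + tp A2 * G) * w = 0"
      proof -
        have "w * (G * A2 + tp A2 * G) * w = G * (A2 * w) + tp (A2 * w) * G"
          by (simp add: algebra_simps hs id)
        also have "\<dots> = 0" using E(2,4) by (simp add: G)
        finally show ?thesis .
      qed
      have Y: "F * A2 - A2 * F - (B * G + B * G) = - p - q * (m - w)"
        using main unfolding BG by (simp add: algebra_simps As)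
      have p0: "entry p j i = 0" if "\<not> (j \<le> a \<and> a < i)" "(i, j) \<in> allowed n a c" for i j
      proof -
        have "entry (u * p) j i = entry p j i" "entry (p * u) j i = 0" by (simp_all add: As E)
        then show ?thesis using that by (auto simp: e allowed_def split: if_splits)
      qed
      have q0: "entry (q * (m - w)) j i = 0" if "\<not> (i \<le> c \<and> c < j)" "(i, j) \<in> allowed n a c" for i j
      proof -
        have "entry (w * q) j i = entry q j i" by (simp add: As)
        then show ?thesis using that by (auto simp: e allowed_def right_diff_distrib split: if_splits)
      qed
      have "\<forall>(i,j)\<in>allowed n a c. entry (F * A2 - A2 * F - (B * G + B * G)) j i = 0"
      proof clarify
        fix i j assume al: "(i, j) \<in> allowed n a c"
        then have "entry p j i = 0" "entry (q * (m - w)) j i = 0"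
          using p0 q0 by (auto simp: allowed_def)
        then show "entry (F * A2 - A2 * F - (B * G + B * G)) j i = 0" unfolding Y by simp
      qed
      then have z: "A2 = 0" "B = 0" using nd' A2 B skew by blast+
      have qw: "q * w = 0" using BG z(2) by simp
      have pq: "p + q = 0" using main z(1) by simp
      then have p: "p = - q" by (simp add: eq_neg_iff_add_eq_0)
      have "p * w = 0" using qw p by simp
      moreover have "p \<in> hom m w" using A(5) p hom_uminus by blast
      ultimately have "p = 0" using disj[OF A(4)] E(3) by blast
      then have "p = 0" "q = 0" using p by simp_all
      then show ?thesis using z E(1,2) by auto
    qed
    then have "reg u m w u w G 0 F 0"
      unfolding reg_def using idw form F id by (auto intro!: homI simp: hom_zero ids)
    then show "\<exists>F G. reg u m w u w G 0 F 0" by blast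
  qed
qed

section \<open>Block form of the seaweed and its bracket\<close>

lemma tr_tp [simp]: "tr (tp A) = tr A"
  by (simp add: tr_def)

lemma tr_times_single: "tr (A * single i j c) = entry A j i * c"
  by (subst tr_eq[of "{j}"]) (auto simp: entry_times_single split: if_splits)

text \<open>Reversing the columns of the upper right block turns symmetry about the antidiagonal
  into ordinary symmetry, so that \<open>B\<close> can be treated as a symmetric matrix.\<close>

definition emb :: "nat \<Rightarrow> 'k::field fin_mat \<Rightarrow> 'k fin_mat \<Rightarrow> 'k matrix" where
  "emb n A B = (\<lambda>i j.
     if i \<in> {1..n} \<and> j \<in> {1..n} then entry A i j
     else if i \<in> {1..n} \<and> j \<in> {n+1..2*n} then entry B i (2*n+1-j)
     else if i \<in> {n+1..2*n} \<and> j \<in> {n+1..2*n} then - entry A (2*n+1-j) (2*n+1-i)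
     else 0)"

lemma emb_simps:
  "i \<in> {1..n} \<Longrightarrow> j \<in> {1..n} \<Longrightarrow> emb n A B i j = entry A i j"
  "i \<in> {1..n} \<Longrightarrow> j \<in> {n+1..2*n} \<Longrightarrow> emb n A B i j = entry B i (2*n+1-j)"
  "i \<in> {n+1..2*n} \<Longrightarrow> j \<in> {1..n} \<Longrightarrow> emb n A B i j = 0"
  "i \<in> {n+1..2*n} \<Longrightarrow> j \<in> {n+1..2*n} \<Longrightarrow> emb n A B i j = - entry A (2*n+1-j) (2*n+1-i)"
  "i \<notin> {1..2*n} \<or> j \<notin> {1..2*n} \<Longrightarrow> emb n A B i j = 0"
  by (auto simp: emb_def)

definition seaweed_mats :: "nat \<Rightarrow> nat \<Rightarrow> nat \<Rightarrow> 'k::field matrix set" where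
  "seaweed_mats n a c = {X \<in> sp n. \<forall>i j. (j \<le> a \<and> a < i \<or> j \<le> n \<and> n < i \<or> i \<le> c \<and> c < j) \<longrightarrow> X i j = 0}"

lemma range_cases:
  fixes i j n :: nat
  obtains "i \<notin> {1..2*n} \<or> j \<notin> {1..2*n}" | "i \<in> {1..n}" "j \<in> {1..n}" | "i \<in> {1..n}" "j \<in> {n+1..2*n}"
      | "i \<in> {n+1..2*n}" "j \<in> {1..n}" | "i \<in> {n+1..2*n}" "j \<in> {n+1..2*n}"
  by (fastforce simp: not_le)

lemma emb_in_seaweed_mats:
  assumes "a < n" "c \<le> n" and A: "A \<in> gl_part n a c" and B: "B \<in> sym_part n c"
  shows "emb n A B \<in> seaweed_mats n a c"
proof -
  have tB: "entry B i j = entry B j i" for i j using B unfolding sym_part_def by (metis (mono_tags) entry_tp mem_Collect_eq)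
  have A0: "entry A i j = 0" if "(i, j) \<notin> allowed n a c" for i j using A that unfolding gl_part_def by blast
  have B0: "entry B i j = 0" if "i \<le> c" for i j using B that unfolding sym_part_def by force
  have "emb n A B \<in> square_mats (2*n)" unfolding square_mats_def using emb_simps(5) by blast
  moreover have "emb n A B i j = - (sg n i * sg n j * emb n A B (2*n+1-j) (2*n+1-i))"
    if ij: "i \<in> {1..2*n}" "j \<in> {1..2*n}" for i j
  proof (rule range_cases[of i n j])
    assume "i \<notin> {1..2*n} \<or> j \<notin> {1..2*n}" then show ?thesis using ij by blast
  next
    assume *: "i \<in> {1..n}" "j \<in> {1..n}"
    then have r: "2*n+1-j \<in> {n+1..2*n}" "2*n+1-i \<in> {n+1..2*n}" "2*n+1-(2*n+1-i) = i" "2*n+1-(2*n+1-j) = j" by auto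
    show ?thesis unfolding emb_simps(1)[OF *] emb_simps(4)[OF r(1,2)] r(3,4) using * by (simp add: sg_def)
  next
    assume *: "i \<in> {1..n}" "j \<in> {n+1..2*n}"
    then have r: "2*n+1-j \<in> {1..n}" "2*n+1-i \<in> {n+1..2*n}" "2*n+1-(2*n+1-i) = i" by auto
    show ?thesis unfolding emb_simps(2)[OF *] emb_simps(2)[OF r(1,2)] r(3) using * tB[of i] by (simp add: sg_def)
  next
    assume *: "i \<in> {n+1..2*n}" "j \<in> {1..n}"
    then have r: "2*n+1-j \<in> {n+1..2*n}" "2*n+1-i \<in> {1..n}" by auto
    show ?thesis unfolding emb_simps(3)[OF *] emb_simps(3)[OF r(1,2)] by simp
  next
    assume *: "i \<in> {n+1..2*n}" "j \<in> {n+1..2*n}"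
    then have r: "2*n+1-j \<in> {1..n}" "2*n+1-i \<in> {1..n}" by auto
    show ?thesis unfolding emb_simps(4)[OF *] emb_simps(1)[OF r(1,2)] using * by (simp add: sg_def)
  qed
  moreover have "emb n A B i j = 0" if h: "j \<le> a \<and> a < i \<or> j \<le> n \<and> n < i \<or> i \<le> c \<and> c < j" for i j
  proof (rule range_cases[of i n j])
    assume "i \<in> {1..n}" "j \<in> {1..n}"
    then show ?thesis using h A0[of i j] by (auto simp: emb_simps allowed_def)
  next
    assume *: "i \<in> {1..n}" "j \<in> {n+1..2*n}"
    then have "i \<le> c" using h assms by auto
    then show ?thesis unfolding emb_simps(2)[OF *] by (rule B0)
  next
    assume "i \<in> {n+1..2*n}" "j \<in> {n+1..2*n}"
    then show ?thesis using h assms by auto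
  qed (auto simp: emb_simps)
  ultimately show ?thesis unfolding seaweed_mats_def sp_iff by blast
qed

lemma seaweed_mats_eq_emb:
  assumes X: "X \<in> seaweed_mats n a c" and "a < n" "c \<le> n"
  obtains A B where "A \<in> gl_part n a c" "B \<in> sym_part n c" "X = emb n A B"
proof -
  have sp: "X \<in> sp n" and X0: "\<And>i j. j \<le> a \<and> a < i \<or> j \<le> n \<and> n < i \<or> i \<le> c \<and> c < j \<Longrightarrow> X i j = 0"
    using X unfolding seaweed_mats_def by blast+
  define A where "A = mk_mat (\<lambda>i j. if i \<in> {1..n} \<and> j \<in> {1..n} then X i j else 0)"
  define B where "B = mk_mat (\<lambda>i j. if i \<in> {1..n} \<and> j \<in> {1..n} then X i (2*n+1-j) else 0)"
  have eA: "entry A i j = (if i \<in> {1..n} \<and> j \<in> {1..n} then X i j else 0)" for i j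
    unfolding A_def by (subst entry_mk[of "{1..n}"]) (auto split: if_splits)
  have eB: "entry B i j = (if i \<in> {1..n} \<and> j \<in> {1..n} then X i (2*n+1-j) else 0)" for i j
    unfolding B_def by (subst entry_mk[of "{1..n}"]) (auto split: if_splits)
  have tB: "entry B i j = entry B j i" for i j
  proof (cases "i \<in> {1..n} \<and> j \<in> {1..n}")
    case True
    then have "i \<in> {1..2*n}" "2*n+1-j \<in> {1..2*n}" "2*n+1-(2*n+1-j) = j" by auto
    then show ?thesis using True sp_reflect[OF sp, of i "2*n+1-j"] by (auto simp: eB sg_def)
  qed (auto simp: eB)
  have "A \<in> gl_part n a c"
    unfolding gl_part_def allowed_def using X0 by (auto simp: eA split: if_splits)
  moreover have "B \<in> sym_part n c"
    unfolding sym_part_def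
  proof (intro CollectI conjI allI impI)
    show "tp B = B" by (rule fin_mat_eqI) (use tB in simp)
    have *: "i \<in> {c+1..n}" if "entry B i j \<noteq> 0" for i j
    proof -
      have "i \<in> {1..n}" "j \<in> {1..n}" "X i (2*n+1-j) \<noteq> 0" using that by (auto simp: eB split: if_splits)
      moreover have "2*n+1-j > c" using assms \<open>j \<in> {1..n}\<close> by auto
      ultimately have "\<not> i \<le> c" using X0 by blast
      then show ?thesis using \<open>i \<in> {1..n}\<close> by auto
    qed
    fix i j assume "entry B i j \<noteq> 0"
    then show "i \<in> {c+1..n}" "j \<in> {c+1..n}" using *[of i j] *[of j i] tB[of i j] by auto
  qed
  moreover have "X = emb n A B"
  proof (intro ext)
    fix i j
    show "X i j = emb n A B i j"
    proof (rule range_cases[of i n j])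
      assume "i \<notin> {1..2*n} \<or> j \<notin> {1..2*n}"
      then show ?thesis using sp_range[OF sp] emb_simps(5) by metis
    next
      assume "i \<in> {1..n}" "j \<in> {1..n}" then show ?thesis by (simp add: emb_simps eA)
    next
      assume *: "i \<in> {1..n}" "j \<in> {n+1..2*n}"
      then have "2*n+1-j \<in> {1..n}" "2*n+1-(2*n+1-j) = j" by auto
      then show ?thesis unfolding emb_simps(2)[OF *] using * by (simp add: eB)
    next
      assume *: "i \<in> {n+1..2*n}" "j \<in> {1..n}" then show ?thesis using X0 by (simp add: emb_simps)
    next
      assume *: "i \<in> {n+1..2*n}" "j \<in> {n+1..2*n}"
      then have r: "2*n+1-j \<in> {1..n}" "2*n+1-i \<in> {1..n}" "i \<in> {1..2*n}" "j \<in> {1..2*n}" 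
        and s: "sg n i = (- 1 :: 'a)" "sg n j = (- 1 :: 'a)" by (auto simp: sg_def)
      have "X i j = - X (2*n+1-j) (2*n+1-i)" using sp_reflect[OF sp r(3,4)] s by simp
      then show ?thesis unfolding emb_simps(4)[OF *] using r by (simp add: eA)
    qed
  qed
  ultimately show ?thesis using that by blast
qed

lemma part_support:
  assumes "X \<in> gl_part n a c \<or> X \<in> sym_part n c" "\<not> (i \<in> {1..n} \<and> j \<in> {1..n})"
  shows "entry X i j = 0"
proof (rule ccontr)
  assume "entry X i j \<noteq> 0"
  then have "(i, j) \<in> allowed n a c \<or> i \<in> {c+1..n} \<and> j \<in> {c+1..n}"
    using assms(1) unfolding gl_part_def sym_part_def by blast
  then show False using assms(2) by (auto simp: allowed_def)
qed

lemma emb_inject: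
  assumes "A \<in> gl_part n a c" "B \<in> sym_part n c" "A' \<in> gl_part n a c" "B' \<in> sym_part n c"
    and e: "\<And>i j. i \<in> {1..n} \<Longrightarrow> j \<in> {1..n} \<Longrightarrow> emb n A B i j = emb n A' B' i j"
      "\<And>i j. i \<in> {1..n} \<Longrightarrow> j \<in> {n+1..2*n} \<Longrightarrow> emb n A B i j = emb n A' B' i j"
  shows "A = A'" "B = B'"
proof -
  have A0: "entry A i j = 0" "entry A' i j = 0" "entry B i j = 0" "entry B' i j = 0"
    if "\<not> (i \<in> {1..n} \<and> j \<in> {1..n})" for i j
    using part_support[of _ n a c i j] assms(1-4) that by blast+
  show "A = A'"
  proof (rule fin_mat_eqI)
    fix i j show "entry A i j = entry A' i j"
      using e(1)[of i j] A0[of i j] by (cases "i \<in> {1..n} \<and> j \<in> {1..n}") (simp_all add: emb_simps(1))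
  qed
  show "B = B'"
  proof (rule fin_mat_eqI)
    fix i j show "entry B i j = entry B' i j"
    proof (cases "i \<in> {1..n} \<and> j \<in> {1..n}")
      case True
      then have *: "i \<in> {1..n}" "2*n+1-j \<in> {n+1..2*n}" "2*n+1-(2*n+1-j) = j" by auto
      then show ?thesis using e(2)[OF *(1,2)] unfolding emb_simps(2)[OF *(1,2)] *(3) by simp
    qed (use A0 in simp)
  qed
qed

lemma lie_subalgebra_Int:
  "gl.lie_subalgebra N S \<Longrightarrow> gl.lie_subalgebra N T \<Longrightarrow> gl.lie_subalgebra N (S \<inter> T)"
  unfolding gl.lie_subalgebra_def gl.subspace_def by auto

lemma seaweed_mats_subalgebra:
  assumes "0 < a" "a < n" "0 < c" "c \<le> n"
  shows "gl.lie_subalgebra (2*n) (seaweed_mats n a c :: 'k::field_char_0 matrix set)"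
proof -
  have "seaweed_mats n a c = flag_stabilizer n {a, n} \<inter> mtr ` (flag_stabilizer n {c} :: 'k matrix set)"
    unfolding seaweed_mats_def by (auto simp: flag_stabilizer_def mtr_image_iff mtr_sp) (auto simp: mtr_def)
  moreover have "gl.lie_subalgebra (2*n) (mtr ` (flag_stabilizer n {c} :: 'k matrix set))"
    unfolding mtr_subalgebra by (rule flag_stabilizer_subalgebra)
  moreover have "gl.lie_subalgebra (2*n) (flag_stabilizer n {a, n} :: 'k matrix set)"
    by (rule flag_stabilizer_subalgebra)
  ultimately show ?thesis using lie_subalgebra_Int by metis
qed

lemma gl_part_mult: "A \<in> gl_part n a c \<Longrightarrow> A' \<in> gl_part n a c \<Longrightarrow> A * A' \<in> gl_part n a c"
proof -
  assume A: "A \<in> gl_part n a c" "A' \<in> gl_part n a c"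
  have "(i, j) \<in> allowed n a c" if "entry (A * A') i j \<noteq> 0" for i j
  proof -
    have "(\<Sum>k\<in>{k. entry A i k \<noteq> 0}. entry A i k * entry A' k j) \<noteq> 0"
      using that by (subst (asm) entry_times[OF finite_row]) auto
    then obtain k where "entry A i k * entry A' k j \<noteq> 0" by (rule sum.not_neutral_contains_not_neutral)
    then have "entry A i k \<noteq> 0" "entry A' k j \<noteq> 0" by auto
    then have "(i, k) \<in> allowed n a c" "(k, j) \<in> allowed n a c" using A unfolding gl_part_def by blast+
    then show ?thesis unfolding allowed_def by auto
  qed
  then show ?thesis unfolding gl_part_def by blast
qed

lemma gl_part_diff: "A \<in> gl_part n a c \<Longrightarrow> A' \<in> gl_part n a c \<Longrightarrow> A - A' \<in> gl_part n a c"
  unfolding gl_part_def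
proof (intro CollectI allI impI)
  fix i j
  assume A: "A \<in> {A. \<forall>i j. entry A i j \<noteq> 0 \<longrightarrow> (i, j) \<in> allowed n a c}"
    "A' \<in> {A. \<forall>i j. entry A i j \<noteq> 0 \<longrightarrow> (i, j) \<in> allowed n a c}" and "entry (A - A') i j \<noteq> 0"
  then have "entry A i j \<noteq> 0 \<or> entry A' i j \<noteq> 0" by auto
  then show "(i, j) \<in> allowed n a c" using A by blast
qed

lemma zero_part: "0 \<in> gl_part n a c" "0 \<in> sym_part n c"
  by (simp_all add: gl_part_def sym_part_def)

text \<open>The bracket is known to lie in the seaweed, hence equals some
  \<open>emb n A2 B2\<close>, and only the two upper blocks have to be computed. After the column
  reversal the action of \<open>A\<close> on \<open>B'\<close> reads
  \<open>A * B' + B' * tp A\<close>.\<close>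

lemma emb_commutator:
  fixes A :: "'k::field_char_0 fin_mat"
  assumes n: "0 < a" "a < n" "0 < c" "c \<le> n"
    and A: "A \<in> gl_part n a c" "B \<in> sym_part n c" and A': "A' \<in> gl_part n a c" "B' \<in> sym_part n c"
  obtains A2 B2 where "A2 \<in> gl_part n a c" "B2 \<in> sym_part n c"
    "commutator (2*n) (emb n A B) (emb n A' B') = emb n A2 B2"
    "A2 = A * A' - A' * A" "B2 = A * B' + B' * tp A - A' * B - B * tp A'"
proof -
  let ?C = "commutator (2*n) (emb n A B) (emb n A' B')"
  have "?C \<in> seaweed_mats n a c"
    using seaweed_mats_subalgebra[OF n, where 'k='k] emb_in_seaweed_mats[OF n(2,4) A] emb_in_seaweed_mats[OF n(2,4) A']
    unfolding gl.lie_subalgebra_def by blast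
  then obtain A2 B2 where AB: "A2 \<in> gl_part n a c" "B2 \<in> sym_part n c" "?C = emb n A2 B2"
    by (rule seaweed_mats_eq_emb[OF _ n(2,4)])
  note supp = part_support[of _ n a c]
  have split: "(\<Sum>k=1..2*n. f k) = (\<Sum>k=1..n. f k) + (\<Sum>k=n+1..2*n. f k)" for f :: "nat \<Rightarrow> 'k"
    using sum.ub_add_nat[of 1 n f n] by (simp add: mult_2)
  have rev: "(\<Sum>k=n+1..2*n. f k) = (\<Sum>k=1..n. f (2*n+1-k))" for f :: "nat \<Rightarrow> 'k"
    by (rule sum.reindex_bij_witness[of _ "\<lambda>k. 2*n+1-k" "\<lambda>k. 2*n+1-k"]) auto
  have ent: "entry (X * Y) i j = (\<Sum>k=1..n. entry X i k * entry Y k j)"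
    if "X \<in> gl_part n a c \<or> X \<in> sym_part n c" for X Y :: "'k fin_mat" and i j
    by (rule entry_times) (use supp[of X] that in auto)
  have m11: "mat_mult (2*n) (emb n X1 Y1) (emb n X2 Y2) i j = entry (X1 * X2) i j"
    if "i \<in> {1..n}" "j \<in> {1..n}" "X1 \<in> gl_part n a c" for X1 X2 Y1 Y2 :: "'k fin_mat" and i j
  proof -
    have "(\<Sum>k=n+1..2*n. emb n X1 Y1 i k * emb n X2 Y2 k j) = 0"
      by (rule sum.neutral, rule ballI) (simp only: emb_simps(3)[OF _ that(2)] mult_zero_right)
    moreover have "(\<Sum>k=1..n. emb n X1 Y1 i k * emb n X2 Y2 k j) = (\<Sum>k=1..n. entry X1 i k * entry X2 k j)"
      by (rule sum.cong) (use that in \<open>auto simp: emb_simps\<close>)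
    ultimately show ?thesis unfolding mat_mult_def split using ent[of X1 X2] that by simp
  qed
  have m12: "mat_mult (2*n) (emb n X1 Y1) (emb n X2 Y2) i (2*n+1-j) = entry (X1 * Y2) i j - entry (Y1 * tp X2) i j"
    if "i \<in> {1..n}" "j \<in> {1..n}" "X1 \<in> gl_part n a c" "Y1 \<in> sym_part n c" for X1 X2 Y1 Y2 :: "'k fin_mat" and i j
  proof -
    have j: "2*n+1-j \<in> {n+1..2*n}" "2*n+1-(2*n+1-j) = j" using that by auto
    have "(\<Sum>k=1..n. emb n X1 Y1 i k * emb n X2 Y2 k (2*n+1-j)) = (\<Sum>k=1..n. entry X1 i k * entry Y2 k j)"
      by (rule sum.cong[OF refl]) (simp only: emb_simps(1)[OF that(1)] emb_simps(2)[OF _ j(1)] j(2))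
    moreover have "(\<Sum>k=n+1..2*n. emb n X1 Y1 i k * emb n X2 Y2 k (2*n+1-j)) = - (\<Sum>k=1..n. entry Y1 i k * entry (tp X2) k j)"
      unfolding rev sum_negf[symmetric]
    proof (rule sum.cong[OF refl])
      fix k assume "k \<in> {1..n}"
      then have k: "2*n+1-k \<in> {n+1..2*n}" "2*n+1-(2*n+1-k) = k" by auto
      show "emb n X1 Y1 i (2*n+1-k) * emb n X2 Y2 (2*n+1-k) (2*n+1-j) = - (entry Y1 i k * entry (tp X2) k j)"
        unfolding emb_simps(2)[OF that(1) k(1)] emb_simps(4)[OF k(1) j(1)] k(2) j(2) by simp
    qed
    ultimately show ?thesis unfolding mat_mult_def split using ent[of X1 Y2] ent[of Y1 "tp X2"] that by simp
  qed
  have e2: "emb n A2 B2 i j = mat_mult (2*n) (emb n A B) (emb n A' B') i j - mat_mult (2*n) (emb n A' B') (emb n A B) i j" for i j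
    unfolding AB(3)[symmetric] commutator_def by simp
  have "A2 = A * A' - A' * A"
  proof (rule fin_mat_eqI)
    fix i j
    have g: "A * A' - A' * A \<in> gl_part n a c" using gl_part_diff gl_part_mult A A' by blast
    show "entry A2 i j = entry (A * A' - A' * A) i j"
    proof (cases "i \<in> {1..n} \<and> j \<in> {1..n}")
      case True
      then have "entry A2 i j = emb n A2 B2 i j" by (simp add: emb_simps(1))
      then show ?thesis unfolding e2 using True A A' by (simp add: m11)
    next
      case False then show ?thesis using supp[of A2 i j] supp[of "A * A' - A' * A" i j] AB g by simp
    qed
  qed
  moreover have "B2 = A * B' + B' * tp A - A' * B - B * tp A'"
  proof (rule fin_mat_eqI)
    fix i j
    show "entry B2 i j = entry (A * B' + B' * tp A - A' * B - B * tp A') i j"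
    proof (cases "i \<in> {1..n} \<and> j \<in> {1..n}")
      case True
      then have j: "2*n+1-j \<in> {n+1..2*n}" "2*n+1-(2*n+1-j) = j" by auto
      have i: "i \<in> {1..n}" using True by blast
      have "entry B2 i j = emb n A2 B2 i (2*n+1-j)" unfolding emb_simps(2)[OF i j(1)] j(2) ..
      moreover have jj: "j \<in> {1..n}" using True by blast
      ultimately show ?thesis
        unfolding e2 m12[OF i jj A] m12[OF i jj A'] by simp
    next
      case False
      have z: "entry (X * Y) i j = 0" if "\<And>k. entry X i k = 0 \<or> entry Y k j = 0" for X Y :: "'k fin_mat"
        by (subst entry_times[of "{}"]) (use that in auto)
      have "entry (A * B') i j = 0" "entry (B' * tp A) i j = 0" "entry (A' * B) i j = 0" "entry (B * tp A') i j = 0"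
        by (rule z; use False supp[of A] supp[of B'] supp[of A'] supp[of B] A A' in auto)+
      then show ?thesis using False supp[of B2 i j] AB by simp
    qed
  qed
  ultimately show ?thesis using that AB by blast
qed

section \<open>Functionals as trace pairings\<close>

lemma sym_single: "i \<in> {c+1..n} \<Longrightarrow> j \<in> {c+1..n} \<Longrightarrow> single i j 1 + single j i 1 \<in> sym_part n c"
  by (auto simp: sym_part_def add.commute split: if_splits)

lemma gl_single: "(i, j) \<in> allowed n a c \<Longrightarrow> single i j 1 \<in> gl_part n a c"
  by (auto simp: gl_part_def split: if_splits)

lemma finite_allowed [simp]: "finite (allowed n a c)"
  by (rule finite_subset[of _ "{1..n} \<times> {1..n}"]) (auto simp: allowed_def)

lemma sum_single_entry:
  assumes "finite P" "\<And>i j. entry A i j \<noteq> 0 \<Longrightarrow> (i, j) \<in> P"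
  shows "(\<Sum>x\<in>P. entry A (fst x) (snd x) * entry (single (fst x) (snd x) 1) p q) = entry A p q"
proof -
  have "(\<Sum>x\<in>P. entry A (fst x) (snd x) * entry (single (fst x) (snd x) 1) p q)
    = (\<Sum>x\<in>P. if x = (p, q) then entry A p q else 0)"
    by (rule sum.cong) auto
  then show ?thesis using assms by (auto simp: sum.delta)
qed

text \<open>The second sum runs over ordered pairs and so meets each symmetric generator twice; on
  the diagonal the generator is itself doubled. Both cases call for the factor one half.\<close>

lemma emb_expand:
  fixes A :: "'k::field_char_0 fin_mat"
  assumes A: "A \<in> gl_part n a c" and B: "B \<in> sym_part n c"
  shows "emb n A B = (\<Sum>x\<in>allowed n a c. mat_scale (entry A (fst x) (snd x)) (emb n (single (fst x) (snd x) 1) 0))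
    + (\<Sum>x\<in>{c+1..n} \<times> {c+1..n}. mat_scale (entry B (fst x) (snd x) / 2)
        (emb n 0 (single (fst x) (snd x) 1 + single (snd x) (fst x) 1)))" (is "_ = ?S1 + ?S2")
proof (intro ext)
  fix i j
  have tB: "entry B i j = entry B j i" for i j using B unfolding sym_part_def by (metis (mono_tags) entry_tp mem_Collect_eq)
  have sA: "(\<Sum>x\<in>allowed n a c. entry A (fst x) (snd x) * entry (single (fst x) (snd x) 1) p q) = entry A p q" for p q
    by (rule sum_single_entry) (use A in \<open>auto simp: gl_part_def\<close>)
  have B0: "entry B p q \<noteq> 0 \<Longrightarrow> (p, q) \<in> {c+1..n} \<times> {c+1..n}" for p q
    using B unfolding sym_part_def by blast
  have sB1: "(\<Sum>x\<in>{c+1..n} \<times> {c+1..n}. entry B (fst x) (snd x) * entry (single (fst x) (snd x) 1) p q) = entry B p q" for p q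
    by (rule sum_single_entry) (use B0 in auto)
  have "(\<Sum>x\<in>{c+1..n} \<times> {c+1..n}. entry B (fst x) (snd x) * entry (single (snd x) (fst x) 1) p q)
    = (\<Sum>x\<in>{c+1..n} \<times> {c+1..n}. entry B (fst x) (snd x) * entry (single (fst x) (snd x) 1) q p)" for p q
    by (rule sum.cong) auto
  then have sB2: "(\<Sum>x\<in>{c+1..n} \<times> {c+1..n}. entry B (fst x) (snd x) * entry (single (snd x) (fst x) 1) p q) = entry B p q" for p q
    using sB1 tB by simp
  have sB: "(\<Sum>x\<in>{c+1..n} \<times> {c+1..n}. entry B (fst x) (snd x) / 2 * entry (single (fst x) (snd x) 1 + single (snd x) (fst x) 1) p q)
    = entry B p q" for p q
  proof -
    have "(\<Sum>x\<in>{c+1..n} \<times> {c+1..n}. entry B (fst x) (snd x) / 2 * entry (single (fst x) (snd x) 1 + single (snd x) (fst x) 1) p q)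
      = (\<Sum>x\<in>{c+1..n} \<times> {c+1..n}. (entry B (fst x) (snd x) * entry (single (fst x) (snd x) 1) p q
         + entry B (fst x) (snd x) * entry (single (snd x) (fst x) 1) p q) / 2)"
      by (rule sum.cong[OF refl]) (simp only: entry_plus distrib_left add_divide_distrib times_divide_eq_left)
    also have "\<dots> = entry B p q"
      unfolding sum_divide_distrib[symmetric] sum.distrib sB1 sB2 by simp
    finally show ?thesis .
  qed
  note e = plus_fun_apply sum_matrix_apply mat_scale_def
  show "emb n A B i j = (?S1 + ?S2) i j"
  proof (cases rule: range_cases[of i n j])
    case 1
    show ?thesis unfolding e emb_simps(5)[OF 1] by simp
  next
    case 2
    show ?thesis unfolding e emb_simps(1)[OF 2] sA by simp
  next
    case 3
    show ?thesis unfolding e emb_simps(2)[OF 3] sB by simp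
  next
    case 4
    show ?thesis unfolding e emb_simps(3)[OF 4] by simp
  next
    case 5
    show ?thesis unfolding e emb_simps(4)[OF 5] mult_minus_right sum_negf sA by simp
  qed
qed

lemma tr_mult_sum:
  assumes "finite P" "\<And>i j. entry A i j \<noteq> 0 \<Longrightarrow> (i, j) \<in> P"
  shows "tr (F * A) = (\<Sum>x\<in>P. entry F (snd x) (fst x) * entry A (fst x) (snd x))"
proof -
  obtain N where N: "\<And>i j. entry A i j \<noteq> 0 \<Longrightarrow> i < N \<and> j < N" using entry_bound by metis
  have "entry (F * A) j j = (\<Sum>i<N. entry F j i * entry A i j)" for j
    by (rule entry_times) (use N in auto)
  moreover have "tr (F * A) = (\<Sum>j<N. entry (F * A) j j)"
  proof (rule tr_eq)
    fix j assume "entry (F * A) j j \<noteq> 0"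
    then have "(\<Sum>i<N. entry F j i * entry A i j) \<noteq> 0" using calculation by simp
    then obtain i where "entry F j i * entry A i j \<noteq> 0" by (rule sum.not_neutral_contains_not_neutral)
    then show "j \<in> {..<N}" using N by auto
  qed simp
  ultimately have "tr (F * A) = (\<Sum>j<N. \<Sum>i<N. entry F j i * entry A i j)" by simp
  also have "\<dots> = (\<Sum>i<N. \<Sum>j<N. entry F j i * entry A i j)" by (rule sum.swap)
  also have "\<dots> = (\<Sum>x\<in>{..<N} \<times> {..<N}. entry F (snd x) (fst x) * entry A (fst x) (snd x))"
    by (simp add: sum.cartesian_product case_prod_beta)
  also have "\<dots> = (\<Sum>x\<in>P. entry F (snd x) (fst x) * entry A (fst x) (snd x))"
    by (rule sum.mono_neutral_cong) (use assms N in force)+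
  finally show ?thesis .
qed

text \<open>Modulo \<open>m\<close> the two numbers are opposite. The theorem applies this to
  \<open>a + (n - c)\<close> and \<open>b + c\<close>, whose sum is \<open>n + n\<close>.\<close>

lemma gcd_nat_eq_of_sum:
  fixes m x y :: nat
  assumes "x + y = m + m"
  shows "gcd m x = gcd m y"
proof -
  have "d dvd m \<and> d dvd x \<longleftrightarrow> d dvd m \<and> d dvd y" for d
    using assms by (metis dvd_add dvd_add_right_iff dvd_add_left_iff)
  then show ?thesis by (metis dvd_antisym gcd_dvd1 gcd_dvd2 gcd_greatest)
qed

lemma dual_of_sum:
  assumes f: "f \<in> gl.dual_of L" and L: "gl.subspace L" and "finite I" and x: "\<And>i. i \<in> I \<Longrightarrow> x i \<in> L"
  shows "f (\<Sum>i\<in>I. mat_scale (c i) (x i)) = (\<Sum>i\<in>I. c i * f (x i))"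
  using \<open>finite I\<close> x
proof (induction I rule: finite_induct)
  case empty
  have "f (mat_scale 0 0) = 0 * f 0"
    using f gl.subspace_0[OF L] unfolding gl.dual_of_def by blast
  moreover have "mat_scale 0 0 = (0 :: 'a matrix)" by (auto simp: mat_scale_def fun_eq_iff)
  ultimately have "f 0 = 0" by simp
  then show ?case by (simp only: sum.empty)
next
  case (insert i I)
  have xi: "x i \<in> L" and "\<And>j. j \<in> I \<Longrightarrow> x j \<in> L" using insert.prems by auto
  then have S: "(\<Sum>i\<in>I. mat_scale (c i) (x i)) \<in> L"
    by (intro gl.subspace_sum[OF L] gl.subspace_scale[OF L])
  have "f (mat_scale (c i) (x i) + (\<Sum>i\<in>I. mat_scale (c i) (x i))) = c i * f (x i) + f (\<Sum>i\<in>I. mat_scale (c i) (x i))"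
    using f xi S gl.subspace_scale[OF L xi] unfolding gl.dual_of_def by simp
  moreover have "f (\<Sum>i\<in>I. mat_scale (c i) (x i)) = (\<Sum>i\<in>I. c i * f (x i))"
    using insert.IH insert.prems by blast
  ultimately show ?case by (simp only: sum.insert[OF insert.hyps(1,2)])
qed

text \<open>Linearity of \<open>f\<close> is known on the seaweed only, so the matrices are read off
  from its values on the spanning elements of \<open>emb_expand\<close>.\<close>

lemma functional_as_trace:
  fixes f :: "'k::field_char_0 matrix \<Rightarrow> 'k"
  assumes n: "0 < a" "a < n" "0 < c" "c \<le> n" and f: "f \<in> gl.dual_of (seaweed_mats n a c)"
  obtains F G where "F \<in> hom (dg {1..n}) (dg {1..n})" "G \<in> hom (dg {c+1..n}) (dg {c+1..n})" "tp G = G"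
    "\<And>A B. A \<in> gl_part n a c \<Longrightarrow> B \<in> sym_part n c \<Longrightarrow> f (emb n A B) = tr (F * A) + tr (G * B)"
proof -
  define F where "F = mk_mat (\<lambda>j i. if (i, j) \<in> allowed n a c then f (emb n (single i j 1) 0) else 0)"
  \<comment> \<open>The trace of \<open>G * (single i j 1 + single j i 1)\<close> is twice
    \<open>entry G i j\<close>, hence the division by 2.\<close>
  define G where "G = mk_mat (\<lambda>j i. if i \<in> {c+1..n} \<and> j \<in> {c+1..n} then f (emb n 0 (single i j 1 + single j i 1)) / 2 else 0)"
  have eF: "entry F j i = (if (i, j) \<in> allowed n a c then f (emb n (single i j 1) 0) else 0)" for i j
    unfolding F_def by (subst entry_mk[of "{1..n}"]) (auto simp: allowed_def split: if_splits)
  have eG: "entry G j i = (if i \<in> {c+1..n} \<and> j \<in> {c+1..n} then f (emb n 0 (single i j 1 + single j i 1)) / 2 else 0)" for i j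
    unfolding G_def by (subst entry_mk[of "{c+1..n}"]) (auto split: if_splits)
  have L: "gl.subspace (seaweed_mats n a c :: 'k matrix set)"
    using seaweed_mats_subalgebra[OF n] unfolding gl.lie_subalgebra_def by blast
  have "F \<in> hom (dg {1..n}) (dg {1..n})" by (auto simp: hom_dg_iff eF allowed_def split: if_splits)
  moreover have "G \<in> hom (dg {c+1..n}) (dg {c+1..n})" by (auto simp: hom_dg_iff eG split: if_splits)
  moreover have "tp G = G" by (rule fin_mat_eqI) (auto simp: eG add.commute)
  moreover have "f (emb n A B) = tr (F * A) + tr (G * B)" if A: "A \<in> gl_part n a c" and B: "B \<in> sym_part n c" for A B
  proof -
    let ?S1 = "\<Sum>x\<in>allowed n a c. mat_scale (entry A (fst x) (snd x)) (emb n (single (fst x) (snd x) 1) 0)"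
    let ?S2 = "\<Sum>x\<in>{c+1..n} \<times> {c+1..n}. mat_scale (entry B (fst x) (snd x) / 2)
        (emb n 0 (single (fst x) (snd x) 1 + single (snd x) (fst x) 1))"
    have e1: "emb n (single (fst x) (snd x) 1) 0 \<in> (seaweed_mats n a c :: 'k matrix set)" if "x \<in> allowed n a c" for x
      using emb_in_seaweed_mats[OF n(2,4) gl_single zero_part(2)] that by (metis prod.collapse)
    have e2: "emb n 0 (single (fst x) (snd x) 1 + single (snd x) (fst x) 1) \<in> (seaweed_mats n a c :: 'k matrix set)"
      if "x \<in> {c+1..n} \<times> {c+1..n}" for x
      using emb_in_seaweed_mats[OF n(2,4) zero_part(1) sym_single] that by (metis mem_Times_iff)
    have S: "?S1 \<in> seaweed_mats n a c" "?S2 \<in> seaweed_mats n a c"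
      using e1 e2 by (intro gl.subspace_sum[OF L] gl.subspace_scale[OF L]; blast)+
    have "f (emb n A B) = f ?S1 + f ?S2"
      unfolding emb_expand[OF A B] using S f unfolding gl.dual_of_def by blast
    also have "f ?S1 = (\<Sum>x\<in>allowed n a c. entry A (fst x) (snd x) * f (emb n (single (fst x) (snd x) 1) 0))"
      by (rule dual_of_sum[OF f L finite_allowed e1])
    also have "\<dots> = (\<Sum>x\<in>allowed n a c. entry F (snd x) (fst x) * entry A (fst x) (snd x))"
      by (rule sum.cong) (auto simp: eF)
    also have "\<dots> = tr (F * A)"
      by (rule tr_mult_sum[symmetric]) (use A in \<open>auto simp: gl_part_def\<close>)
    also have "f ?S2 = (\<Sum>x\<in>{c+1..n} \<times> {c+1..n}. entry B (fst x) (snd x) / 2 * f (emb n 0 (single (fst x) (snd x) 1 + single (snd x) (fst x) 1)))"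
      by (rule dual_of_sum[OF f L _ e2]) auto
    also have "\<dots> = (\<Sum>x\<in>{c+1..n} \<times> {c+1..n}. entry G (snd x) (fst x) * entry B (fst x) (snd x))"
      by (rule sum.cong) (auto simp: eG)
    also have "\<dots> = tr (G * B)"
      by (rule tr_mult_sum[symmetric]) (use B in \<open>auto simp: sym_part_def\<close>)
    finally show ?thesis .
  qed
  ultimately show ?thesis using that by blast
qed

text \<open>Cyclicity of the trace moves \<open>A'\<close> and \<open>B'\<close> to the right;
  transposing the last term shows that it equals the one before it.\<close>

lemma bracket_trace:
  assumes G: "tp G = G" and B: "tp B = B" "tp B' = B'"
  shows "tr (F * (A * A' - A' * A)) + tr (G * (A * B' + B' * tp A - A' * B - B * tp A'))
    = tr ((F * A - A * F - (B * G + B * G)) * A') + tr ((G * A + tp A * G) * B')"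
proof -
  have "tr (F * (A' * A)) = tr (A * (F * A'))"
    using tr_mult_commute[of "F * A'" A] by (simp add: mult.assoc)
  moreover have "tr (G * (B' * tp A)) = tr (tp A * (G * B'))"
    using tr_mult_commute[of "G * B'" "tp A"] by (simp add: mult.assoc)
  moreover have "tr (G * (A' * B)) = tr (B * (G * A'))"
    using tr_mult_commute[of "G * A'" B] by (simp add: mult.assoc)
  moreover have "tr (G * (B * tp A')) = tr (B * (G * A'))"
    using tr_tp[of "G * (B * tp A')"] tr_mult_commute[of A' "B * G"] by (simp add: G B mult.assoc)
  ultimately show ?thesis by (simp add: algebra_simps)
qed

text \<open>\<open>A'\<close> and \<open>B'\<close> vary independently, so the two traces vanish
  separately. Testing on matrix units and symmetrized matrix units turns them into conditions on
  entries.\<close>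

lemma kernel_condition:
  fixes F :: "'k::field_char_0 fin_mat"
  assumes n: "0 < a" "a < n" "0 < c" "c \<le> n" and A: "A \<in> gl_part n a c" and B: "B \<in> sym_part n c"
    and G: "tp G = G"
    and f: "\<And>A B :: 'k fin_mat. A \<in> gl_part n a c \<Longrightarrow> B \<in> sym_part n c \<Longrightarrow> f (emb n A B) = tr (F * A) + tr (G * B)"
  shows "emb n A B \<in> gl.ker_B (2*n) (seaweed_mats n a c) f \<longleftrightarrow>
     dg {c+1..n} * (G * A + tp A * G) * dg {c+1..n} = 0 \<and>
     (\<forall>(i,j)\<in>allowed n a c. entry (F * A - A * F - (B * G + B * G)) j i = 0)"
proof -
  define Y where "Y = F * A - A * F - (B * G + B * G)"
  define Z where "Z = G * A + tp A * G"
  have Zs: "entry Z i j = entry Z j i" for i j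
  proof -
    have "tp Z = Z" by (simp add: Z_def G add.commute)
    then show ?thesis by (metis entry_tp)
  qed
  have fc: "f (commutator (2*n) (emb n A B) (emb n A' B')) = tr (Y * A') + tr (Z * B')"
    if A': "A' \<in> gl_part n a c" "B' \<in> sym_part n c" for A' B'
  proof -
    obtain A2 B2 where *: "A2 \<in> gl_part n a c" "B2 \<in> sym_part n c"
      "commutator (2*n) (emb n A B) (emb n A' B') = emb n A2 B2"
      "A2 = A * A' - A' * A" "B2 = A * B' + B' * tp A - A' * B - B * tp A'"
      using emb_commutator[OF n A B A'] .
    have "tp B = B" "tp B' = B'" using B A' by (auto simp: sym_part_def)
    then show ?thesis unfolding *(3) f[OF *(1,2)] unfolding *(4,5) Y_def Z_def
      by (rule bracket_trace[OF G])
  qed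
  have "emb n A B \<in> gl.ker_B (2*n) (seaweed_mats n a c) f \<longleftrightarrow>
    (\<forall>A'\<in>gl_part n a c. \<forall>B'\<in>sym_part n c. tr (Y * A') + tr (Z * B') = 0)"
  proof
    assume k: "emb n A B \<in> gl.ker_B (2*n) (seaweed_mats n a c) f"
    show "\<forall>A'\<in>gl_part n a c. \<forall>B'\<in>sym_part n c. tr (Y * A') + tr (Z * B') = 0"
    proof (intro ballI)
      fix A' B' :: "'k fin_mat" assume A': "A' \<in> gl_part n a c" "B' \<in> sym_part n c"
      show "tr (Y * A') + tr (Z * B') = 0"
        using k emb_in_seaweed_mats[OF n(2,4) A'] fc[OF A'] unfolding gl.ker_B_def by auto
    qed
  next
    assume h: "\<forall>A'\<in>gl_part n a c. \<forall>B'\<in>sym_part n c. tr (Y * A') + tr (Z * B') = 0"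
    have "f (commutator (2*n) (emb n A B) X) = 0" if X: "X \<in> seaweed_mats n a c" for X
    proof -
      obtain A' B' where A': "A' \<in> gl_part n a c" "B' \<in> sym_part n c" "X = emb n A' B'"
        using seaweed_mats_eq_emb[OF X n(2,4)] .
      then show ?thesis using fc[OF A'(1,2)] h by simp
    qed
    then show "emb n A B \<in> gl.ker_B (2*n) (seaweed_mats n a c) f"
      unfolding gl.ker_B_def using emb_in_seaweed_mats[OF n(2,4) A B] by blast
  qed
  also have "\<dots> \<longleftrightarrow> (\<forall>A'\<in>gl_part n a c. tr (Y * A') = 0) \<and> (\<forall>B'\<in>sym_part n c. tr (Z * B') = 0)"
  proof
    assume h: "\<forall>A'\<in>gl_part n a c. \<forall>B'\<in>sym_part n c. tr (Y * A') + tr (Z * B') = 0"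
    show "(\<forall>A'\<in>gl_part n a c. tr (Y * A') = 0) \<and> (\<forall>B'\<in>sym_part n c. tr (Z * B') = 0)"
    proof (intro conjI ballI)
      fix A' :: "'k fin_mat" assume "A' \<in> gl_part n a c"
      then have "tr (Y * A') + tr (Z * 0) = 0" using h zero_part(2) by blast
      then show "tr (Y * A') = 0" by simp
    next
      fix B' :: "'k fin_mat" assume "B' \<in> sym_part n c"
      then have "tr (Y * 0) + tr (Z * B') = 0" using h zero_part(1) by blast
      then show "tr (Z * B') = 0" by simp
    qed
  qed simp
  also have "(\<forall>A'\<in>gl_part n a c. tr (Y * A') = 0) \<longleftrightarrow> (\<forall>(i,j)\<in>allowed n a c. entry Y j i = 0)"
  proof
    assume h: "\<forall>A'\<in>gl_part n a c. tr (Y * A') = 0"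
    show "\<forall>(i,j)\<in>allowed n a c. entry Y j i = 0"
    proof clarify
      fix i j assume "(i, j) \<in> allowed n a c"
      then have "tr (Y * single i j 1) = 0" using h gl_single by blast
      then show "entry Y j i = 0" by (simp add: tr_times_single)
    qed
  next
    assume h: "\<forall>(i,j)\<in>allowed n a c. entry Y j i = 0"
    have "tr (Y * A') = (\<Sum>x\<in>allowed n a c. entry Y (snd x) (fst x) * entry A' (fst x) (snd x))"
      if "A' \<in> gl_part n a c" for A'
      by (rule tr_mult_sum) (use that in \<open>auto simp: gl_part_def\<close>)
    moreover have "(\<Sum>x\<in>allowed n a c. entry Y (snd x) (fst x) * entry A' (fst x) (snd x)) = 0" for A'
      by (rule sum.neutral) (use h in auto)
    ultimately show "\<forall>A'\<in>gl_part n a c. tr (Y * A') = 0" by simp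
  qed
  also have "(\<forall>B'\<in>sym_part n c. tr (Z * B') = 0) \<longleftrightarrow> dg {c+1..n} * Z * dg {c+1..n} = 0"
  proof
    assume h: "\<forall>B'\<in>sym_part n c. tr (Z * B') = 0"
    show "dg {c+1..n} * Z * dg {c+1..n} = 0"
    proof (rule fin_mat_eqI)
      fix i j
      have "entry Z i j = 0" if "i \<in> {c+1..n}" "j \<in> {c+1..n}"
      proof -
        have "tr (Z * (single i j 1 + single j i 1)) = 0" using h sym_single[OF that] by blast
        then have "2 * entry Z i j = 0" using Zs[of i j] by (simp add: distrib_left tr_times_single)
        then show ?thesis by simp
      qed
      then show "entry (dg {c+1..n} * Z * dg {c+1..n}) i j = entry 0 i j"
        by (auto simp: entry_dg_times entry_times_dg)
    qed
  next
    let ?w = "dg {c+1..n} :: 'k fin_mat"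
    assume h: "?w * Z * ?w = 0"
    show "\<forall>B'\<in>sym_part n c. tr (Z * B') = 0"
    proof
      fix B' :: "'k fin_mat" assume "B' \<in> sym_part n c"
      then have "B' \<in> hom ?w ?w" by (auto simp: hom_dg_iff sym_part_def)
      note hs = hom_simps[OF this]
      have "tr (Z * B') = tr (Z * ?w * B' * ?w)" using hs by (simp add: mult.assoc)
      also have "\<dots> = tr (?w * Z * ?w * B')" using tr_mult_commute[of "Z * ?w * B'" ?w] by (simp add: mult.assoc)
      finally show "tr (Z * B') = 0" unfolding h by simp
    qed
  qed
  finally show ?thesis unfolding Y_def Z_def by blast
qed

text \<open>As \<open>gl.dim\<close> is 0 on infinite-dimensional spaces as well, the finite
  spanning set is what makes dimension 0 mean a zero space.\<close>

lemma finite_dim_zero: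
  fixes K :: "'k::field matrix set"
  assumes "finite T" "K \<subseteq> gl.span T" "gl.dim K = 0"
  shows "K \<subseteq> {0}"
proof -
  obtain B where B: "B \<subseteq> K" "gl.independent B" "K \<subseteq> gl.span B" "card B = gl.dim K"
    using gl.basis_exists by blast
  then have "finite B" using gl.independent_span_bound[OF assms(1) B(2)] assms(2) by blast
  then have "B = {}" using B(4) assms(3) by simp
  then show ?thesis using B(3) by simp
qed

lemma lie_index_zero_iff:
  assumes n: "0 < a" "a < n" "0 < c" "c \<le> n"
  shows "gl.lie_index (2*n) (seaweed_mats n a c :: 'k::field_char_0 matrix set) = 0 \<longleftrightarrow>
    (\<exists>F G. F \<in> hom (dg {1..n}) (dg {1..n}) \<and> G \<in> hom (dg {c+1..n}) (dg {c+1..n}) \<and> tp G = G \<and> nondeg n a c F (G :: 'k fin_mat))"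
proof -
  let ?Q = "seaweed_mats n a c :: 'k matrix set"
  let ?T = "(\<lambda>x. emb n (single (fst x) (snd x) 1) 0) ` allowed n a c \<union>
    (\<lambda>x. emb n 0 (single (fst x) (snd x) 1 + single (snd x) (fst x) 1)) ` ({c+1..n} \<times> {c+1..n}) :: 'k matrix set"
  have span: "?Q \<subseteq> gl.span ?T"
  proof
    fix X assume "X \<in> ?Q"
    then obtain A B where AB: "A \<in> gl_part n a c" "B \<in> sym_part n c" "X = emb n A B"
      using seaweed_mats_eq_emb n by metis
    show "X \<in> gl.span ?T"
      unfolding AB(3) emb_expand[OF AB(1,2)]
      by (intro gl.span_add gl.span_sum gl.span_scale gl.span_base) auto
  qed
  have dim: "gl.dim (gl.ker_B (2*n) ?Q f) = 0 \<longleftrightarrow> gl.ker_B (2*n) ?Q f \<subseteq> {0}" for f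
  proof
    have "gl.ker_B (2*n) ?Q f \<subseteq> gl.span ?T" using span unfolding gl.ker_B_def by blast
    then show "gl.dim (gl.ker_B (2*n) ?Q f) = 0 \<Longrightarrow> gl.ker_B (2*n) ?Q f \<subseteq> {0}"
      by (intro finite_dim_zero[of ?T]) auto
    assume "gl.ker_B (2*n) ?Q f \<subseteq> {0}"
    then have "gl.ker_B (2*n) ?Q f \<subseteq> gl.span {}" by simp
    then show "gl.dim (gl.ker_B (2*n) ?Q f) = 0"
      using gl.dim_le_card[of "gl.ker_B (2*n) ?Q f" "{}"] by simp
  qed
  have "(\<lambda>_. 0) \<in> gl.dual_of ?Q" unfolding gl.dual_of_def by simp
  then have ex: "\<exists>d. \<exists>f\<in>gl.dual_of ?Q. d = gl.dim (gl.ker_B (2*n) ?Q f)" by blast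
  \<comment> \<open>The index is an attained minimum of natural numbers, so it is 0 exactly when
    some functional has a zero kernel.\<close>
  have least: "(LEAST d. P d) = 0 \<longleftrightarrow> P 0" if "\<exists>d. P d" for P :: "nat \<Rightarrow> bool"
    using LeastI_ex[OF that] Least_eq_0[of P] by auto
  have "gl.lie_index (2*n) ?Q = 0 \<longleftrightarrow> (\<exists>f\<in>gl.dual_of ?Q. 0 = gl.dim (gl.ker_B (2*n) ?Q f))"
    unfolding gl.lie_index_def by (rule least[OF ex])
  also have "\<dots> \<longleftrightarrow> (\<exists>f\<in>gl.dual_of ?Q. gl.ker_B (2*n) ?Q f \<subseteq> {0})" using dim by metis
  also have "\<dots> \<longleftrightarrow> (\<exists>F G. F \<in> hom (dg {1..n}) (dg {1..n}) \<and> G \<in> hom (dg {c+1..n}) (dg {c+1..n}) \<and> tp G = G \<and> nondeg n a c F (G :: 'k fin_mat))"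
  proof
    assume "\<exists>f\<in>gl.dual_of ?Q. gl.ker_B (2*n) ?Q f \<subseteq> {0}"
    then obtain f where f: "f \<in> gl.dual_of ?Q" "gl.ker_B (2*n) ?Q f \<subseteq> {0}" by blast
    obtain F G where FG: "F \<in> hom (dg {1..n}) (dg {1..n})" "G \<in> hom (dg {c+1..n}) (dg {c+1..n})" "tp G = G"
      "\<And>A B. A \<in> gl_part n a c \<Longrightarrow> B \<in> sym_part n c \<Longrightarrow> f (emb n A B) = tr (F * A) + tr (G * B)"
      using functional_as_trace[OF n f(1)] by blast
    have "nondeg n a c F G"
      unfolding nondeg_def
    proof (intro ballI impI)
      fix A B assume A: "A \<in> gl_part n a c" "B \<in> sym_part n c" and
        h: "dg {c+1..n} * (G * A + tp A * G) * dg {c+1..n} = 0 \<and>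
     (\<forall>(i,j)\<in>allowed n a c. entry (F * A - A * F - (B * G + B * G)) j i = 0)"
      have "emb n A B \<in> gl.ker_B (2*n) ?Q f" using kernel_condition[OF n A FG(3,4)] h by blast
      then have "emb n A B = 0" using f(2) by blast
      then have "emb n A B i j = emb n 0 0 i j" for i j by (simp add: emb_def)
      then show "A = 0 \<and> B = 0" using emb_inject[OF A zero_part(1) zero_part(2)] by blast
    qed
    then show "\<exists>F G. F \<in> hom (dg {1..n}) (dg {1..n}) \<and> G \<in> hom (dg {c+1..n}) (dg {c+1..n}) \<and> tp G = G \<and> nondeg n a c F (G :: 'k fin_mat)"
      using FG by blast
  next
    assume "\<exists>F G. F \<in> hom (dg {1..n}) (dg {1..n}) \<and> G \<in> hom (dg {c+1..n}) (dg {c+1..n}) \<and> tp G = G \<and> nondeg n a c F (G :: 'k fin_mat)"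
    then obtain F G :: "'k fin_mat" where FG: "F \<in> hom (dg {1..n}) (dg {1..n})" "G \<in> hom (dg {c+1..n}) (dg {c+1..n})"
      "tp G = G" "nondeg n a c F G" by blast
    \<comment> \<open>Reading column \<open>2*n+1 - snd x\<close> undoes the column reversal in
      \<open>emb\<close>, so that \<open>f\<close> becomes the pairing with \<open>F\<close> and
      \<open>G\<close>.\<close>
    define f where "f X = (\<Sum>x\<in>{1..n} \<times> {1..n}. entry F (snd x) (fst x) * X (fst x) (snd x)
      + entry G (snd x) (fst x) * X (fst x) (2*n+1 - snd x))" for X :: "'k matrix"
    have "f \<in> gl.dual_of ?Q"
      unfolding gl.dual_of_def f_def by (simp add: mat_scale_def sum.distrib distrib_left sum_distrib_left mult.left_commute)
    have fe: "f (emb n A B) = tr (F * A) + tr (G * B)" if A: "A \<in> gl_part n a c" and B: "B \<in> sym_part n c" for A B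
    proof -
      have "tr (F * A) = (\<Sum>x\<in>{1..n} \<times> {1..n}. entry F (snd x) (fst x) * entry A (fst x) (snd x))"
        by (rule tr_mult_sum) (use part_support[of A n a c] A in auto)
      moreover have "tr (G * B) = (\<Sum>x\<in>{1..n} \<times> {1..n}. entry G (snd x) (fst x) * entry B (fst x) (snd x))"
        by (rule tr_mult_sum) (use part_support[of B n a c] B in auto)
      moreover have "f (emb n A B) = (\<Sum>x\<in>{1..n} \<times> {1..n}. entry F (snd x) (fst x) * entry A (fst x) (snd x)
        + entry G (snd x) (fst x) * entry B (fst x) (snd x))"
        unfolding f_def
      proof (rule sum.cong[OF refl])
        fix x assume x: "x \<in> {1..n} \<times> {1..n}"
        then have i: "fst x \<in> {1..n}" "snd x \<in> {1..n}" "2*n+1 - snd x \<in> {n+1..2*n}" "2*n+1-(2*n+1 - snd x) = snd x" by auto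
        show "entry F (snd x) (fst x) * emb n A B (fst x) (snd x) + entry G (snd x) (fst x) * emb n A B (fst x) (2*n+1 - snd x)
          = entry F (snd x) (fst x) * entry A (fst x) (snd x) + entry G (snd x) (fst x) * entry B (fst x) (snd x)"
          unfolding emb_simps(1)[OF i(1,2)] emb_simps(2)[OF i(1,3)] i(4) ..
      qed
      ultimately show ?thesis by (simp add: sum.distrib)
    qed
    have "gl.ker_B (2*n) ?Q f \<subseteq> {0}"
    proof
      fix X assume X: "X \<in> gl.ker_B (2*n) ?Q f"
      then have "X \<in> ?Q" unfolding gl.ker_B_def by blast
      then obtain A B where AB: "A \<in> gl_part n a c" "B \<in> sym_part n c" "X = emb n A B"
        using seaweed_mats_eq_emb n by metis
      then have "A = 0 \<and> B = 0"
        using kernel_condition[OF n AB(1,2) FG(3) fe] X FG(4) unfolding nondeg_def by blast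
      then show "X \<in> {0}" using AB(3) by (auto simp: emb_def fun_eq_iff)
    qed
    then show "\<exists>f\<in>gl.dual_of ?Q. gl.ker_B (2*n) ?Q f \<subseteq> {0}" using \<open>f \<in> gl.dual_of ?Q\<close> by blast
  qed
  finally show ?thesis .
qed

theorem theorem5p3:
  fixes a b c n :: nat
  assumes "a > 0" and "b > 0" and "c > 0" and "n > 0" and "a + b = n" and "c \<le> n"
  shows "gl.lie_index (2 * n)
           (seaweed n [a, b] [c] :: 'k::{alg_closed_field, field_char_0} matrix set) = 0 \<longleftrightarrow>
         (c + 1 = n \<and> gcd (a + b) (b + c) = 1) \<or>
         (c + 2 = n \<and> gcd (a + b) (b + c) = 1) \<or>
         (c + 3 = n \<and> odd a \<and> odd b \<and> odd c \<and> gcd (a + b) (b + c) = 2)"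
proof -
  have n: "0 < a" "a < n" "0 < c" "c \<le> n" using assms by auto
  let ?R = "\<exists>F G. reg (dg {1..a}) (dg {1..n}) (dg {c+1..n}) (dg {1..a}) (dg {c+1..n}) G 0 F (0 :: 'k fin_mat)"
  have "gl.lie_index (2 * n) (seaweed n [a, b] [c] :: 'k matrix set) = 0 \<longleftrightarrow> ?R"
    unfolding seaweed_two_one[OF assms(1,2,3,5,6)] seaweed_mats_def[symmetric] lie_index_zero_iff[OF n] reg_iff_nondeg[OF n(2,4)] ..
  also have "\<dots> \<longleftrightarrow> num_cond a n (n - c)"
  proof
    assume ?R
    then have "regular_on (dg {1..a}) (dg {1..n}) (dg {c+1..n} :: 'k fin_mat)"
      unfolding regular_on_def by blast
    then show "num_cond a n (n - c)" by (subst (asm) regular_on_iff) (auto simp: tr_dg)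
  qed (rule reg_inclusions_exists[OF n])
  also have "\<dots> \<longleftrightarrow> (c + 1 = n \<and> gcd (a + b) (b + c) = 1) \<or> (c + 2 = n \<and> gcd (a + b) (b + c) = 1) \<or>
         (c + 3 = n \<and> odd a \<and> odd b \<and> odd c \<and> gcd (a + b) (b + c) = 2)"
  proof -
    have g: "gcd n (a + t) = gcd (a + b) (b + c)" if "n = c + t" for t
    proof -
      have "gcd n (a + t) = gcd n (b + c)"
      proof (rule gcd_nat_eq_of_sum)
        show "a + t + (b + c) = n + n" using that assms by simp
      qed
      then show ?thesis using assms by simp
    qed
    \<comment> \<open>\<open>num_cond\<close> has no parity clause: as \<open>a + b = c + 3\<close>
      is even, \<open>c\<close> is odd, then \<open>b\<close> because \<open>b + c\<close> is even,
      and finally \<open>a\<close>.\<close>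
    have odd: "odd a \<and> odd b \<and> odd c" if "gcd (a + b) (b + c) = 2" "n = c + 3"
    proof -
      have "even (a + b)" "even (b + c)" using that(1) by (metis gcd_dvd1, metis gcd_dvd2)
      then show ?thesis using that(2) assms by presburger
    qed
    consider "n = c" | "n = c + 1" | "n = c + 2" | "n = c + 3" | "n > c + 3" using n(4) by linarith
    then show ?thesis
    proof cases
      case 1 then show ?thesis using n unfolding num_cond_def by simp
    next
      case 2
      then have "n - c = 1" by simp
      then show ?thesis using 2 g[OF 2] unfolding num_cond_def by simp
    next
      case 3
      then have "n - c = 2" by simp
      then show ?thesis using 3 g[OF 3] unfolding num_cond_def by simp
    next
      case 4
      then have "n - c = 3" by simp
      then show ?thesis using 4 g[OF 4] odd[OF _ 4] unfolding num_cond_def by auto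
    next
      case 5
      then have "n - c > 3" "\<not> n \<le> c" "c + 1 \<noteq> n" "c + 2 \<noteq> n" "c + 3 \<noteq> n" by simp_all
      then show ?thesis unfolding num_cond_def by simp
    qed
  qed
  finally show ?thesis .
qed

end
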